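(* The categories $\mathrm{Tmon}$ of topological monoids and $\mathrm{Tgrp}$ of topological groups are $\mathrm{Top}_+$-complete and $\mathrm{Top}_+$-cocomplete; moreover, the forgetful functor $V\colon\mathrm{Tgrp}\to\mathrm{Tmon}$ preserves indexed colimits.
   Context: Spaces are $k$-spaces (compactly generated in the sense of Vogt), with products and function spaces given the $k$-topology. $\mathrm{Top}_+$ is the category of based $k$-spaces and based maps; it is closed symmetric monoidal under the smash product $\wedge$, with internal hom the space of based maps, and is therefore self-enriched. $\mathrm{Tmon}$ is the category of (associative, unital) topological monoids in $k$-spaces and continuous homomorphisms; $\mathrm{Tgrp}$ is its full subcategory of topological groups. The identity element serves as basepoint, and both categories are $\mathrm{Top}_+$-enriched by giving the set of homomorphisms $M\to N$ the subspace ($k$-)topology from the space of based maps $M\to N$. A $\mathrm{Top}_+$-enriched category $\mathcal R$ is $\mathrm{Top}_+$-complete (respectively $\mathrm{Top}_+$-cocomplete) if it admits all small indexed (= weighted) limits (respectively colimits) in the sense of Kelly: for every small $\mathrm{Top}_+$-category $\mathcal A$, every $\mathrm{Top}_+$-functor $D\colon\mathcal A\to\mathcal R$ and every weight $W\colon\mathcal A\to\mathrm{Top}_+$ (respectively $W\colon\mathcal A^{op}\to\mathrm{Top}_+$), there is an object $\{W,D\}$ (respectively $W\star D$) with isomorphisms in $\mathrm{Top}_+$, natural in $X$, $\mathcal R(X,\{W,D\})\cong[\mathcal A,\mathrm{Top}_+](W,\mathcal R(X,D(-)))$ (respectively $\mathcal R(W\star D,X)\cong[\mathcal A^{op},\mathrm{Top}_+](W,\mathcal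 R(D(-),X))$). *)

theory Defs
  imports "HOL-Analysis.Analysis" "HOL-Algebra.Group"
begin

unbundle cardinal_syntax

section \<open>Small sets\<close>

text \<open>
  Size is measured against a type \<open>'u\<close> playing the role of a Grothendieck universe: the small sets
  are those of cardinality below that of \<open>'u\<close>, and the last definition says that this cardinality
  is strongly inaccessible (uncountable, strong limit, regular).  Every small set is in bijection
  with a small set of elements of \<open>'u\<close>, so it is no restriction to carry small spaces and small
  index categories by subsets of \<open>'u\<close>.  HOL does not prove that such a type exists, in the same way
  as ZFC does not prove that a universe exists.
\<close>

definition small :: "'u itself \<Rightarrow> 'a set \<Rightarrow> bool" where
  "small u A \<longleftrightarrow> |A| <o |UNIV :: 'u set|"

definition universe_type :: "'u itself \<Rightarrow> bool" where
  "universe_type u \<longleftrightarrow>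
     uncountable (UNIV :: 'u set) \<and>
     (\<forall>A :: 'u set. small u A \<longrightarrow> small u (Pow A)) \<and>
     (\<forall>(A :: 'u set) (B :: 'u \<Rightarrow> 'u set).
        small u A \<and> (\<forall>a\<in>A. small u (B a)) \<longrightarrow> small u (\<Union>a\<in>A. B a))"


section \<open>Compactly generated spaces in the sense of Vogt\<close>

text \<open>
  A set is open in the k-topology iff its preimage under every continuous map from a compact
  Hausdorff space is open.  No separation axiom is imposed on the space itself, so this is
  not the library's \<open>k_space\<close>, which tests on compact subspaces.
\<close>

definition kopen :: "'u itself \<Rightarrow> 'a topology \<Rightarrow> 'a set \<Rightarrow> bool" where
  "kopen u X S \<longleftrightarrow> S \<subseteq> topspace X \<and>
     (\<forall>(K :: 'u topology) f.
        small u (topspace K) \<and> compact_space K \<and> Hausdorff_space K \<and> continuous_map K X f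
        \<longrightarrow> openin K {x \<in> topspace K. f x \<in> S})"

definition kify :: "'u itself \<Rightarrow> 'a topology \<Rightarrow> 'a topology" where
  "kify u X = topology (kopen u X)"

definition kspace :: "'u itself \<Rightarrow> 'a topology \<Rightarrow> bool" where
  "kspace u X \<longleftrightarrow> kify u X = X"

lemma istopology_kopen:
  fixes u :: "'u itself" and X :: "'a topology"
  shows "istopology (kopen u X)"
  unfolding istopology_def
proof (intro conjI allI impI)
  fix S T assume S: "kopen u X S" and T: "kopen u X T"
  show "kopen u X (S \<inter> T)"
    unfolding kopen_def
  proof (intro conjI allI impI)
    show "S \<inter> T \<subseteq> topspace X" using S by (auto simp: kopen_def)
    fix K :: "'u topology" and f
    assume A: "small u (topspace K) \<and> compact_space K \<and> Hausdorff_space K \<and> continuous_map K X f"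
    have "{x \<in> topspace K. f x \<in> S \<inter> T} = {x \<in> topspace K. f x \<in> S} \<inter> {x \<in> topspace K. f x \<in> T}"
      by auto
    then show "openin K {x \<in> topspace K. f x \<in> S \<inter> T}"
      using S T A by (simp add: kopen_def openin_Int)
  qed
next
  fix \<K> assume A: "\<forall>S\<in>\<K>. kopen u X S"
  show "kopen u X (\<Union>\<K>)"
    unfolding kopen_def
  proof (intro conjI allI impI)
    show "\<Union>\<K> \<subseteq> topspace X" using A by (auto simp: kopen_def)
    fix K :: "'u topology" and f
    assume B: "small u (topspace K) \<and> compact_space K \<and> Hausdorff_space K \<and> continuous_map K X f"
    have "{x \<in> topspace K. f x \<in> \<Union>\<K>} = (\<Union>S\<in>\<K>. {x \<in> topspace K. f x \<in> S})"
      by auto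
    moreover have "openin K (\<Union>S\<in>\<K>. {x \<in> topspace K. f x \<in> S})"
      using A B by (intro openin_Union) (auto simp: kopen_def)
    ultimately show "openin K {x \<in> topspace K. f x \<in> \<Union>\<K>}" by simp
  qed
qed

lemma openin_kify: "openin (kify u X) S \<longleftrightarrow> kopen u X S"
  unfolding kify_def by (simp add: istopology_kopen topology_inverse')

lemma topspace_kify [simp]:
  fixes u :: "'u itself" and X :: "'a topology"
  shows "topspace (kify u X) = topspace X"
proof
  show "topspace (kify u X) \<subseteq> topspace X"
    using openin_topspace[of "kify u X"] unfolding openin_kify kopen_def by blast
  have "{x \<in> topspace K. f x \<in> topspace X} = topspace K" if "continuous_map K X f"
    for K :: "'u topology" and f
    using that by (auto simp: continuous_map_def)
  then have "kopen u X (topspace X)" by (simp add: kopen_def)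
  then show "topspace X \<subseteq> topspace (kify u X)"
    by (metis openin_kify openin_subset)
qed


section \<open>Based k-spaces\<close>

record 'a based =
  btop :: "'a topology"
  bpt :: 'a

definition based_kspace :: "'u itself \<Rightarrow> 'a based \<Rightarrow> bool" where
  "based_kspace u X \<longleftrightarrow>
     kspace u (btop X) \<and> small u (topspace (btop X)) \<and> bpt X \<in> topspace (btop X)"

definition based_map :: "'a based \<Rightarrow> 'b based \<Rightarrow> ('a \<Rightarrow> 'b) \<Rightarrow> bool" where
  "based_map X Y f \<longleftrightarrow> continuous_map (btop X) (btop Y) f \<and> f (bpt X) = bpt Y"

definition based_iso :: "'a based \<Rightarrow> 'b based \<Rightarrow> ('a \<Rightarrow> 'b) \<Rightarrow> bool" where
  "based_iso X Y f \<longleftrightarrow> homeomorphic_map (btop X) (btop Y) f \<and> f (bpt X) = bpt Y"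

text \<open>A based map as a point of the mapping space is represented by its extensional version.\<close>

definition based_maps :: "'a based \<Rightarrow> 'b based \<Rightarrow> ('a \<Rightarrow> 'b) set" where
  "based_maps X Y = {f \<in> extensional (topspace (btop X)). based_map X Y f}"

text \<open>
  The internal hom: the k-topology associated with the topology with subbasis
  \<open>{f. f (h K) \<subseteq> U}\<close> for maps \<open>h : K \<rightarrow> X\<close> from compact Hausdorff spaces and \<open>U\<close> open in \<open>Y\<close>.
  (For non-Hausdorff \<open>X\<close>, testing on compact subsets of \<open>X\<close> instead would give a different
  topology.)  The whole set of maps is among these sets, by taking \<open>K\<close> empty.
\<close>

definition map_space :: "'u itself \<Rightarrow> 'a based \<Rightarrow> 'b based \<Rightarrow> ('a \<Rightarrow> 'b) based" where
  "map_space u X Y =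
     \<lparr>btop = kify u (topology_generated_by
        {{f \<in> based_maps X Y. f ` h ` topspace K \<subseteq> U} | (K :: 'u topology) h U.
           small u (topspace K) \<and> compact_space K \<and> Hausdorff_space K \<and>
           continuous_map K (btop X) h \<and> openin (btop Y) U}),
      bpt = (\<lambda>x\<in>topspace (btop X). bpt Y)\<rparr>"

text \<open>
  The smash product is the quotient of the product k-space collapsing the wedge to the basepoint.
  Its underlying set is represented by the pairs off the wedge together with the pair of
  basepoints; \<open>smash_proj\<close> is the quotient map onto it.
\<close>

definition kprod :: "'u itself \<Rightarrow> 'a topology \<Rightarrow> 'b topology \<Rightarrow> ('a \<times> 'b) topology" where
  "kprod u X Y = kify u (prod_topology X Y)"

definition smash_proj :: "'a based \<Rightarrow> 'b based \<Rightarrow> 'a \<times> 'b \<Rightarrow> 'a \<times> 'b" where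
  "smash_proj X Y p = (if fst p = bpt X \<or> snd p = bpt Y then (bpt X, bpt Y) else p)"

definition smash :: "'u itself \<Rightarrow> 'a based \<Rightarrow> 'b based \<Rightarrow> ('a \<times> 'b) based" where
  "smash u X Y =
     (let P = kprod u (btop X) (btop Y); q = smash_proj X Y in
      \<lparr>btop = topology (\<lambda>S. S \<subseteq> q ` topspace P \<and> openin P {p \<in> topspace P. q p \<in> S}),
       bpt = (bpt X, bpt Y)\<rparr>)"

lemma istopology_quotient:
  "istopology (\<lambda>S. S \<subseteq> q ` topspace P \<and> openin P {p \<in> topspace P. q p \<in> S})"
  unfolding istopology_def
proof (intro conjI allI impI)
  fix S T
  assume A: "S \<subseteq> q ` topspace P \<and> openin P {p \<in> topspace P. q p \<in> S}"
    and B: "T \<subseteq> q ` topspace P \<and> openin P {p \<in> topspace P. q p \<in> T}"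
  have "{p \<in> topspace P. q p \<in> S \<inter> T} = {p \<in> topspace P. q p \<in> S} \<inter> {p \<in> topspace P. q p \<in> T}"
    by auto
  with A B show "openin P {p \<in> topspace P. q p \<in> S \<inter> T}" by (simp add: openin_Int)
  from A show "S \<inter> T \<subseteq> q ` topspace P" by auto
next
  fix \<K> assume A: "\<forall>S\<in>\<K>. S \<subseteq> q ` topspace P \<and> openin P {p \<in> topspace P. q p \<in> S}"
  then show "\<Union>\<K> \<subseteq> q ` topspace P" by blast
  have "{p \<in> topspace P. q p \<in> \<Union>\<K>} = (\<Union>S\<in>\<K>. {p \<in> topspace P. q p \<in> S})" by auto
  moreover have "openin P (\<Union>S\<in>\<K>. {p \<in> topspace P. q p \<in> S})"
    using A by (intro openin_Union) auto
  ultimately show "openin P {p \<in> topspace P. q p \<in> \<Union>\<K>}" by simp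
qed

lemma openin_smash:
  "openin (btop (smash u X Y)) S \<longleftrightarrow>
     S \<subseteq> smash_proj X Y ` topspace (kprod u (btop X) (btop Y)) \<and>
     openin (kprod u (btop X) (btop Y))
       {p \<in> topspace (kprod u (btop X) (btop Y)). smash_proj X Y p \<in> S}"
  by (simp add: smash_def Let_def istopology_quotient topology_inverse')


section \<open>Categories and functors enriched in based k-spaces\<close>

text \<open>
  \<open>Cmp C a b c g f\<close> is the composite of \<open>g : b \<rightarrow> c\<close> with \<open>f : a \<rightarrow> b\<close>.  Based maps out of the unit
  object (the two-point space) are points, so identities are points of the hom spaces.
\<close>

record ('o, 'h) ecat =
  Obj :: "'o set"
  Hom :: "'o \<Rightarrow> 'o \<Rightarrow> 'h based"
  Cmp :: "'o \<Rightarrow> 'o \<Rightarrow> 'o \<Rightarrow> 'h \<Rightarrow> 'h \<Rightarrow> 'h"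
  Idn :: "'o \<Rightarrow> 'h"

abbreviation Mor :: "('o, 'h) ecat \<Rightarrow> 'o \<Rightarrow> 'o \<Rightarrow> 'h set" where
  "Mor C a b \<equiv> topspace (btop (Hom C a b))"

text \<open>
  In the third clause, composition is a based map on the smash product; the clause after it says
  that on all pairs, \<open>Cmp\<close> is this map composed with the quotient map.
\<close>

definition topp_category :: "'u itself \<Rightarrow> ('o, 'h) ecat \<Rightarrow> bool" where
  "topp_category u C \<longleftrightarrow>
     (\<forall>a\<in>Obj C. \<forall>b\<in>Obj C. based_kspace u (Hom C a b)) \<and>
     (\<forall>a\<in>Obj C. Idn C a \<in> Mor C a a) \<and>
     (\<forall>a\<in>Obj C. \<forall>b\<in>Obj C. \<forall>c\<in>Obj C.
        based_map (smash u (Hom C b c) (Hom C a b)) (Hom C a c) (\<lambda>(g, f). Cmp C a b c g f)) \<and>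
     (\<forall>a\<in>Obj C. \<forall>b\<in>Obj C. \<forall>c\<in>Obj C. \<forall>g\<in>Mor C b c. \<forall>f\<in>Mor C a b.
        Cmp C a b c g f = (case smash_proj (Hom C b c) (Hom C a b) (g, f) of
                             (g', f') \<Rightarrow> Cmp C a b c g' f')) \<and>
     (\<forall>a\<in>Obj C. \<forall>b\<in>Obj C. \<forall>f\<in>Mor C a b.
        Cmp C a a b f (Idn C a) = f \<and> Cmp C a b b (Idn C b) f = f) \<and>
     (\<forall>a\<in>Obj C. \<forall>b\<in>Obj C. \<forall>c\<in>Obj C. \<forall>d\<in>Obj C.
        \<forall>f\<in>Mor C a b. \<forall>g\<in>Mor C b c. \<forall>h\<in>Mor C c d.
        Cmp C a b d (Cmp C b c d h g) f = Cmp C a c d h (Cmp C a b c g f))"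

definition eop :: "('o, 'h) ecat \<Rightarrow> ('o, 'h) ecat" where
  "eop C = \<lparr>Obj = Obj C, Hom = (\<lambda>a b. Hom C b a),
            Cmp = (\<lambda>a b c g f. Cmp C c b a f g), Idn = Idn C\<rparr>"

record ('o, 'h, 'p, 'g) efun =
  fobj :: "'o \<Rightarrow> 'p"
  fmap :: "'o \<Rightarrow> 'o \<Rightarrow> 'h \<Rightarrow> 'g"

definition topp_functor ::
  "'u itself \<Rightarrow> ('o, 'h) ecat \<Rightarrow> ('p, 'g) ecat \<Rightarrow> ('o, 'h, 'p, 'g) efun \<Rightarrow> bool" where
  "topp_functor u A B F \<longleftrightarrow>
     topp_category u A \<and> topp_category u B \<and>
     (\<forall>a\<in>Obj A. fobj F a \<in> Obj B) \<and>
     (\<forall>a\<in>Obj A. \<forall>b\<in>Obj A. based_map (Hom A a b) (Hom B (fobj F a) (fobj F b)) (fmap F a b)) \<and>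
     (\<forall>a\<in>Obj A. fmap F a a (Idn A a) = Idn B (fobj F a)) \<and>
     (\<forall>a\<in>Obj A. \<forall>b\<in>Obj A. \<forall>c\<in>Obj A. \<forall>f\<in>Mor A a b. \<forall>g\<in>Mor A b c.
        fmap F a c (Cmp A a b c g f) =
          Cmp B (fobj F a) (fobj F b) (fobj F c) (fmap F b c g) (fmap F a b f))"

definition efun_comp ::
  "('p, 'g, 'q, 'k) efun \<Rightarrow> ('o, 'h, 'p, 'g) efun \<Rightarrow> ('o, 'h, 'q, 'k) efun" where
  "efun_comp G F = \<lparr>fobj = (\<lambda>a. fobj G (fobj F a)),
                    fmap = (\<lambda>a b f. fmap G (fobj F a) (fobj F b) (fmap F a b f))\<rparr>"

text \<open>
  The category of based k-spaces enriched in itself, on small spaces carried by subsets of an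
  arbitrary type \<open>'a\<close>.
\<close>

definition Topp :: "'u itself \<Rightarrow> ('a based, 'a \<Rightarrow> 'a) ecat" where
  "Topp u = \<lparr>Obj = {X. based_kspace u X}, Hom = map_space u,
             Cmp = (\<lambda>X Y Z g f. compose (topspace (btop X)) g f),
             Idn = (\<lambda>X. \<lambda>x\<in>topspace (btop X). x)\<rparr>"


section \<open>Indexed limits and colimits\<close>

text \<open>The based space \<open>[\<A>, Top\<^sub>+](W, G)\<close> of natural transformations, a subspace (with the
  k-topology) of the product of the mapping spaces from \<open>W a\<close> to \<open>G a\<close>.  The functors \<open>W\<close> and \<open>G\<close>
  may take values in based k-spaces carried by different types.\<close>

definition nat_trans_space :: "'u itself \<Rightarrow> ('o, 'h) ecat \<Rightarrow> ('o, 'h, 'a based, 'a \<Rightarrow> 'a) efun \<Rightarrow>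
    ('o, 'h, 'b based, 'b \<Rightarrow> 'b) efun \<Rightarrow> ('o \<Rightarrow> 'a \<Rightarrow> 'b) based" where
  "nat_trans_space u A W G =
     \<lparr>btop = kify u (subtopology
        (kify u (product_topology (\<lambda>a. btop (map_space u (fobj W a) (fobj G a))) (Obj A)))
        {\<alpha>. \<forall>a\<in>Obj A. \<forall>b\<in>Obj A. \<forall>f\<in>Mor A a b. \<forall>w\<in>topspace (btop (fobj W a)).
              fmap G a b f (\<alpha> a w) = \<alpha> b (fmap W a b f w)}),
      bpt = (\<lambda>a\<in>Obj A. bpt (map_space u (fobj W a) (fobj G a)))\<rparr>"

text \<open>The functors \<open>R(X, D -) : \<A> \<rightarrow> Top\<^sub>+\<close> and \<open>R(D -, X) : \<A>\<^sup>o\<^sup>p \<rightarrow> Top\<^sub>+\<close>.\<close>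

definition hom_to ::
  "('o, 'h) ecat \<Rightarrow> 'o \<Rightarrow> ('i, 'j, 'o, 'h) efun \<Rightarrow> ('i, 'j, 'h based, 'h \<Rightarrow> 'h) efun" where
  "hom_to R X D =
     \<lparr>fobj = (\<lambda>a. Hom R X (fobj D a)),
      fmap = (\<lambda>a b f. \<lambda>g\<in>Mor R X (fobj D a). Cmp R X (fobj D a) (fobj D b) (fmap D a b f) g)\<rparr>"

definition hom_from ::
  "('o, 'h) ecat \<Rightarrow> ('i, 'j, 'o, 'h) efun \<Rightarrow> 'o \<Rightarrow> ('i, 'j, 'h based, 'h \<Rightarrow> 'h) efun" where
  "hom_from R D X =
     \<lparr>fobj = (\<lambda>a. Hom R (fobj D a) X),
      fmap = (\<lambda>a b f. \<lambda>g\<in>Mor R (fobj D a) X. Cmp R (fobj D b) (fobj D a) X g (fmap D b a f))\<rparr>"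

text \<open>
  \<open>\<phi>\<close> exhibits \<open>L\<close> as the limit \<open>{W, D}\<close>: the \<open>\<phi> X : R(X, L) \<rightarrow> [\<A>, Top\<^sub>+](W, R(X, D -))\<close> are
  isomorphisms in \<open>Top\<^sub>+\<close>, natural in \<open>X\<close>.
\<close>

definition is_indexed_limit :: "'u itself \<Rightarrow> ('o, 'h) ecat \<Rightarrow> ('i, 'j) ecat \<Rightarrow>
    ('i, 'j, 'a based, 'a \<Rightarrow> 'a) efun \<Rightarrow> ('i, 'j, 'o, 'h) efun \<Rightarrow>
    'o \<Rightarrow> ('o \<Rightarrow> 'h \<Rightarrow> 'i \<Rightarrow> 'a \<Rightarrow> 'h) \<Rightarrow> bool" where
  "is_indexed_limit u R A W D L \<phi> \<longleftrightarrow>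
     L \<in> Obj R \<and>
     (\<forall>X\<in>Obj R. based_iso (Hom R X L) (nat_trans_space u A W (hom_to R X D)) (\<phi> X)) \<and>
     (\<forall>X\<in>Obj R. \<forall>Y\<in>Obj R. \<forall>h\<in>Mor R Y X. \<forall>f\<in>Mor R X L.
        \<phi> Y (Cmp R Y X L f h) =
          (\<lambda>a\<in>Obj A. \<lambda>w\<in>topspace (btop (fobj W a)). Cmp R Y X (fobj D a) (\<phi> X f a w) h))"

text \<open>
  \<open>\<phi>\<close> exhibits \<open>C\<close> as the colimit \<open>W \<star> D\<close>: the \<open>\<phi> X : R(C, X) \<rightarrow> [\<A>\<^sup>o\<^sup>p, Top\<^sub>+](W, R(D -, X))\<close> are
  isomorphisms in \<open>Top\<^sub>+\<close>, natural in \<open>X\<close>.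
\<close>

definition is_indexed_colimit :: "'u itself \<Rightarrow> ('o, 'h) ecat \<Rightarrow> ('i, 'j) ecat \<Rightarrow>
    ('i, 'j, 'a based, 'a \<Rightarrow> 'a) efun \<Rightarrow> ('i, 'j, 'o, 'h) efun \<Rightarrow>
    'o \<Rightarrow> ('o \<Rightarrow> 'h \<Rightarrow> 'i \<Rightarrow> 'a \<Rightarrow> 'h) \<Rightarrow> bool" where
  "is_indexed_colimit u R A W D C \<phi> \<longleftrightarrow>
     C \<in> Obj R \<and>
     (\<forall>X\<in>Obj R. based_iso (Hom R C X) (nat_trans_space u (eop A) W (hom_from R D X)) (\<phi> X)) \<and>
     (\<forall>X\<in>Obj R. \<forall>Y\<in>Obj R. \<forall>h\<in>Mor R X Y. \<forall>f\<in>Mor R C X.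
        \<phi> Y (Cmp R C X Y h f) =
          (\<lambda>a\<in>Obj A. \<lambda>w\<in>topspace (btop (fobj W a)). Cmp R (fobj D a) X Y h (\<phi> X f a w)))"

definition topp_complete :: "'u itself \<Rightarrow> ('o, 'h) ecat \<Rightarrow> bool" where
  "topp_complete u R \<longleftrightarrow>
     topp_category u R \<and>
     (\<forall>(A :: ('u, 'u) ecat) (W :: ('u, 'u, 'u based, 'u \<Rightarrow> 'u) efun) D.
        small u (Obj A) \<and> topp_functor u A (Topp u) W \<and> topp_functor u A R D
        \<longrightarrow> (\<exists>L \<phi>. is_indexed_limit u R A W D L \<phi>))"

definition topp_cocomplete :: "'u itself \<Rightarrow> ('o, 'h) ecat \<Rightarrow> bool" where
  "topp_cocomplete u R \<longleftrightarrow>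
     topp_category u R \<and>
     (\<forall>(A :: ('u, 'u) ecat) (W :: ('u, 'u, 'u based, 'u \<Rightarrow> 'u) efun) D.
        small u (Obj A) \<and> topp_functor u (eop A) (Topp u) W \<and> topp_functor u A R D
        \<longrightarrow> (\<exists>C \<phi>. is_indexed_colimit u R A W D C \<phi>))"

text \<open>
  The unit of a colimit \<open>(C, \<phi>)\<close> is the transformation \<open>\<phi> C (id C) : W \<rightarrow> R(D -, C)\<close>.  Preservation
  by \<open>F\<close> means that the image of the unit under \<open>F\<close> is the unit of a colimit of \<open>F D\<close>.
\<close>

definition preserves_indexed_colimits ::
  "'u itself \<Rightarrow> ('o, 'h) ecat \<Rightarrow> ('p, 'g) ecat \<Rightarrow> ('o, 'h, 'p, 'g) efun \<Rightarrow> bool" where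
  "preserves_indexed_colimits u R S F \<longleftrightarrow>
     topp_functor u R S F \<and>
     (\<forall>(A :: ('u, 'u) ecat) (W :: ('u, 'u, 'u based, 'u \<Rightarrow> 'u) efun) D C \<phi>.
        small u (Obj A) \<and> topp_functor u (eop A) (Topp u) W \<and> topp_functor u A R D \<and>
        is_indexed_colimit u R A W D C \<phi>
        \<longrightarrow> (\<exists>\<psi>. is_indexed_colimit u S A W (efun_comp F D) (fobj F C) \<psi> \<and>
               (\<forall>a\<in>Obj A. \<forall>w\<in>topspace (btop (fobj W a)).
                  \<psi> (fobj F C) (Idn S (fobj F C)) a w =
                    fmap F (fobj D a) C (\<phi> C (Idn R C) a w))))"


section \<open>Topological monoids and groups\<close>

record 'a top_monoid = "'a monoid" +
  mtop :: "'a topology"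

definition underlying :: "'a top_monoid \<Rightarrow> 'a based" where
  "underlying M = \<lparr>btop = mtop M, bpt = \<one>\<^bsub>M\<^esub>\<rparr>"

definition topological_monoid :: "'u itself \<Rightarrow> 'a top_monoid \<Rightarrow> bool" where
  "topological_monoid u M \<longleftrightarrow>
     monoid M \<and> topspace (mtop M) = carrier M \<and> based_kspace u (underlying M) \<and>
     continuous_map (kprod u (mtop M) (mtop M)) (mtop M) (\<lambda>(x, y). x \<otimes>\<^bsub>M\<^esub> y)"

definition topological_group :: "'u itself \<Rightarrow> 'a top_monoid \<Rightarrow> bool" where
  "topological_group u G \<longleftrightarrow>
     topological_monoid u G \<and> group G \<and> continuous_map (mtop G) (mtop G) (\<lambda>x. inv\<^bsub>G\<^esub> x)"

text \<open>
  Continuous unital homomorphisms: the library's \<open>hom\<close> asks for multiplicativity only, and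
  unitality is the condition that the map be based.
\<close>

definition hom_space :: "'u itself \<Rightarrow> 'a top_monoid \<Rightarrow> 'a top_monoid \<Rightarrow> ('a \<Rightarrow> 'a) based" where
  "hom_space u M N =
     \<lparr>btop = kify u (subtopology (btop (map_space u (underlying M) (underlying N))) (hom M N)),
      bpt = (\<lambda>x\<in>carrier M. \<one>\<^bsub>N\<^esub>)\<rparr>"

definition Tmon :: "'u itself \<Rightarrow> ('u top_monoid, 'u \<Rightarrow> 'u) ecat" where
  "Tmon u = \<lparr>Obj = {M. topological_monoid u M}, Hom = hom_space u,
             Cmp = (\<lambda>M N P g f. compose (carrier M) g f),
             Idn = (\<lambda>M. \<lambda>x\<in>carrier M. x)\<rparr>"

definition Tgrp :: "'u itself \<Rightarrow> ('u top_monoid, 'u \<Rightarrow> 'u) ecat" where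
  "Tgrp u = Tmon u \<lparr>Obj := {G. topological_group u G}\<rparr>"

definition forget :: "('u top_monoid, 'u \<Rightarrow> 'u, 'u top_monoid, 'u \<Rightarrow> 'u) efun" where
  "forget = \<lparr>fobj = (\<lambda>G. G), fmap = (\<lambda>G H f. f)\<rparr>"

end

theory Submission
  imports Defs
begin

text \<open>
  The topologies of hom spaces, mapping spaces and spaces of natural transformations are k-topologies,
  hence determined by the continuous maps from small compact Hausdorff spaces, and a map from such a
  space to a mapping space is the same as a jointly continuous map.  An indexed limit of topological
  monoids is the space of natural transformations from the weight to the diagram, with pointwise
  multiplication.  An indexed colimit is the submonoid generated by the universal cocone in the product
  of all small topological monoids with a cocone, in the initial k-topology; its universal property
  is automatically enriched since a family of cocones into \<open>X\<close> is a cocone into a cotensor of \<open>X\<close>.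
  If the diagram consists of groups, then the universal cocone factors through the group of units,
  so the colimit of monoids is a group, and colimits of groups are colimits of monoids because
  taking units is right adjoint to the forgetful functor.
\<close>

section \<open>Cardinal arithmetic below the universe\<close>

section \<open>Small sets\<close>

text \<open>Two obstacles shape the proof. The first is one of types: limits are carried by families
  of functions, cotensors by functions, and the colimit arises inside a product indexed by cocones,
  whereas the objects of \<open>Tmon\<close> are carried by \<open>'u\<close>. Each monoid is
  therefore built on the type where it is natural, shown to be small, and moved to \<open>'u\<close>
  by \<open>small_copy\<close>; this is why homomorphisms and cocones are set up between monoids on
  different types.

  The second is topological: a colimit built as a quotient of a free monoid would need control over
  products of quotient maps before its multiplication could be called continuous. In a submonoid of
  a product, continuity is checked coordinatewise, a factorisation is a coordinate projection, and
  its uniqueness is generation by words. The price is that this gives only a bijection between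
  homomorphisms and cocones, so continuity in the hom space must be recovered separately.

  Compactness of the probes does its essential work in the exponential law: closed neighbourhoods
  serve for evaluation, closed projections for the converse.\<close>

lemma small_inj:
  assumes "small u B" "inj_on f A" "f ` A \<subseteq> B"
  shows "small u A"
proof -
  have "|A| \<le>o |B|"
    using assms(2,3) card_of_ordLeq by blast
  then show ?thesis
    using assms(1) unfolding small_def by (rule ordLeq_ordLess_trans)
qed

lemma small_subset: "small u B \<Longrightarrow> A \<subseteq> B \<Longrightarrow> small u A"
  by (rule small_inj[of u B "\<lambda>x. x"]) auto

lemma small_image: "small u A \<Longrightarrow> small u (f ` A)"
  using card_of_image ordLeq_ordLess_trans unfolding small_def by blast

lemma small_imp_inj:
  fixes A :: "'a set"
  assumes "small (u :: 'u itself) A"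
  obtains e :: "'a \<Rightarrow> 'u" where "inj_on e A"
proof -
  have "|A| \<le>o |UNIV :: 'u set|"
    using assms ordLess_imp_ordLeq unfolding small_def by blast
  then show thesis
    using that card_of_ordLeq[of A "UNIV :: 'u set"] by blast
qed

lemma not_small_imp_inj:
  assumes "\<not> small (u :: 'u itself) A"
  obtains g where "inj_on g (UNIV :: 'u set)" "range g \<subseteq> A"
  using assms unfolding small_def card_of_ordLess[symmetric] by blast

lemma not_small_UNIV: "\<not> small (u :: 'u itself) (UNIV :: 'u set)"
  unfolding small_def using ordLess_irreflexive by blast

locale universe =
  fixes u :: "'u itself"
  assumes universe: "universe_type u"
begin

lemma small_nat: "small u (A :: nat set)"
proof (rule ccontr)
  assume "\<not> small u A"
  then obtain g :: "'u \<Rightarrow> nat" where "inj_on g UNIV"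
    by (rule not_small_imp_inj)
  then have "countable (UNIV :: 'u set)"
    by (rule countableI)
  then show False
    using universe unfolding universe_type_def by blast
qed

lemma small_finite: "finite A \<Longrightarrow> small u A"
  by (meson finite_imp_inj_to_nat_seg small_inj[OF small_nat] subset_UNIV)

text \<open>Regularity in \<open>universe_type\<close> speaks only of subsets of \<open>'u\<close>,
  while \<open>I\<close> and the \<open>B i\<close> live on any types. If the union were not small,
  \<open>'u\<close> would embed into it; pulling the \<open>B i\<close> back along the embedding
  covers \<open>'u\<close> by small sets with a small index set, so \<open>UNIV\<close> would be
  small.\<close>

lemma small_UN:
  assumes I: "small u I" and B: "\<And>i. i \<in> I \<Longrightarrow> small u (B i)"
  shows "small u (\<Union>i\<in>I. B i)"
proof (rule ccontr)
  assume "\<not> small u (\<Union>i\<in>I. B i)"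
  then obtain g where g: "inj_on g (UNIV :: 'u set)" "range g \<subseteq> (\<Union>i\<in>I. B i)"
    by (rule not_small_imp_inj)
  obtain e :: "_ \<Rightarrow> 'u" where e: "inj_on e I"
    using I small_imp_inj by blast
  have "small u (g -` B i)" if "i \<in> I" for i
    by (rule small_inj[OF B[OF that], of g]) (use inj_on_subset[OF g(1)] in auto)
  then have B': "\<forall>a\<in>e ` I. small u (g -` B (inv_into I e a))"
    by (metis inv_into_into)
  have "small u A \<and> (\<forall>a\<in>A. small u (C a)) \<longrightarrow> small u (\<Union>a\<in>A. C a)"
    for A and C :: "'u \<Rightarrow> 'u set"
    using universe unfolding universe_type_def by blast
  from this[of "e ` I" "\<lambda>a. g -` B (inv_into I e a)"]
  have "small u (\<Union>a\<in>e ` I. g -` B (inv_into I e a))"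
    using B' small_image[OF I] by blast
  moreover have "x \<in> (\<Union>a\<in>e ` I. g -` B (inv_into I e a))" for x
  proof -
    obtain i where "i \<in> I" "g x \<in> B i"
      using g(2) by (meson UN_E rangeI subsetD)
    then show ?thesis
      using e by (intro UN_I[of "e i"]) auto
  qed
  ultimately have "small u (UNIV :: 'u set)"
    by (meson small_subset subsetI)
  then show False
    using not_small_UNIV by blast
qed

lemma small_Sigma:
  assumes "small u I" "\<And>i. i \<in> I \<Longrightarrow> small u (B i)"
  shows "small u (Sigma I B)"
proof -
  have "Sigma I B = (\<Union>i\<in>I. Pair i ` B i)"
    by auto
  then show ?thesis
    using assms by (simp add: small_UN small_image)
qed

lemma small_Pow:
  assumes A: "small u A"
  shows "small u (Pow A)"
proof -
  obtain e :: "_ \<Rightarrow> 'u" where e: "inj_on e A"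
    using A small_imp_inj by blast
  have "small u (Pow (e ` A))"
    using universe A small_image unfolding universe_type_def by blast
  then show ?thesis
    by (rule small_inj[of _ _ "image e"]) (use e in \<open>auto intro: inj_on_image_Pow\<close>)
qed

text \<open>Extensional functions are determined by their graphs, which are subsets of
  \<open>Sigma I B\<close>; regularity bounds the latter and the strong limit property its power
  set.\<close>

lemma small_PiE:
  assumes "small u I" "\<And>i. i \<in> I \<Longrightarrow> small u (B i)"
  shows "small u (PiE I B)"
proof (rule small_inj[OF small_Pow[OF small_Sigma[OF assms]], where f = "\<lambda>f. (\<lambda>i. (i, f i)) ` I"])
  show "inj_on (\<lambda>f. (\<lambda>i. (i, f i)) ` I) (PiE I B)"
  proof (rule inj_onI)
    fix f g assume *: "f \<in> PiE I B" "g \<in> PiE I B" "(\<lambda>i. (i, f i)) ` I = (\<lambda>i. (i, g i)) ` I"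
    then have "f i = g i" if "i \<in> I" for i
      using that by blast
    then show "f = g"
      using * by (meson PiE_ext)
  qed
qed auto

text \<open>A union over the lengths, which form a small index set because the universe is
  uncountable.\<close>

lemma small_lists:
  assumes A: "small u A"
  shows "small u (lists A)"
proof -
  have "small u {xs \<in> lists A. length xs = n}" for n
  proof (induction n)
    case 0
    then show ?case by (rule small_subset[OF small_finite[of "{[]}"]]) auto
  next
    case (Suc n)
    have "{xs \<in> lists A. length xs = Suc n} \<subseteq> (\<lambda>(x, xs). x # xs) ` (A \<times> {xs \<in> lists A. length xs = n})"
      by (auto simp: length_Suc_conv image_iff)
    then show ?case
      by (rule small_subset[rotated]) (intro small_image small_Sigma A Suc)
  qed
  then have "small u (\<Union>n\<in>UNIV. {xs \<in> lists A. length xs = n})"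
    by (intro small_UN small_nat)
  then show ?thesis
    by (rule small_subset) auto
qed

end

section \<open>k-spaces through maps from compact Hausdorff spaces\<close>

section \<open>Probes\<close>

text \<open>
  A k-space is determined by its probes, the continuous maps into it from small compact Hausdorff
  spaces.
\<close>

definition test :: "'u itself \<Rightarrow> 'u topology \<Rightarrow> bool" where
  "test u K \<longleftrightarrow> small u (topspace K) \<and> compact_space K \<and> Hausdorff_space K"

lemma kopenD: "kopen u X S \<Longrightarrow> test u K \<Longrightarrow> continuous_map K X f \<Longrightarrow> openin K {x \<in> topspace K. f x \<in> S}"
  unfolding kopen_def test_def by blast

lemma openin_imp_kopen: "openin X S \<Longrightarrow> kopen u X S"
  unfolding kopen_def by (auto simp: openin_subset openin_continuous_map_preimage)

text \<open>Preimages of k-open sets under probes are open by definition, so passing to the finer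
  topology loses no probes. This lets products, hom spaces and spaces of transformations be handled
  through their probes instead of their open sets.\<close>

lemma probe_kify:
  assumes "test u K"
  shows "continuous_map K (kify u X) q \<longleftrightarrow> continuous_map K X q"
proof
  assume "continuous_map K (kify u X) q"
  then show "continuous_map K X q"
    using openin_imp_kopen[of X _ u] by (auto simp: continuous_map openin_kify)
next
  assume "continuous_map K X q"
  then show "continuous_map K (kify u X) q"
    using kopenD[OF _ assms] by (auto simp: continuous_map openin_kify)
qed

lemma kspace_kify [simp]: "kspace u (kify u X)"
proof -
  have "kopen u (kify u X) S \<longleftrightarrow> kopen u X S" for S
    using probe_kify[of u _ X] unfolding kopen_def test_def by (auto 4 4)
  then show ?thesis
    unfolding kspace_def by (auto simp: topology_eq openin_kify)
qed

lemma openin_kspace: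
  assumes "kspace u X"
  shows "openin X S \<longleftrightarrow> S \<subseteq> topspace X \<and>
    (\<forall>K q. test u K \<longrightarrow> continuous_map K X q \<longrightarrow> openin K {x \<in> topspace K. q x \<in> S})"
  using assms openin_kify[of u X S] unfolding kspace_def kopen_def test_def by auto

lemma probe_compose:
  "continuous_map K X q \<Longrightarrow> continuous_map X Y f \<Longrightarrow> continuous_map K Y (\<lambda>x. f (q x))"
  using continuous_map_compose[of K X q Y f] by (simp add: o_def)

text \<open>Probes determine the open sets by \<open>openin_kspace\<close>. Equality on the nose,
  rather than a homeomorphism, later lets hom spaces into a monoid and into its group of units be
  interchanged.\<close>

lemma kspace_eqI:
  assumes "kspace u X" "kspace u Y" "topspace X = topspace Y"
    and "\<And>K q. test u K \<Longrightarrow> continuous_map K X q \<longleftrightarrow> continuous_map K Y q"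
  shows "X = Y"
  unfolding topology_eq using assms by (auto simp: openin_kspace[of u])

lemma kspace_continuous_mapI:
  assumes X: "kspace u X" and f: "f \<in> topspace X \<rightarrow> topspace Y"
    and probe: "\<And>K q. test u K \<Longrightarrow> continuous_map K X q \<Longrightarrow> continuous_map K Y (\<lambda>x. f (q x))"
  shows "continuous_map X Y f"
  unfolding continuous_map_def
proof (intro conjI allI impI f)
  fix U assume U: "openin Y U"
  show "openin X {x \<in> topspace X. f x \<in> U}"
    unfolding openin_kspace[OF X]
  proof (intro conjI allI impI)
    fix K q assume K: "test u K" and q: "continuous_map K X q"
    have "{x \<in> topspace K. q x \<in> {x \<in> topspace X. f x \<in> U}} = {x \<in> topspace K. f (q x) \<in> U}"
      using q by (auto simp: continuous_map_def)
    then show "openin K {x \<in> topspace K. q x \<in> {x \<in> topspace X. f x \<in> U}}"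
      using openin_continuous_map_preimage[OF probe[OF K q] U] by simp
  qed auto
qed

lemma probe_kprod:
  "test u K \<Longrightarrow> continuous_map K (kprod u X Y) q \<longleftrightarrow>
    continuous_map K X (\<lambda>x. fst (q x)) \<and> continuous_map K Y (\<lambda>x. snd (q x))"
  unfolding kprod_def by (simp add: probe_kify continuous_map_pairwise o_def)

lemma topspace_kprod [simp]: "topspace (kprod u X Y) = topspace X \<times> topspace Y"
  by (simp add: kprod_def)

lemma kspace_kprod [simp]: "kspace u (kprod u X Y)"
  by (simp add: kprod_def)

lemma continuous_map_kprodI:
  assumes "f \<in> topspace X \<times> topspace Y \<rightarrow> topspace Z"
    and "\<And>K q r. test u K \<Longrightarrow> continuous_map K X q \<Longrightarrow> continuous_map K Y r \<Longrightarrow>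
      continuous_map K Z (\<lambda>x. f (q x, r x))"
  shows "continuous_map (kprod u X Y) Z f"
proof (rule kspace_continuous_mapI[of u])
  fix K q assume "test u K" "continuous_map K (kprod u X Y) q"
  then show "continuous_map K Z (\<lambda>x. f (q x))"
    using assms(2)[of K "\<lambda>x. fst (q x)" "\<lambda>x. snd (q x)"] by (simp add: probe_kprod)
qed (use assms in auto)

text \<open>Transport of structure: the target type carries no topology beforehand, and pulling the
  one of \<open>X\<close> back along the inverse of \<open>e\<close> makes \<open>e\<close> a
  homeomorphism onto its image.\<close>

lemma homeomorphic_copy:
  fixes X :: "'a topology"
  assumes e: "inj_on (e :: 'a \<Rightarrow> 'b) (topspace X)"
  defines "g \<equiv> inv_into (topspace X) e"
  shows "homeomorphic_maps X (pullback_topology (e ` topspace X) g X) e g"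
    and "topspace (pullback_topology (e ` topspace X) g X) = e ` topspace X"
proof -
  have g: "g (e x) = x" if "x \<in> topspace X" for x
    using e that by (simp add: g_def)
  show top: "topspace (pullback_topology (e ` topspace X) g X) = e ` topspace X"
    using g by (auto simp: topspace_pullback_topology)
  have "continuous_map X (pullback_topology (e ` topspace X) g X) e"
  proof (rule continuous_map_pullback')
    show "continuous_map X X (g \<circ> e)"
      by (rule continuous_map_eq[OF continuous_map_id]) (simp add: g)
  qed auto
  moreover have "continuous_map (pullback_topology (e ` topspace X) g X) X g"
    using continuous_map_pullback[OF continuous_map_id[of X], of "e ` topspace X" g] by simp
  ultimately show "homeomorphic_maps X (pullback_topology (e ` topspace X) g X) e g"
    unfolding homeomorphic_maps_def top using g by auto
qed

lemma kspace_homeomorphic: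
  assumes X: "kspace u X" and e: "homeomorphic_maps X Y e g"
  shows "kspace u Y"
proof -
  have "kopen u Y S \<longleftrightarrow> openin Y S" for S
  proof
    assume S: "kopen u Y S"
    have "openin X {x \<in> topspace X. e x \<in> S}"
      unfolding openin_kspace[OF X]
    proof (intro conjI allI impI)
      fix K q assume K: "test u K" "continuous_map K X q"
      have "{x \<in> topspace K. q x \<in> {x \<in> topspace X. e x \<in> S}} = {x \<in> topspace K. e (q x) \<in> S}"
        using K by (auto simp: continuous_map_def)
      then show "openin K {x \<in> topspace K. q x \<in> {x \<in> topspace X. e x \<in> S}}"
        using kopenD[OF S K(1) probe_compose[OF K(2)]] e by (simp add: homeomorphic_maps_def)
    qed auto
    then have "openin Y {y \<in> topspace Y. g y \<in> {x \<in> topspace X. e x \<in> S}}"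
      using e openin_continuous_map_preimage unfolding homeomorphic_maps_def by blast
    moreover have "{y \<in> topspace Y. g y \<in> {x \<in> topspace X. e x \<in> S}} = S"
      using S e unfolding kopen_def homeomorphic_maps_def continuous_map_def by (auto simp: Pi_iff)
    ultimately show "openin Y S"
      by simp
  qed (rule openin_imp_kopen)
  then show ?thesis
    unfolding kspace_def by (simp add: topology_eq openin_kify)
qed

lemma test_subtopology:
  assumes "test u K" "closedin K C"
  shows "test u (subtopology K C)"
  using assms small_subset[of u "topspace K" C] closedin_subset[of K C]
  by (auto simp: test_def Int_absorb1 Hausdorff_space_subtopology topspace_subtopology_subset
      compact_space_subtopology closedin_compact_space)

context universe
begin

lemma test_sing: "test u (discrete_topology {x})"
  by (auto simp: test_def small_finite compact_space_discrete_topology)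

text \<open>Probes have their domain on \<open>'u\<close>, but the product lives on
  \<open>'u \<times> 'u\<close>. Being small, it has a copy on \<open>'u\<close>, which is again
  compact Hausdorff.\<close>

lemma test_prod:
  assumes K: "test u K" and L: "test u L"
  obtains P e g where "test u P" "homeomorphic_maps (prod_topology K L) P e g"
proof -
  have small: "small u (topspace (prod_topology K L))"
    using K L small_Sigma[of "topspace K" "\<lambda>_. topspace L"] by (simp add: test_def)
  then obtain e :: "'u \<times> 'u \<Rightarrow> 'u" where e: "inj_on e (topspace (prod_topology K L))"
    using small_imp_inj by blast
  let ?g = "inv_into (topspace (prod_topology K L)) e"
  let ?P = "pullback_topology (e ` topspace (prod_topology K L)) ?g (prod_topology K L)"
  have h: "homeomorphic_maps (prod_topology K L) ?P e ?g"
    and top: "topspace ?P = e ` topspace (prod_topology K L)"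
    using homeomorphic_copy[OF e] by blast+
  have "prod_topology K L homeomorphic_space ?P"
    using h unfolding homeomorphic_space_def by blast
  moreover have "compact_space (prod_topology K L)" "Hausdorff_space (prod_topology K L)"
    using K L by (auto simp: test_def compact_space_prod_topology Hausdorff_space_prod_topology)
  ultimately have "compact_space ?P" "Hausdorff_space ?P"
    using homeomorphic_compact_space homeomorphic_Hausdorff_space by blast+
  moreover have "small u (topspace ?P)"
    unfolding top using small by (rule small_image)
  ultimately show thesis
    using h that unfolding test_def by blast
qed

end

section \<open>The exponential law on probes\<close>

section \<open>Mapping spaces\<close>

text \<open>Continuity of the uncurried map on the k-product of \<open>K\<close> and
  \<open>X\<close>, spelled out on probes. In this form it composes by substitution, without any
  currying or product topology.\<close>

definition joint_probes ::
  "'u itself \<Rightarrow> 'k topology \<Rightarrow> 'a topology \<Rightarrow> 'b topology \<Rightarrow> ('k \<Rightarrow> 'a \<Rightarrow> 'b) \<Rightarrow> bool" where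
  "joint_probes u K X Y F \<longleftrightarrow>
     (\<forall>L p h. test u L \<longrightarrow> continuous_map L K p \<longrightarrow> continuous_map L X h \<longrightarrow>
        continuous_map L Y (\<lambda>l. F (p l) (h l)))"

lemma joint_probesI:
  "(\<And>L p h. test u L \<Longrightarrow> continuous_map L K p \<Longrightarrow> continuous_map L X h \<Longrightarrow>
     continuous_map L Y (\<lambda>l. F (p l) (h l))) \<Longrightarrow> joint_probes u K X Y F"
  unfolding joint_probes_def by blast

lemma joint_probesD:
  "joint_probes u K X Y F \<Longrightarrow> test u L \<Longrightarrow> continuous_map L K p \<Longrightarrow> continuous_map L X h \<Longrightarrow>
     continuous_map L Y (\<lambda>l. F (p l) (h l))"
  unfolding joint_probes_def by blast

lemma based_maps_iff:
  assumes "kspace u (btop X)"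
  shows "f \<in> based_maps X Y \<longleftrightarrow>
    f \<in> extensional (topspace (btop X)) \<and> f \<in> topspace (btop X) \<rightarrow> topspace (btop Y) \<and>
    f (bpt X) = bpt Y \<and>
    (\<forall>K q. test u K \<longrightarrow> continuous_map K (btop X) q \<longrightarrow> continuous_map K (btop Y) (\<lambda>x. f (q x)))"
  using kspace_continuous_mapI[OF assms, of f "btop Y"] probe_compose[of _ "btop X" _ "btop Y" f]
    continuous_map_funspace[of "btop X" "btop Y" f]
  unfolding based_maps_def based_map_def by blast

lemma based_maps_subset:
  "based_maps X Y \<subseteq> PiE (topspace (btop X)) (\<lambda>_. topspace (btop Y))"
  unfolding based_maps_def based_map_def PiE_def using continuous_map_funspace by blast

context universe
begin

abbreviation "compact_open_subbasis X Y \<equiv>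
  {{f \<in> based_maps X Y. f ` h ` topspace K \<subseteq> U} | (K :: 'u topology) h U.
     test u K \<and> continuous_map K (btop X) h \<and> openin (btop Y) U}"

lemma btop_map_space:
  "btop (map_space u X Y) = kify u (topology_generated_by (compact_open_subbasis X Y))"
  unfolding map_space_def test_def by simp

lemma Union_compact_open_subbasis: "\<Union> (compact_open_subbasis X Y) = based_maps X Y"
proof -
  have "test u (trivial_topology :: 'u topology)"
    by (simp add: test_def small_finite)
  moreover have "continuous_map (trivial_topology :: 'u topology) (btop X) undefined"
    by (simp add: continuous_map)
  moreover have "openin (btop Y) {}"
    by simp
  ultimately have "{f \<in> based_maps X Y. f ` undefined ` topspace (trivial_topology :: 'u topology) \<subseteq> {}}
      \<in> compact_open_subbasis X Y"
    by blast
  then show ?thesis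
    by auto
qed

lemma topspace_map_space [simp]: "topspace (btop (map_space u X Y)) = based_maps X Y"
  using Union_compact_open_subbasis unfolding btop_map_space by simp

lemma kspace_map_space [simp]: "kspace u (btop (map_space u X Y))"
  unfolding btop_map_space by simp

text \<open>Compact Hausdorff spaces are regular: \<open>l0\<close> has a closed neighbourhood
  \<open>C\<close> such that \<open>F l0\<close> maps the image of \<open>C\<close> under
  \<open>h\<close> into \<open>U\<close>. As \<open>C\<close> is again compact, \<open>h\<close>
  restricted to \<open>C\<close> defines a subbasic neighbourhood of \<open>F l0\<close>, in which
  \<open>F\<close> stays near \<open>l0\<close>.\<close>

lemma probe_evaluation:
  assumes L: "test u L" and F: "continuous_map L (btop (map_space u X Y)) F"
    and h: "continuous_map L (btop X) h"
  shows "continuous_map L (btop Y) (\<lambda>l. F l (h l))"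
proof -
  have Fmaps: "F l \<in> based_maps X Y" if "l \<in> topspace L" for l
    using F that continuous_map_funspace by fastforce
  have Fcont: "continuous_map L (btop Y) (\<lambda>l'. F l (h l'))" if "l \<in> topspace L" for l
    using Fmaps[OF that] probe_compose[OF h] unfolding based_maps_def based_map_def by blast
  have "openin L {l \<in> topspace L. F l (h l) \<in> U}" if U: "openin (btop Y) U" for U
  proof (subst openin_subopen, intro ballI)
    fix l0 assume l0: "l0 \<in> {l \<in> topspace L. F l (h l) \<in> U}"
    define W where "W = {l \<in> topspace L. F l0 (h l) \<in> U}"
    have W: "openin L W" "l0 \<in> W"
      unfolding W_def using l0 openin_continuous_map_preimage[OF Fcont U] by auto
    have "neighbourhood_base_of (closedin L) L"
      using L neighbourhood_base_of_closedin compact_Hausdorff_imp_regular_space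
      unfolding test_def by blast
    then obtain V C where V: "openin L V" "l0 \<in> V" "V \<subseteq> C" "C \<subseteq> W" and C: "closedin L C"
      using W unfolding neighbourhood_base_of by meson
    let ?B = "{f \<in> based_maps X Y. f ` h ` topspace (subtopology L C) \<subseteq> U}"
    have "?B \<in> compact_open_subbasis X Y"
      using test_subtopology[OF L C] continuous_map_from_subtopology[OF h] U by blast
    moreover have "continuous_map L (topology_generated_by (compact_open_subbasis X Y)) F"
      using F L probe_kify unfolding btop_map_space by blast
    ultimately have "openin L (F -` ?B \<inter> topspace L)"
      unfolding continuous_on_generated_topo_iff by blast
    then have "openin L (V \<inter> (F -` ?B \<inter> topspace L))"
      using V by blast
    moreover have "l0 \<in> V \<inter> (F -` ?B \<inter> topspace L)"
      using l0 V Fmaps by (auto simp: W_def)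
    moreover have "V \<inter> (F -` ?B \<inter> topspace L) \<subseteq> {l \<in> topspace L. F l (h l) \<in> U}"
      using V(3) by auto
    ultimately show "\<exists>T. openin L T \<and> l0 \<in> T \<and> T \<subseteq> {l \<in> topspace L. F l (h l) \<in> U}"
      by blast
  qed
  moreover have "F l (h l) \<in> topspace (btop Y)" if "l \<in> topspace L" for l
    using Fcont[OF that] that unfolding continuous_map_def by auto
  ultimately show ?thesis
    unfolding continuous_map_def by auto
qed

text \<open>The exponential law for maps out of test spaces. One direction is
  \<open>probe_evaluation\<close>; the other rests on the closedness of the projection along a
  compact factor.\<close>

lemma probe_map_space:
  assumes K: "test u K"
  shows "continuous_map K (btop (map_space u X Y)) F \<longleftrightarrow>
    F \<in> topspace K \<rightarrow> based_maps X Y \<and> joint_probes u K (btop X) (btop Y) F"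
proof
  assume F: "continuous_map K (btop (map_space u X Y)) F"
  have "joint_probes u K (btop X) (btop Y) F"
    using probe_evaluation[OF _ probe_compose[OF _ F]] by (intro joint_probesI)
  then show "F \<in> topspace K \<rightarrow> based_maps X Y \<and> joint_probes u K (btop X) (btop Y) F"
    using continuous_map_funspace[OF F] by simp
next
  assume *: "F \<in> topspace K \<rightarrow> based_maps X Y \<and> joint_probes u K (btop X) (btop Y) F"
  show "continuous_map K (btop (map_space u X Y)) F"
    unfolding btop_map_space probe_kify[OF K]
  proof (rule continuous_on_generated_topo)
    show "F ` topspace K \<subseteq> \<Union> (compact_open_subbasis X Y)"
      unfolding Union_compact_open_subbasis using * by blast
    fix B assume "B \<in> compact_open_subbasis X Y"
    then obtain L h U where B: "B = {f \<in> based_maps X Y. f ` h ` topspace L \<subseteq> U}"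
      and L: "test u L" and h: "continuous_map L (btop X) h" and U: "openin (btop Y) U"
      by blast
    \<comment> \<open>\<open>joint_probes\<close> speaks only of test spaces, so it is applied to
      the two projections on the copy \<open>P\<close>, and the result is carried back along
      \<open>e\<close>.\<close>
    obtain P e g where P: "test u P" and eg: "homeomorphic_maps (prod_topology K L) P e g"
      using test_prod[OF K L] by blast
    have g: "continuous_map P (prod_topology K L) g"
      using eg by (simp add: homeomorphic_maps_def)
    have "continuous_map P K (\<lambda>x. fst (g x))" "continuous_map P L (\<lambda>x. snd (g x))"
      using g by (auto simp: continuous_map_pairwise o_def)
    then have "continuous_map P (btop Y) (\<lambda>x. F (fst (g x)) (h (snd (g x))))"
      using joint_probesD[OF conjunct2[OF *] P] probe_compose[OF _ h] by blast
    then have "continuous_map (prod_topology K L) (btop Y) (\<lambda>x. F (fst (g (e x))) (h (snd (g (e x)))))"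
      using eg probe_compose unfolding homeomorphic_maps_def by blast
    then have ev: "continuous_map (prod_topology K L) (btop Y) (\<lambda>x. F (fst x) (h (snd x)))"
      by (rule continuous_map_eq) (use eg in \<open>auto simp: homeomorphic_maps_def\<close>)
    \<comment> \<open>A point \<open>k\<close> lies outside the preimage of \<open>B\<close> exactly
      when some \<open>l\<close> sends \<open>F k (h l)\<close> outside \<open>U\<close>. These
      \<open>k\<close> form the image of \<open>Z\<close> under \<open>fst\<close>, which is closed
      since \<open>L\<close> is compact.\<close>
    define Z where "Z = {x \<in> topspace (prod_topology K L). F (fst x) (h (snd x)) \<in> topspace (btop Y) - U}"
    have "closedin (prod_topology K L) Z"
      unfolding Z_def using ev U by (intro closedin_continuous_map_preimage) auto
    then have "closedin K (fst ` Z)"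
      using closed_map_fst[of L K] L unfolding closed_map_def test_def by blast
    moreover have "F -` B \<inter> topspace K = topspace K - fst ` Z"
    proof -
      have "F k (h l) \<in> topspace (btop Y)" if "k \<in> topspace K" "l \<in> topspace L" for k l
        using funcset_mem[OF continuous_map_funspace[OF ev], of "(k, l)"] that by simp
      then show ?thesis
        using * unfolding B Z_def by (force simp: image_iff)
    qed
    ultimately show "openin K (F -` B \<inter> topspace K)"
      by auto
  qed
qed

lemma small_based_maps:
  assumes "small u (topspace (btop X))" "small u (topspace (btop Y))"
  shows "small u (based_maps X Y)"
  using small_subset[OF small_PiE based_maps_subset] assms by blast

end

section \<open>Continuous homomorphisms and their hom spaces\<close>

section \<open>Topological monoids\<close>

lemma underlying_simps [simp]: "btop (underlying M) = mtop M" "bpt (underlying M) = \<one>\<^bsub>M\<^esub>"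
  by (simp_all add: underlying_def)

lemma topological_monoidD:
  assumes "topological_monoid u M"
  shows "monoid M" "topspace (mtop M) = carrier M" "kspace u (mtop M)" "small u (carrier M)"
  using assms unfolding topological_monoid_def based_kspace_def by auto

lemma probe_mult:
  assumes "topological_monoid u M" "test u K"
    and "continuous_map K (mtop M) p" "continuous_map K (mtop M) q"
  shows "continuous_map K (mtop M) (\<lambda>x. p x \<otimes>\<^bsub>M\<^esub> q x)"
proof -
  have "continuous_map K (kprod u (mtop M) (mtop M)) (\<lambda>x. (p x, q x))"
    using assms by (simp add: probe_kprod)
  then show ?thesis
    using assms(1) probe_compose[of K _ "\<lambda>x. (p x, q x)"] unfolding topological_monoid_def by fastforce
qed

lemma topological_monoidI:
  assumes "monoid M" "topspace (mtop M) = carrier M" "kspace u (mtop M)" "small u (carrier M)"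
    and "\<And>K p q. test u K \<Longrightarrow> continuous_map K (mtop M) p \<Longrightarrow> continuous_map K (mtop M) q \<Longrightarrow>
      continuous_map K (mtop M) (\<lambda>x. p x \<otimes>\<^bsub>M\<^esub> q x)"
  shows "topological_monoid u M"
proof -
  have "continuous_map (kprod u (mtop M) (mtop M)) (mtop M) (\<lambda>(x, y). x \<otimes>\<^bsub>M\<^esub> y)"
    using assms monoid.m_closed by (intro continuous_map_kprodI) fastforce+
  then show ?thesis
    using assms monoid.one_closed unfolding topological_monoid_def based_kspace_def by auto
qed

lemma topological_groupI:
  assumes M: "topological_monoid u M" and inv: "carrier M \<subseteq> Units M"
    and "\<And>K p. test u K \<Longrightarrow> continuous_map K (mtop M) p \<Longrightarrow> continuous_map K (mtop M) (\<lambda>x. inv\<^bsub>M\<^esub> p x)"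
  shows "topological_group u M"
proof -
  have "group M"
    using topological_monoidD[OF M] inv by (simp add: group_def group_axioms_def)
  moreover have "continuous_map (mtop M) (mtop M) (\<lambda>x. inv\<^bsub>M\<^esub> x)"
  proof (rule kspace_continuous_mapI[OF topological_monoidD(3)[OF M]])
    show "(\<lambda>x. inv\<^bsub>M\<^esub> x) \<in> topspace (mtop M) \<rightarrow> topspace (mtop M)"
      using group.inv_closed[OF \<open>group M\<close>] topological_monoidD(2)[OF M] by simp
  qed (rule assms(3))
  ultimately show ?thesis
    using M unfolding topological_group_def by blast
qed

lemma topological_groupD:
  assumes "topological_group u M"
  shows "topological_monoid u M" "group M"
    and "continuous_map K (mtop M) p \<Longrightarrow> continuous_map K (mtop M) (\<lambda>x. inv\<^bsub>M\<^esub> p x)"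
  using assms probe_compose[of K "mtop M" p "mtop M" "\<lambda>x. inv\<^bsub>M\<^esub> x"]
  unfolding topological_group_def by auto

text \<open>The two carriers may have different types and no extensionality is demanded, so that
  such maps compose as plain functions and connect objects on \<open>'u\<close> with monoids on
  function types. \<open>ext_cont_hom\<close> selects the representatives that are points of
  \<open>hom_space\<close>.\<close>

definition cont_hom :: "'a top_monoid \<Rightarrow> 'b top_monoid \<Rightarrow> ('a \<Rightarrow> 'b) set" where
  "cont_hom M N = {f \<in> hom M N. f \<one>\<^bsub>M\<^esub> = \<one>\<^bsub>N\<^esub> \<and> continuous_map (mtop M) (mtop N) f}"

lemma cont_homD:
  assumes "f \<in> cont_hom M N"
  shows "x \<in> carrier M \<Longrightarrow> f x \<in> carrier N"
    and "x \<in> carrier M \<Longrightarrow> y \<in> carrier M \<Longrightarrow> f (x \<otimes>\<^bsub>M\<^esub> y) = f x \<otimes>\<^bsub>N\<^esub> f y"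
    and "f \<one>\<^bsub>M\<^esub> = \<one>\<^bsub>N\<^esub>"
    and "continuous_map (mtop M) (mtop N) f"
  using assms unfolding cont_hom_def hom_def by auto

lemma cont_homI:
  assumes "kspace u (mtop M)" "topspace (mtop M) = carrier M" "topspace (mtop N) = carrier N"
    and "\<And>x. x \<in> carrier M \<Longrightarrow> f x \<in> carrier N"
    and "\<And>x y. x \<in> carrier M \<Longrightarrow> y \<in> carrier M \<Longrightarrow> f (x \<otimes>\<^bsub>M\<^esub> y) = f x \<otimes>\<^bsub>N\<^esub> f y"
    and "f \<one>\<^bsub>M\<^esub> = \<one>\<^bsub>N\<^esub>"
    and "\<And>K q. test u K \<Longrightarrow> continuous_map K (mtop M) q \<Longrightarrow> continuous_map K (mtop N) (\<lambda>x. f (q x))"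
  shows "f \<in> cont_hom M N"
  using assms kspace_continuous_mapI[of u "mtop M" f "mtop N"] unfolding cont_hom_def hom_def by auto

lemma probe_cont_hom:
  "f \<in> cont_hom M N \<Longrightarrow> continuous_map K (mtop M) q \<Longrightarrow> continuous_map K (mtop N) (\<lambda>x. f (q x))"
  using cont_homD(4) probe_compose by blast

lemma cont_hom_compose:
  "f \<in> cont_hom M N \<Longrightarrow> g \<in> cont_hom N P \<Longrightarrow> (\<lambda>x. g (f x)) \<in> cont_hom M P"
  unfolding cont_hom_def hom_def using probe_compose[of "mtop M" "mtop N" f] by (auto simp: Pi_iff)

lemma cont_hom_cong:
  assumes "\<And>x. x \<in> carrier M \<Longrightarrow> f x = g x" "monoid M" "topspace (mtop M) = carrier M"
  shows "f \<in> cont_hom M N \<longleftrightarrow> g \<in> cont_hom M N"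
proof -
  have "f \<in> cont_hom M N" if "g \<in> cont_hom M N" "\<And>x. x \<in> carrier M \<Longrightarrow> f x = g x" for f g
    using that assms(2,3) continuous_map_eq[of "mtop M" "mtop N" g f]
    unfolding cont_hom_def hom_def by (auto simp: Pi_iff monoid.m_closed monoid.one_closed)
  then show ?thesis
    using assms(1) by metis
qed

lemma cont_hom_restrict:
  assumes "monoid M" "topspace (mtop M) = carrier M"
  shows "restrict f (carrier M) \<in> cont_hom M N \<longleftrightarrow> f \<in> cont_hom M N"
  by (rule cont_hom_cong) (use assms in auto)

definition ext_cont_hom :: "'a top_monoid \<Rightarrow> 'b top_monoid \<Rightarrow> ('a \<Rightarrow> 'b) set" where
  "ext_cont_hom M N = cont_hom M N \<inter> extensional (carrier M)"

lemma ext_cont_homI: "topological_monoid u M \<Longrightarrow> f \<in> cont_hom M N \<Longrightarrow> restrict f (carrier M) \<in> ext_cont_hom M N"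
  unfolding ext_cont_hom_def using cont_hom_restrict topological_monoidD by blast

context universe
begin

lemma topspace_hom_space [simp]:
  assumes "topspace (mtop M) = carrier M"
  shows "topspace (btop (hom_space u M N)) = ext_cont_hom M N"
  using assms unfolding hom_space_def
  by (auto simp: based_maps_def based_map_def cont_hom_def ext_cont_hom_def)

lemma kspace_hom_space [simp]: "kspace u (btop (hom_space u M N))"
  by (simp add: hom_space_def)

text \<open>Neither the restriction to homomorphisms nor the k-topology changes which families are
  continuous, so the exponential law passes from the mapping space to the hom space.\<close>

lemma probe_hom_space:
  assumes M: "topspace (mtop M) = carrier M" and K: "test u K"
  shows "continuous_map K (btop (hom_space u M N)) F \<longleftrightarrow>
    F \<in> topspace K \<rightarrow> ext_cont_hom M N \<and> joint_probes u K (mtop M) (mtop N) F"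
proof -
  have "f \<in> ext_cont_hom M N \<longleftrightarrow> f \<in> based_maps (underlying M) (underlying N) \<and> f \<in> hom M N" for f
    using M by (auto simp: based_maps_def based_map_def cont_hom_def ext_cont_hom_def)
  then show ?thesis
    unfolding hom_space_def
    by (auto simp: probe_kify[OF K] continuous_map_in_subtopology probe_map_space[OF K])
qed

lemma bpt_hom_space: "bpt (hom_space u M N) = (\<lambda>x\<in>carrier M. \<one>\<^bsub>N\<^esub>)"
  by (simp add: hom_space_def)

lemma one_cont_hom:
  assumes M: "topological_monoid u M" and N: "topological_monoid u N"
  shows "(\<lambda>x. \<one>\<^bsub>N\<^esub>) \<in> cont_hom M N"
  using monoid.one_closed[OF topological_monoidD(1)[OF N]] monoid.l_one[OF topological_monoidD(1)[OF N]]
    topological_monoidD(2)[OF N]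
  unfolding cont_hom_def hom_def by auto

lemma based_kspace_hom_space:
  assumes M: "topological_monoid u M" and N: "topological_monoid u N"
  shows "based_kspace u (hom_space u M N)"
proof -
  have "ext_cont_hom M N \<subseteq> based_maps (underlying M) (underlying N)"
    using topological_monoidD[OF M]
    by (auto simp: based_maps_def based_map_def cont_hom_def ext_cont_hom_def)
  moreover have "small u (based_maps (underlying M) (underlying N))"
    using topological_monoidD[OF M] topological_monoidD[OF N] by (intro small_based_maps) simp_all
  ultimately have "small u (ext_cont_hom M N)"
    using small_subset by blast
  then show ?thesis
    using topological_monoidD[OF M] ext_cont_homI[OF M one_cont_hom[OF M N]]
    unfolding based_kspace_def by (simp add: bpt_hom_space)
qed

section \<open>Enriched composition through the smash product\<close>

section \<open>The categories of topological monoids and groups\<close>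

lemma quotient_map_smash_proj:
  "quotient_map (kprod u (btop X) (btop Y)) (btop (smash u X Y)) (smash_proj X Y)"
proof -
  let ?P = "kprod u (btop X) (btop Y)"
  have "{p \<in> topspace ?P. smash_proj X Y p \<in> smash_proj X Y ` topspace ?P} = topspace ?P"
    by blast
  then have "openin (btop (smash u X Y)) (smash_proj X Y ` topspace ?P)"
    unfolding openin_smash by (metis openin_topspace subset_refl)
  then have "topspace (btop (smash u X Y)) = smash_proj X Y ` topspace ?P"
    using openin_smash[of u X Y "topspace (btop (smash u X Y))"] openin_subset openin_topspace by blast
  then show ?thesis
    unfolding quotient_map_def openin_smash by simp
qed

lemma Tmon_simps [simp]:
  "Obj (Tmon u) = {M. topological_monoid u M}" "Hom (Tmon u) = hom_space u"
  "Cmp (Tmon u) M N P g f = compose (carrier M) g f" "Idn (Tmon u) M = (\<lambda>x\<in>carrier M. x)"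
  by (simp_all add: Tmon_def)

lemma Tgrp_simps [simp]:
  "Obj (Tgrp u) = {M. topological_group u M}" "Hom (Tgrp u) = hom_space u"
  "Cmp (Tgrp u) M N P g f = compose (carrier M) g f" "Idn (Tgrp u) M = (\<lambda>x\<in>carrier M. x)"
  by (simp_all add: Tgrp_def)

lemma compose_ext_cont_hom:
  assumes "topological_monoid u M" "f \<in> ext_cont_hom M N" "g \<in> ext_cont_hom N P"
  shows "compose (carrier M) g f \<in> ext_cont_hom M P"
  using ext_cont_homI[OF assms(1) cont_hom_compose[of f M N g P]] assms(2,3)
  by (simp add: ext_cont_hom_def compose_def)

text \<open>On the k-product, composition is continuous because joint probes can be substituted into
  one another. It descends to the smash product since a composite with a trivial homomorphism on
  either side is trivial.\<close>

lemma hom_space_composition: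
  assumes M: "topological_monoid u M" and N: "topological_monoid u N" and P: "topological_monoid u P"
  shows "based_map (smash u (hom_space u N P) (hom_space u M N)) (hom_space u M P)
      (\<lambda>(g, f). compose (carrier M) g f)"
    and "g \<in> ext_cont_hom N P \<Longrightarrow> f \<in> ext_cont_hom M N \<Longrightarrow>
      compose (carrier M) g f =
        (case smash_proj (hom_space u N P) (hom_space u M N) (g, f) of (g', f') \<Rightarrow> compose (carrier M) g' f')"
proof -
  note M' = topological_monoidD[OF M] and N' = topological_monoidD[OF N] and P' = topological_monoidD[OF P]
  let ?X = "hom_space u N P" and ?Y = "hom_space u M N"
  have 1: "\<one>\<^bsub>N\<^esub> \<in> carrier N"
    using N'(1) monoid.one_closed by blast
  show proj: "compose (carrier M) g f = (case smash_proj ?X ?Y (g, f) of (g', f') \<Rightarrow> compose (carrier M) g' f')"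
    if "g \<in> ext_cont_hom N P" "f \<in> ext_cont_hom M N" for f g
    using that 1 unfolding smash_proj_def bpt_hom_space
    by (auto simp: ext_cont_hom_def compose_def cont_homD intro!: restrict_ext)
  have "continuous_map (kprod u (btop ?X) (btop ?Y)) (btop (hom_space u M P)) (\<lambda>(g, f). compose (carrier M) g f)"
  proof (rule continuous_map_kprodI)
    show "(\<lambda>(g, f). compose (carrier M) g f) \<in> topspace (btop ?X) \<times> topspace (btop ?Y) \<rightarrow>
        topspace (btop (hom_space u M P))"
      using compose_ext_cont_hom[OF M] M'(2) N'(2) by auto
    fix K G F assume K: "test u K"
      and "continuous_map K (btop ?X) G" "continuous_map K (btop ?Y) F"
    then have G: "G \<in> topspace K \<rightarrow> ext_cont_hom N P" "joint_probes u K (mtop N) (mtop P) G"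
      and F: "F \<in> topspace K \<rightarrow> ext_cont_hom M N" "joint_probes u K (mtop M) (mtop N) F"
      using probe_hom_space M'(2) N'(2) by blast+
    have "joint_probes u K (mtop M) (mtop P) (\<lambda>x. compose (carrier M) (G x) (F x))"
    proof (rule joint_probesI)
      fix L p h assume L: "test u L" "continuous_map L K p" and h: "continuous_map L (mtop M) h"
      have "continuous_map L (mtop P) (\<lambda>l. G (p l) (F (p l) (h l)))"
        by (rule joint_probesD[OF G(2) L joint_probesD[OF F(2) L h]])
      then show "continuous_map L (mtop P) (\<lambda>l. compose (carrier M) (G (p l)) (F (p l)) (h l))"
        by (rule continuous_map_eq) (use continuous_map_funspace[OF h] M'(2) in \<open>auto simp: compose_def\<close>)
    qed
    then show "continuous_map K (btop (hom_space u M P))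
        (\<lambda>x. case (G x, F x) of (g, f) \<Rightarrow> compose (carrier M) g f)"
      using compose_ext_cont_hom[OF M funcset_mem[OF F(1)] funcset_mem[OF G(1)]]
      by (simp add: probe_hom_space[OF M'(2) K])
  qed
  then have "continuous_map (kprod u (btop ?X) (btop ?Y)) (btop (hom_space u M P))
      ((\<lambda>(g, f). compose (carrier M) g f) \<circ> smash_proj ?X ?Y)"
    by (rule continuous_map_eq) (use M'(2) N'(2) proj in \<open>auto simp: split_def\<close>)
  then have "continuous_map (btop (smash u ?X ?Y)) (btop (hom_space u M P)) (\<lambda>(g, f). compose (carrier M) g f)"
    using continuous_compose_quotient_map[OF quotient_map_smash_proj] by blast
  moreover have compose_zero: "compose (carrier M) (\<lambda>x\<in>carrier N. \<one>\<^bsub>P\<^esub>) (\<lambda>x\<in>carrier M. \<one>\<^bsub>N\<^esub>) =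
      (\<lambda>x\<in>carrier M. \<one>\<^bsub>P\<^esub>)"
    using 1 by (auto simp: compose_def)
  moreover have "bpt (smash u ?X ?Y) = (bpt ?X, bpt ?Y)"
    by (simp add: smash_def Let_def)
  ultimately show "based_map (smash u ?X ?Y) (hom_space u M P) (\<lambda>(g, f). compose (carrier M) g f)"
    using compose_zero unfolding based_map_def by (simp add: bpt_hom_space)
qed

text \<open>The enrichment is inherited by full subcategories, so leaving the class of objects open
  covers monoids and groups together.\<close>

lemma topp_category_top_monoids:
  fixes C :: "('u top_monoid, 'u \<Rightarrow> 'u) ecat"
  assumes Obj: "\<And>M. M \<in> Obj C \<Longrightarrow> topological_monoid u M" and Hom: "Hom C = hom_space u"
    and Cmp: "Cmp C = (\<lambda>M N P g f. compose (carrier M) g f)" and Idn: "Idn C = (\<lambda>M. \<lambda>x\<in>carrier M. x)"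
  shows "topp_category u C"
proof -
  have Mor: "Mor C a b = ext_cont_hom a b" if "a \<in> Obj C" for a b
    using topspace_hom_space topological_monoidD(2) Obj that by (metis Hom)
  show ?thesis
    unfolding topp_category_def
  proof (intro conjI ballI)
    fix a b assume a: "a \<in> Obj C" and b: "b \<in> Obj C"
    show "based_kspace u (Hom C a b)"
      unfolding Hom by (rule based_kspace_hom_space[OF Obj[OF a] Obj[OF b]])
    fix f assume f: "f \<in> Mor C a b"
    show "Cmp C a a b f (Idn C a) = f" "Cmp C a b b (Idn C b) f = f"
      using f unfolding Cmp Idn Mor[OF a]
      by (auto simp: ext_cont_hom_def compose_def cont_homD extensional_def)
    fix c d g h
    show "Cmp C a b d (Cmp C b c d h g) f = Cmp C a c d h (Cmp C a b c g f)"
      using f unfolding Cmp Mor[OF a]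
      by (auto simp: ext_cont_hom_def compose_def cont_homD intro!: restrict_ext)
  next
    fix a b c assume a: "a \<in> Obj C" and b: "b \<in> Obj C" and c: "c \<in> Obj C"
    show "based_map (smash u (Hom C b c) (Hom C a b)) (Hom C a c) (\<lambda>(g, f). Cmp C a b c g f)"
      using hom_space_composition(1) Obj a b c unfolding Hom Cmp by blast
    fix g f assume "g \<in> Mor C b c" "f \<in> Mor C a b"
    then show "Cmp C a b c g f =
        (case smash_proj (Hom C b c) (Hom C a b) (g, f) of (g', f') \<Rightarrow> Cmp C a b c g' f')"
      using hom_space_composition(2) Obj a b c unfolding Mor[OF a] Mor[OF b] unfolding Hom Cmp by blast
  next
    fix a assume a: "a \<in> Obj C"
    show "Idn C a \<in> Mor C a a"
      unfolding Mor[OF a] Idn by (rule ext_cont_homI[OF Obj[OF a]]) (simp add: cont_hom_def hom_def)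
  qed
qed

lemma topp_category_Tmon: "topp_category u (Tmon u)"
  by (rule topp_category_top_monoids) (simp_all add: Tmon_def)

lemma topp_category_Tgrp: "topp_category u (Tgrp u)"
  by (rule topp_category_top_monoids) (auto simp: Tgrp_def Tmon_def topological_group_def)

lemma topp_functor_forget: "topp_functor u (Tgrp u) (Tmon u) forget"
  using topp_category_Tgrp topp_category_Tmon topological_groupD(1)
  unfolding topp_functor_def by (auto simp: forget_def based_map_def)

end

section \<open>Transport of monoids to the universe type\<close>

section \<open>Small copies\<close>

lemma cont_hom_Units:
  assumes f: "f \<in> cont_hom M N" and M: "monoid M" and N: "monoid N" and x: "x \<in> Units M"
  shows "f x \<in> Units N" "inv\<^bsub>N\<^esub> f x = f (inv\<^bsub>M\<^esub> x)"
proof -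
  have x': "x \<in> carrier M" "inv\<^bsub>M\<^esub> x \<in> carrier M"
    using monoid.Units_closed[OF M x] monoid.Units_inv_closed[OF M x] by auto
  have "f x \<otimes>\<^bsub>N\<^esub> f (inv\<^bsub>M\<^esub> x) = \<one>\<^bsub>N\<^esub>" "f (inv\<^bsub>M\<^esub> x) \<otimes>\<^bsub>N\<^esub> f x = \<one>\<^bsub>N\<^esub>"
    using x' monoid.Units_r_inv[OF M x] monoid.Units_l_inv[OF M x]
    by (simp_all add: cont_homD(2)[OF f, symmetric] cont_homD(3)[OF f])
  moreover have "f x \<in> carrier N" "f (inv\<^bsub>M\<^esub> x) \<in> carrier N"
    using cont_homD(1)[OF f] x' by auto
  ultimately show "f x \<in> Units N" "inv\<^bsub>N\<^esub> f x = f (inv\<^bsub>M\<^esub> x)"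
    using monoid.inv_unique'[OF N, of "f x" "f (inv\<^bsub>M\<^esub> x)"] unfolding Units_def by auto
qed

context universe
begin

text \<open>The isomorphism is delivered as a pair of mutually inverse continuous homomorphisms
  because these two are what later constructions compose with. Smallness is part of being a
  topological monoid, whatever the carrier type, and provides the injection into
  \<open>'u\<close>.\<close>

lemma small_copy:
  fixes M :: "'b top_monoid"
  assumes M: "topological_monoid u M"
  obtains N :: "'u top_monoid" and e g
  where "topological_monoid u N" "topological_group u M \<Longrightarrow> topological_group u N"
    and "e \<in> cont_hom M N" "g \<in> cont_hom N M"
    and "\<And>x. x \<in> carrier M \<Longrightarrow> g (e x) = x" "\<And>y. y \<in> carrier N \<Longrightarrow> e (g y) = y"
proof -
  note M' = topological_monoidD[OF M]
  interpret M: monoid M by (rule M')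
  obtain e :: "'b \<Rightarrow> 'u" where e: "inj_on e (topspace (mtop M))"
    using M'(2,4) small_imp_inj by metis
  define g where "g = inv_into (topspace (mtop M)) e"
  define N where "N = \<lparr>carrier = e ` carrier M, mult = (\<lambda>x y. e (g x \<otimes>\<^bsub>M\<^esub> g y)), one = e \<one>\<^bsub>M\<^esub>,
    mtop = pullback_topology (e ` topspace (mtop M)) g (mtop M)\<rparr>"
  have sel: "carrier N = e ` carrier M" "\<And>x y. x \<otimes>\<^bsub>N\<^esub> y = e (g x \<otimes>\<^bsub>M\<^esub> g y)" "\<one>\<^bsub>N\<^esub> = e \<one>\<^bsub>M\<^esub>"
    "mtop N = pullback_topology (e ` topspace (mtop M)) g (mtop M)"
    by (simp_all add: N_def)
  have h: "homeomorphic_maps (mtop M) (mtop N) e g" and top: "topspace (mtop N) = carrier N"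
    using homeomorphic_copy[OF e] M'(2) by (simp_all add: sel g_def)
  have ge: "g (e x) = x" if "x \<in> carrier M" for x
    using e that M'(2) by (simp add: g_def)
  have monoid: "monoid N"
    by (rule monoidI) (auto simp: sel ge M.m_assoc)
  have ec: "continuous_map (mtop M) (mtop N) e" and gc: "continuous_map (mtop N) (mtop M) g"
    using h by (auto simp: homeomorphic_maps_def)
  have N: "topological_monoid u N"
  proof (rule topological_monoidI[OF monoid top kspace_homeomorphic[OF M'(3) h]])
    show "small u (carrier N)"
      using M'(4) small_image sel by metis
    fix K p q assume "test u K" "continuous_map K (mtop N) p" "continuous_map K (mtop N) q"
    then show "continuous_map K (mtop N) (\<lambda>x. p x \<otimes>\<^bsub>N\<^esub> q x)"
      unfolding sel(2) by (intro probe_compose[OF _ ec] probe_mult[OF M] probe_compose[OF _ gc])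
  qed
  have e_hom: "e \<in> cont_hom M N"
    using ec by (auto simp: cont_hom_def hom_def sel ge)
  have g_hom: "g \<in> cont_hom N M"
    using gc by (auto simp: cont_hom_def hom_def sel ge)
  have eg: "e (g y) = y" if "y \<in> carrier N" for y
    using that by (auto simp: sel ge)
  have "topological_group u N" if "topological_group u M"
  proof (rule topological_groupI[OF N])
    have Units: "Units M = carrier M"
      using topological_groupD(2)[OF that] group.Units_eq by blast
    then show "carrier N \<subseteq> Units N"
      using cont_hom_Units(1)[OF e_hom M.monoid_axioms monoid] by (auto simp: sel)
    have inv: "inv\<^bsub>N\<^esub> y = e (inv\<^bsub>M\<^esub> g y)" if "y \<in> carrier N" for y
      using cont_hom_Units(2)[OF e_hom M.monoid_axioms monoid, of "g y"] Units eg that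
        cont_homD(1)[OF g_hom] by metis
    fix K p assume "test u K" and p: "continuous_map K (mtop N) p"
    have "continuous_map K (mtop N) (\<lambda>x. e (inv\<^bsub>M\<^esub> g (p x)))"
      by (rule probe_compose[OF topological_groupD(3)[OF that probe_compose[OF p gc]] ec])
    then show "continuous_map K (mtop N) (\<lambda>x. inv\<^bsub>N\<^esub> p x)"
      by (rule continuous_map_eq) (use inv funcset_mem[OF continuous_map_funspace[OF p]] top in auto)
  qed
  then show thesis
    by (rule that[OF N _ e_hom g_hom ge eg])
qed

section \<open>Natural transformations in families over test spaces\<close>

section \<open>Spaces of natural transformations\<close>

lemma topspace_nat_trans_space:
  "topspace (btop (nat_trans_space u A W G)) =
    {\<alpha> \<in> PiE (Obj A) (\<lambda>a. based_maps (fobj W a) (fobj G a)).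
      \<forall>a\<in>Obj A. \<forall>b\<in>Obj A. \<forall>f\<in>Mor A a b. \<forall>w\<in>topspace (btop (fobj W a)).
        fmap G a b f (\<alpha> a w) = \<alpha> b (fmap W a b f w)}"
  by (auto simp: nat_trans_space_def)

lemma kspace_nat_trans_space [simp]: "kspace u (btop (nat_trans_space u A W G))"
  by (simp add: nat_trans_space_def)

lemma bpt_nat_trans_space:
  "bpt (nat_trans_space u A W G) =
    (\<lambda>a\<in>Obj A. \<lambda>w\<in>topspace (btop (fobj W a)). bpt (fobj G a))"
  by (simp add: nat_trans_space_def map_space_def)

lemma probe_nat_trans_space:
  assumes K: "test u K"
  shows "continuous_map K (btop (nat_trans_space u A W G)) \<alpha> \<longleftrightarrow>
    \<alpha> \<in> topspace K \<rightarrow> topspace (btop (nat_trans_space u A W G)) \<and>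
    (\<forall>a\<in>Obj A. joint_probes u K (btop (fobj W a)) (btop (fobj G a)) (\<lambda>k. \<alpha> k a))"
  unfolding topspace_nat_trans_space
  by (auto simp: nat_trans_space_def probe_kify[OF K] continuous_map_in_subtopology
      continuous_map_componentwise probe_map_space[OF K] PiE_iff Pi_iff image_subset_iff)

text \<open>The actions on morphisms need to agree only at points of the spaces
  \<open>fobj G a\<close>, since every \<open>\<alpha> a w\<close> is such a point. It serves to
  compare the functors \<open>hom_from\<close> of \<open>Tgrp\<close> and of
  \<open>Tmon\<close>.\<close>

lemma nat_trans_space_cong:
  assumes "\<And>a. a \<in> Obj A \<Longrightarrow> fobj G a = fobj H a"
    and "\<And>a b f x. a \<in> Obj A \<Longrightarrow> b \<in> Obj A \<Longrightarrow> f \<in> Mor A a b \<Longrightarrow> x \<in> topspace (btop (fobj G a)) \<Longrightarrow>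
      fmap G a b f x = fmap H a b f x"
  shows "nat_trans_space u A W G = nat_trans_space u A W H"
proof -
  have top: "topspace (btop (nat_trans_space u A W G)) = topspace (btop (nat_trans_space u A W H))"
  proof -
    have "(\<forall>a\<in>Obj A. \<forall>b\<in>Obj A. \<forall>f\<in>Mor A a b. \<forall>w\<in>topspace (btop (fobj W a)).
          fmap G a b f (\<alpha> a w) = \<alpha> b (fmap W a b f w)) \<longleftrightarrow>
        (\<forall>a\<in>Obj A. \<forall>b\<in>Obj A. \<forall>f\<in>Mor A a b. \<forall>w\<in>topspace (btop (fobj W a)).
          fmap H a b f (\<alpha> a w) = \<alpha> b (fmap W a b f w))"
      if "\<alpha> \<in> PiE (Obj A) (\<lambda>a. based_maps (fobj W a) (fobj G a))" for \<alpha>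
    proof -
      have "\<alpha> a w \<in> topspace (btop (fobj G a))" if "a \<in> Obj A" "w \<in> topspace (btop (fobj W a))" for a w
        using PiE_mem[OF \<open>\<alpha> \<in> _\<close> that(1)] that(2) based_maps_subset[of "fobj W a" "fobj G a"] by blast
      then show ?thesis
        by (intro ball_cong refl) (simp add: assms(2))
    qed
    moreover have "PiE (Obj A) (\<lambda>a. based_maps (fobj W a) (fobj G a)) =
        PiE (Obj A) (\<lambda>a. based_maps (fobj W a) (fobj H a))"
      using assms(1) by (intro PiE_cong) simp
    ultimately show ?thesis
      unfolding topspace_nat_trans_space by blast
  qed
  moreover have "btop (nat_trans_space u A W G) = btop (nat_trans_space u A W H)"
    by (rule kspace_eqI[of u]) (use assms(1) in \<open>simp_all add: top probe_nat_trans_space\<close>)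
  moreover have "bpt (nat_trans_space u A W G) = bpt (nat_trans_space u A W H)"
    unfolding bpt_nat_trans_space using assms(1) by (auto intro!: restrict_ext)
  ultimately show ?thesis
    by simp
qed

text \<open>Points are probes from the one-point space, so that only families need to be examined.\<close>

lemma discrete_sing_nontrivial [simp]: "discrete_topology {z} \<noteq> trivial_topology"
  by (metis insert_not_empty topspace_discrete_topology)

lemma point_probe: "continuous_map (discrete_topology {z}) X (\<lambda>_. x) \<longleftrightarrow> x \<in> topspace X"
  by simp

text \<open>Reduces an enriched universal property to mutually inverse assignments that carry
  continuous families over a test space to continuous families. The maps between points are the case
  of a one-point parameter space.\<close>

lemma probes_homeomorphic_map:
  assumes X: "kspace u X" and Y: "kspace u Y"
    and f: "\<And>K q. test u K \<Longrightarrow> continuous_map K X q \<Longrightarrow> continuous_map K Y (\<lambda>k. f (q k))"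
    and g: "\<And>K q. test u K \<Longrightarrow> continuous_map K Y q \<Longrightarrow> continuous_map K X (\<lambda>k. g (q k))"
    and gf: "\<And>x. x \<in> topspace X \<Longrightarrow> g (f x) = x" and fg: "\<And>y. y \<in> topspace Y \<Longrightarrow> f (g y) = y"
  shows "homeomorphic_map X Y f"
proof -
  have "f \<in> topspace X \<rightarrow> topspace Y"
    using f[OF test_sing] point_probe[of undefined X] point_probe[of undefined Y] by blast
  moreover have "g \<in> topspace Y \<rightarrow> topspace X"
    using g[OF test_sing] point_probe[of undefined X] point_probe[of undefined Y] by blast
  ultimately have "homeomorphic_maps X Y f g"
    unfolding homeomorphic_maps_def
    by (intro conjI ballI kspace_continuous_mapI[OF X _ f] kspace_continuous_mapI[OF Y _ g] gf fg)
  then show ?thesis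
    by (meson homeomorphic_maps_map)
qed

text \<open>Separates the equations of a based natural transformation from its continuity, so that
  they can be checked for each parameter alone.\<close>

definition natural_family ::
  "('o, 'h) ecat \<Rightarrow> ('o, 'h, 'a based, 'a \<Rightarrow> 'a) efun \<Rightarrow> ('o, 'h, 'b based, 'b \<Rightarrow> 'b) efun \<Rightarrow>
    ('o \<Rightarrow> 'a \<Rightarrow> 'b) \<Rightarrow> bool" where
  "natural_family A W G \<alpha> \<longleftrightarrow>
     \<alpha> \<in> PiE (Obj A) (\<lambda>a. PiE (topspace (btop (fobj W a))) (\<lambda>_. topspace (btop (fobj G a)))) \<and>
     (\<forall>a\<in>Obj A. \<alpha> a (bpt (fobj W a)) = bpt (fobj G a)) \<and>
     (\<forall>a\<in>Obj A. \<forall>b\<in>Obj A. \<forall>f\<in>Mor A a b. \<forall>w\<in>topspace (btop (fobj W a)).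
        fmap G a b f (\<alpha> a w) = \<alpha> b (fmap W a b f w))"

text \<open>
  Continuity of the single components is contained in the condition on joint probes, by taking
  constant maps to the parameter space.
\<close>

lemma probe_nat_trans_space_iff:
  assumes K: "test u K" and W: "\<And>a. a \<in> Obj A \<Longrightarrow> kspace u (btop (fobj W a))"
  shows "continuous_map K (btop (nat_trans_space u A W G)) \<alpha> \<longleftrightarrow>
    (\<forall>k\<in>topspace K. natural_family A W G (\<alpha> k)) \<and>
    (\<forall>a\<in>Obj A. joint_probes u K (btop (fobj W a)) (btop (fobj G a)) (\<lambda>k. \<alpha> k a))"
proof -
  have "\<alpha> k \<in> topspace (btop (nat_trans_space u A W G)) \<longleftrightarrow> natural_family A W G (\<alpha> k)"
    if k: "k \<in> topspace K"
      and joint: "\<forall>a\<in>Obj A. joint_probes u K (btop (fobj W a)) (btop (fobj G a)) (\<lambda>k. \<alpha> k a)" for k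
  proof -
    have "\<alpha> k a \<in> based_maps (fobj W a) (fobj G a) \<longleftrightarrow>
        \<alpha> k a \<in> PiE (topspace (btop (fobj W a))) (\<lambda>_. topspace (btop (fobj G a))) \<and>
        \<alpha> k a (bpt (fobj W a)) = bpt (fobj G a)" if a: "a \<in> Obj A" for a
    proof -
      have "continuous_map L (btop (fobj G a)) (\<lambda>x. \<alpha> k a (q x))"
        if "test u L" "continuous_map L (btop (fobj W a)) q" for L q
        using joint_probesD[OF bspec[OF joint a] that(1) _ that(2), of "\<lambda>_. k"] k by simp
      then show ?thesis
        unfolding based_maps_iff[OF W[OF a]] PiE_def by blast
    qed
    then show ?thesis
      unfolding topspace_nat_trans_space natural_family_def by (auto simp: PiE_iff)
  qed
  then show ?thesis
    unfolding probe_nat_trans_space[OF K] by blast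
qed

end

section \<open>Weighted limits with pointwise multiplication\<close>

section \<open>Limits\<close>

text \<open>Common to limits and colimits. The action of the weight on morphisms is left to the two
  extensions, because \<open>W\<close> is covariant on \<open>A\<close> for limits and contravariant
  for colimits.\<close>

locale weighted = universe u for u :: "'u itself" +
  fixes A :: "('i, 'j) ecat" and W :: "('i, 'j, 'a based, 'a \<Rightarrow> 'a) efun"
    and D :: "('i, 'j, 'u top_monoid, 'u \<Rightarrow> 'u) efun"
  assumes small_Obj: "small u (Obj A)"
    and W_obj: "a \<in> Obj A \<Longrightarrow> based_kspace u (fobj W a)"
    and D_obj: "a \<in> Obj A \<Longrightarrow> topological_monoid u (fobj D a)"
    and D_map: "a \<in> Obj A \<Longrightarrow> b \<in> Obj A \<Longrightarrow> f \<in> Mor A a b \<Longrightarrow> fmap D a b f \<in> cont_hom (fobj D a) (fobj D b)"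
begin

abbreviation "pt a \<equiv> topspace (btop (fobj W a))"

lemma kspace_W: "a \<in> Obj A \<Longrightarrow> kspace u (btop (fobj W a))"
  and small_W: "a \<in> Obj A \<Longrightarrow> small u (pt a)"
  and bpt_W: "a \<in> Obj A \<Longrightarrow> bpt (fobj W a) \<in> pt a"
  using W_obj unfolding based_kspace_def by auto

lemma monoid_D: "a \<in> Obj A \<Longrightarrow> monoid (fobj D a)"
  and topspace_D: "a \<in> Obj A \<Longrightarrow> topspace (mtop (fobj D a)) = carrier (fobj D a)"
  and kspace_D: "a \<in> Obj A \<Longrightarrow> kspace u (mtop (fobj D a))"
  and small_D: "a \<in> Obj A \<Longrightarrow> small u (carrier (fobj D a))"
  using D_obj topological_monoidD by blast+

end

locale limit_data = weighted u A W D
  for u :: "'u itself" and A :: "('i, 'j) ecat" and W :: "('i, 'j, 'a based, 'a \<Rightarrow> 'a) efun"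
    and D :: "('i, 'j, 'u top_monoid, 'u \<Rightarrow> 'u) efun" +
  assumes W_map: "a \<in> Obj A \<Longrightarrow> b \<in> Obj A \<Longrightarrow> f \<in> Mor A a b \<Longrightarrow> w \<in> pt a \<Longrightarrow> fmap W a b f w \<in> pt b"
begin

definition "underlying_diagram = \<lparr>fobj = \<lambda>a. underlying (fobj D a), fmap = fmap D\<rparr>"

definition "lim_monoid =
  \<lparr>carrier = topspace (btop (nat_trans_space u A W underlying_diagram)),
   mult = (\<lambda>\<alpha> \<beta>. \<lambda>a\<in>Obj A. \<lambda>w\<in>pt a. \<alpha> a w \<otimes>\<^bsub>fobj D a\<^esub> \<beta> a w),
   one = (\<lambda>a\<in>Obj A. \<lambda>w\<in>pt a. \<one>\<^bsub>fobj D a\<^esub>),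
   mtop = btop (nat_trans_space u A W underlying_diagram)\<rparr>"

lemma lim_monoid_simps:
  "carrier lim_monoid = topspace (mtop lim_monoid)"
  "\<alpha> \<otimes>\<^bsub>lim_monoid\<^esub> \<beta> = (\<lambda>a\<in>Obj A. \<lambda>w\<in>pt a. \<alpha> a w \<otimes>\<^bsub>fobj D a\<^esub> \<beta> a w)"
  "\<one>\<^bsub>lim_monoid\<^esub> = (\<lambda>a\<in>Obj A. \<lambda>w\<in>pt a. \<one>\<^bsub>fobj D a\<^esub>)"
  "mtop lim_monoid = btop (nat_trans_space u A W underlying_diagram)"
  by (simp_all add: lim_monoid_def)

lemma natural_family_underlying:
  "natural_family A W underlying_diagram \<alpha> \<longleftrightarrow>
     \<alpha> \<in> PiE (Obj A) (\<lambda>a. PiE (pt a) (\<lambda>_. carrier (fobj D a))) \<and>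
     (\<forall>a\<in>Obj A. \<alpha> a (bpt (fobj W a)) = \<one>\<^bsub>fobj D a\<^esub>) \<and>
     (\<forall>a\<in>Obj A. \<forall>b\<in>Obj A. \<forall>f\<in>Mor A a b. \<forall>w\<in>pt a. fmap D a b f (\<alpha> a w) = \<alpha> b (fmap W a b f w))"
proof -
  have "PiE (Obj A) (\<lambda>a. PiE (pt a) (\<lambda>_. topspace (mtop (fobj D a)))) =
      PiE (Obj A) (\<lambda>a. PiE (pt a) (\<lambda>_. carrier (fobj D a)))"
    by (intro PiE_cong) (simp add: topspace_D)
  then show ?thesis
    unfolding natural_family_def underlying_diagram_def by simp
qed

lemma probe_lim_monoid:
  assumes "test u K"
  shows "continuous_map K (mtop lim_monoid) \<alpha> \<longleftrightarrow>
    (\<forall>k\<in>topspace K. natural_family A W underlying_diagram (\<alpha> k)) \<and>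
    (\<forall>a\<in>Obj A. joint_probes u K (btop (fobj W a)) (mtop (fobj D a)) (\<lambda>k. \<alpha> k a))"
proof -
  have "btop (fobj underlying_diagram a) = mtop (fobj D a)" for a
    by (simp add: underlying_diagram_def)
  then show ?thesis
    unfolding lim_monoid_simps(4) using probe_nat_trans_space_iff[OF assms kspace_W, where G = underlying_diagram]
    by simp
qed

lemma lim_monoid_natural: "\<alpha> \<in> carrier lim_monoid \<Longrightarrow> natural_family A W underlying_diagram \<alpha>"
  using probe_lim_monoid[OF test_sing, of _ "\<lambda>_. \<alpha>"] point_probe[of _ "mtop lim_monoid" \<alpha>]
  by (simp add: lim_monoid_simps)

lemma lim_monoid_PiE:
  "\<alpha> \<in> carrier lim_monoid \<Longrightarrow> \<alpha> \<in> PiE (Obj A) (\<lambda>a. PiE (pt a) (\<lambda>_. carrier (fobj D a)))"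
  using lim_monoid_natural[of \<alpha>] by (simp add: natural_family_underlying)

lemma lim_monoid_ext:
  assumes "\<alpha> \<in> carrier lim_monoid" "\<beta> \<in> carrier lim_monoid"
    and "\<And>a w. a \<in> Obj A \<Longrightarrow> w \<in> pt a \<Longrightarrow> \<alpha> a w = \<beta> a w"
  shows "\<alpha> = \<beta>"
proof -
  have *: "\<alpha> \<in> PiE (Obj A) (\<lambda>a. PiE (pt a) (\<lambda>_. carrier (fobj D a)))"
      "\<beta> \<in> PiE (Obj A) (\<lambda>a. PiE (pt a) (\<lambda>_. carrier (fobj D a)))"
    using lim_monoid_PiE assms(1,2) by auto
  show ?thesis
    by (rule PiE_ext[OF *], rule PiE_ext[OF PiE_mem[OF *(1)] PiE_mem[OF *(2)]]) (use assms(3) in auto)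
qed

lemma lim_monoid_apply:
  "\<alpha> \<in> carrier lim_monoid \<Longrightarrow> a \<in> Obj A \<Longrightarrow> w \<in> pt a \<Longrightarrow> \<alpha> a w \<in> carrier (fobj D a)"
  using lim_monoid_natural[of \<alpha>] unfolding natural_family_underlying by (blast dest: PiE_mem)

text \<open>Over a one-point \<open>K\<close> this produces elements of \<open>lim_monoid\<close>;
  over a general \<open>K\<close> it proves that they depend continuously on parameters. One
  verification thus yields both closure under an operation and its continuity.\<close>

lemma probe_lim_monoidI:
  assumes K: "test u K"
    and closed: "\<And>k a w. k \<in> topspace K \<Longrightarrow> a \<in> Obj A \<Longrightarrow> w \<in> pt a \<Longrightarrow> \<alpha> k a w \<in> carrier (fobj D a)"
    and base: "\<And>k a. k \<in> topspace K \<Longrightarrow> a \<in> Obj A \<Longrightarrow> \<alpha> k a (bpt (fobj W a)) = \<one>\<^bsub>fobj D a\<^esub>"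
    and nat: "\<And>k a b f w. k \<in> topspace K \<Longrightarrow> a \<in> Obj A \<Longrightarrow> b \<in> Obj A \<Longrightarrow> f \<in> Mor A a b \<Longrightarrow> w \<in> pt a \<Longrightarrow>
      fmap D a b f (\<alpha> k a w) = \<alpha> k b (fmap W a b f w)"
    and joint: "\<And>a L p h. a \<in> Obj A \<Longrightarrow> test u L \<Longrightarrow> continuous_map L K p \<Longrightarrow>
      continuous_map L (btop (fobj W a)) h \<Longrightarrow> continuous_map L (mtop (fobj D a)) (\<lambda>l. \<alpha> (p l) a (h l))"
  shows "continuous_map K (mtop lim_monoid) (\<lambda>k. \<lambda>a\<in>Obj A. \<lambda>w\<in>pt a. \<alpha> k a w)"
  unfolding probe_lim_monoid[OF K] natural_family_underlying
proof (intro conjI ballI)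
  fix a assume a: "a \<in> Obj A"
  show "joint_probes u K (btop (fobj W a)) (mtop (fobj D a)) (\<lambda>k. (\<lambda>a\<in>Obj A. \<lambda>w\<in>pt a. \<alpha> k a w) a)"
  proof (rule joint_probesI)
    fix L p h assume "test u L" "continuous_map L K p" and h: "continuous_map L (btop (fobj W a)) h"
    then have "continuous_map L (mtop (fobj D a)) (\<lambda>l. \<alpha> (p l) a (h l))"
      using joint a by blast
    then show "continuous_map L (mtop (fobj D a)) (\<lambda>l. (\<lambda>a\<in>Obj A. \<lambda>w\<in>pt a. \<alpha> (p l) a w) a (h l))"
      by (rule continuous_map_eq) (use a funcset_mem[OF continuous_map_funspace[OF h]] in simp)
  qed
qed (use closed base nat bpt_W W_map in auto)

lemma probe_lim_monoidD:
  assumes "test u K" "continuous_map K (mtop lim_monoid) \<alpha>" "a \<in> Obj A" "continuous_map K (btop (fobj W a)) h"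
  shows "continuous_map K (mtop (fobj D a)) (\<lambda>k. \<alpha> k a (h k))"
  using assms joint_probesD[of u K "btop (fobj W a)" "mtop (fobj D a)" "\<lambda>k. \<alpha> k a" K "\<lambda>k. k" h]
  unfolding probe_lim_monoid[OF assms(1)] by simp

lemma probe_lim_monoidE:
  assumes K: "test u K" and q: "continuous_map K (mtop lim_monoid) \<alpha>" and k: "k \<in> topspace K"
  shows "\<alpha> k \<in> carrier lim_monoid"
  using funcset_mem[OF continuous_map_funspace[OF q] k] by (simp add: lim_monoid_simps)

lemma probe_lim_monoid_mult:
  assumes K: "test u K" and "continuous_map K (mtop lim_monoid) \<alpha>" "continuous_map K (mtop lim_monoid) \<beta>"
  shows "continuous_map K (mtop lim_monoid) (\<lambda>k. \<alpha> k \<otimes>\<^bsub>lim_monoid\<^esub> \<beta> k)"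
  unfolding lim_monoid_simps(2)
proof (rule probe_lim_monoidI[OF K])
  note car = probe_lim_monoidE[OF K assms(2)] probe_lim_monoidE[OF K assms(3)]
  note nat = car[THEN lim_monoid_natural, unfolded natural_family_underlying]
  fix k a assume k: "k \<in> topspace K" and a: "a \<in> Obj A"
  show "\<alpha> k a w \<otimes>\<^bsub>fobj D a\<^esub> \<beta> k a w \<in> carrier (fobj D a)" if "w \<in> pt a" for w
    using monoid.m_closed[OF monoid_D[OF a]] lim_monoid_apply car k a that by blast
  show "\<alpha> k a (bpt (fobj W a)) \<otimes>\<^bsub>fobj D a\<^esub> \<beta> k a (bpt (fobj W a)) = \<one>\<^bsub>fobj D a\<^esub>"
    using nat[OF k] a monoid.l_one[OF monoid_D[OF a]] monoid.one_closed[OF monoid_D[OF a]] by simp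
  fix b f w assume b: "b \<in> Obj A" and f: "f \<in> Mor A a b" and w: "w \<in> pt a"
  have "fmap D a b f (\<alpha> k a w) = \<alpha> k b (fmap W a b f w)" "fmap D a b f (\<beta> k a w) = \<beta> k b (fmap W a b f w)"
    using nat[OF k] a b f w by blast+
  then show "fmap D a b f (\<alpha> k a w \<otimes>\<^bsub>fobj D a\<^esub> \<beta> k a w) =
      \<alpha> k b (fmap W a b f w) \<otimes>\<^bsub>fobj D b\<^esub> \<beta> k b (fmap W a b f w)"
    using cont_homD(2)[OF D_map[OF a b f]] lim_monoid_apply car k a w by simp
next
  fix a L p h assume a: "a \<in> Obj A" and L: "test u L" and p: "continuous_map L K p"
    and h: "continuous_map L (btop (fobj W a)) h"
  show "continuous_map L (mtop (fobj D a)) (\<lambda>l. \<alpha> (p l) a (h l) \<otimes>\<^bsub>fobj D a\<^esub> \<beta> (p l) a (h l))"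
    using probe_mult[OF D_obj[OF a] L] probe_lim_monoidD[OF L probe_compose[OF p assms(2)] a h]
      probe_lim_monoidD[OF L probe_compose[OF p assms(3)] a h] by blast
qed

lemma topological_monoid_lim: "topological_monoid u lim_monoid"
proof (rule topological_monoidI)
  have pointI: "x \<in> carrier lim_monoid" if "continuous_map (discrete_topology {undefined :: 'u}) (mtop lim_monoid) (\<lambda>_. x)" for x
    using that by (simp add: lim_monoid_simps(1))
  have pointD: "continuous_map (discrete_topology {undefined :: 'u}) (mtop lim_monoid) (\<lambda>_. x)"
    if "x \<in> carrier lim_monoid" for x
    using that by (simp add: lim_monoid_simps(1))
  have mult: "x \<otimes>\<^bsub>lim_monoid\<^esub> y \<in> carrier lim_monoid" if "x \<in> carrier lim_monoid" "y \<in> carrier lim_monoid" for x y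
    using probe_lim_monoid_mult[OF test_sing pointD pointD] pointI that by blast
  have one: "\<one>\<^bsub>lim_monoid\<^esub> \<in> carrier lim_monoid"
    unfolding lim_monoid_simps(3)
    by (rule pointI[OF probe_lim_monoidI[OF test_sing]])
      (use topspace_D cont_homD(3)[OF D_map] monoid.one_closed[OF monoid_D] in \<open>simp_all\<close>)
  show "monoid lim_monoid"
  proof
    fix x y z assume x: "x \<in> carrier lim_monoid" and y: "y \<in> carrier lim_monoid"
    show "x \<otimes>\<^bsub>lim_monoid\<^esub> y \<in> carrier lim_monoid"
      by (rule mult[OF x y])
    show "\<one>\<^bsub>lim_monoid\<^esub> \<otimes>\<^bsub>lim_monoid\<^esub> x = x"
      by (rule lim_monoid_ext[OF mult[OF one x] x])
        (use monoid.l_one[OF monoid_D] lim_monoid_apply[OF x] in \<open>simp add: lim_monoid_simps\<close>)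
    show "x \<otimes>\<^bsub>lim_monoid\<^esub> \<one>\<^bsub>lim_monoid\<^esub> = x"
      by (rule lim_monoid_ext[OF mult[OF x one] x])
        (use monoid.r_one[OF monoid_D] lim_monoid_apply[OF x] in \<open>simp add: lim_monoid_simps\<close>)
    assume z: "z \<in> carrier lim_monoid"
    show "x \<otimes>\<^bsub>lim_monoid\<^esub> y \<otimes>\<^bsub>lim_monoid\<^esub> z = x \<otimes>\<^bsub>lim_monoid\<^esub> (y \<otimes>\<^bsub>lim_monoid\<^esub> z)"
      by (rule lim_monoid_ext[OF mult[OF mult[OF x y] z] mult[OF x mult[OF y z]]])
        (use monoid.m_assoc[OF monoid_D] lim_monoid_apply[OF x] lim_monoid_apply[OF y] lim_monoid_apply[OF z]
          in \<open>simp add: lim_monoid_simps\<close>)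
  qed (rule one)
  show "topspace (mtop lim_monoid) = carrier lim_monoid"
    by (simp add: lim_monoid_simps)
  show "kspace u (mtop lim_monoid)"
    by (simp add: lim_monoid_simps)
  have "carrier lim_monoid \<subseteq> PiE (Obj A) (\<lambda>a. PiE (pt a) (\<lambda>_. carrier (fobj D a)))"
    using lim_monoid_PiE by blast
  then show "small u (carrier lim_monoid)"
    by (rule small_subset[rotated]) (simp add: small_PiE small_Obj small_W small_D)
qed (rule probe_lim_monoid_mult)

lemma topological_group_lim:
  assumes grp: "\<And>a. a \<in> Obj A \<Longrightarrow> topological_group u (fobj D a)"
  shows "topological_group u lim_monoid"
proof -
  \<comment> \<open>Pointwise inversion keeps a family natural, because homomorphisms commute with
    inverses of units.\<close>
  define J where "J \<alpha> = (\<lambda>a\<in>Obj A. \<lambda>w\<in>pt a. inv\<^bsub>fobj D a\<^esub> \<alpha> a w)" for \<alpha> :: "'i \<Rightarrow> 'a \<Rightarrow> 'u"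
  note M = topological_monoid_lim
  note group = topological_groupD(2)[OF grp]
  have J_probe: "continuous_map K (mtop lim_monoid) (\<lambda>k. J (\<alpha> k))"
    if K: "test u K" and \<alpha>: "continuous_map K (mtop lim_monoid) \<alpha>" for K \<alpha>
    unfolding J_def
  proof (rule probe_lim_monoidI[OF K])
    note car = probe_lim_monoidE[OF K \<alpha>]
    note nat = car[THEN lim_monoid_natural, unfolded natural_family_underlying]
    fix k a assume k: "k \<in> topspace K" and a: "a \<in> Obj A"
    show "inv\<^bsub>fobj D a\<^esub> \<alpha> k a w \<in> carrier (fobj D a)" if "w \<in> pt a" for w
      using group.inv_closed[OF group[OF a]] lim_monoid_apply car k a that by blast
    show "inv\<^bsub>fobj D a\<^esub> \<alpha> k a (bpt (fobj W a)) = \<one>\<^bsub>fobj D a\<^esub>"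
      using nat[OF k] a monoid.inv_one[OF monoid_D[OF a]] by simp
    fix b f w assume b: "b \<in> Obj A" and f: "f \<in> Mor A a b" and w: "w \<in> pt a"
    have "\<alpha> k a w \<in> Units (fobj D a)"
      using lim_monoid_apply car k a w group.Units_eq[OF group[OF a]] by simp
    then have "fmap D a b f (inv\<^bsub>fobj D a\<^esub> \<alpha> k a w) = inv\<^bsub>fobj D b\<^esub> fmap D a b f (\<alpha> k a w)"
      using cont_hom_Units(2)[OF D_map[OF a b f] monoid_D[OF a] monoid_D[OF b]] by simp
    also have "fmap D a b f (\<alpha> k a w) = \<alpha> k b (fmap W a b f w)"
      using nat[OF k] a b f w by blast
    finally show "fmap D a b f (inv\<^bsub>fobj D a\<^esub> \<alpha> k a w) = inv\<^bsub>fobj D b\<^esub> \<alpha> k b (fmap W a b f w)" .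
  next
    fix a L p h assume a: "a \<in> Obj A" and L: "test u L" and p: "continuous_map L K p"
      and h: "continuous_map L (btop (fobj W a)) h"
    show "continuous_map L (mtop (fobj D a)) (\<lambda>l. inv\<^bsub>fobj D a\<^esub> \<alpha> (p l) a (h l))"
      by (rule topological_groupD(3)[OF grp[OF a] probe_lim_monoidD[OF L probe_compose[OF p \<alpha>] a h]])
  qed
  have J: "J x \<in> carrier lim_monoid" if "x \<in> carrier lim_monoid" for x
    using J_probe[OF test_sing, of undefined "\<lambda>_. x"] that by (simp add: lim_monoid_simps(1))
  note mon = topological_monoidD(1)[OF M]
  have JJ: "J x \<otimes>\<^bsub>lim_monoid\<^esub> x = \<one>\<^bsub>lim_monoid\<^esub>" "x \<otimes>\<^bsub>lim_monoid\<^esub> J x = \<one>\<^bsub>lim_monoid\<^esub>"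
    if x: "x \<in> carrier lim_monoid" for x
    using group.l_inv[OF group] group.r_inv[OF group] lim_monoid_apply[OF x]
    by (auto simp: lim_monoid_simps(2,3) J_def intro!: restrict_ext)
  have inv: "inv\<^bsub>lim_monoid\<^esub> x = J x" if "x \<in> carrier lim_monoid" for x
    using monoid.inv_unique'[OF mon that J[OF that] JJ(2,1)[OF that]] by simp
  show ?thesis
  proof (rule topological_groupI[OF M])
    show "carrier lim_monoid \<subseteq> Units lim_monoid"
      using J JJ unfolding Units_def by blast
    fix K \<alpha> assume K: "test u K" and \<alpha>: "continuous_map K (mtop lim_monoid) \<alpha>"
    show "continuous_map K (mtop lim_monoid) (\<lambda>k. inv\<^bsub>lim_monoid\<^esub> \<alpha> k)"
      by (rule continuous_map_eq[OF J_probe[OF K \<alpha>]]) (simp add: inv probe_lim_monoidE[OF K \<alpha>])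
  qed
qed

text \<open>
  The statements about the full subcategories of groups and of monoids are proved at once, for a
  category \<open>R\<close> with the hom spaces of \<open>Tmon\<close> on some class of topological monoids.
\<close>

lemma is_indexed_limit_copy:
  fixes R :: "('u top_monoid, 'u \<Rightarrow> 'u) ecat"
  assumes L: "topological_monoid u L" and e: "e \<in> cont_hom lim_monoid L" and g: "g \<in> cont_hom L lim_monoid"
    and ge: "\<And>x. x \<in> carrier lim_monoid \<Longrightarrow> g (e x) = x" and eg: "\<And>y. y \<in> carrier L \<Longrightarrow> e (g y) = y"
    and Hom: "Hom R = hom_space u" and Cmp: "Cmp R = (\<lambda>M N P g f. compose (carrier M) g f)"
    and Obj: "Obj R \<subseteq> Collect (topological_monoid u)" and LR: "L \<in> Obj R"
  shows "is_indexed_limit u R A W D L (\<lambda>X f. \<lambda>a\<in>Obj A. \<lambda>w\<in>pt a. \<lambda>x\<in>carrier X. g (f x) a w)"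
  unfolding is_indexed_limit_def
proof (intro conjI ballI LR)
  fix X assume "X \<in> Obj R"
  then have X: "topological_monoid u X"
    using Obj by blast
  \<comment> \<open>The bijection only moves the argument \<open>x\<close> past the pair
    \<open>(a, w)\<close>; \<open>g\<close> and \<open>e\<close> switch between \<open>L\<close> and
    the monoid \<open>lim_monoid\<close> of which it is a copy.\<close>
  let ?\<phi> = "\<lambda>f. \<lambda>a\<in>Obj A. \<lambda>w\<in>pt a. \<lambda>x\<in>carrier X. g (f x) a w"
  let ?\<psi> = "\<lambda>\<theta>. \<lambda>x\<in>carrier X. e (\<lambda>a\<in>Obj A. \<lambda>w\<in>pt a. \<theta> a w x)"
  let ?N = "nat_trans_space u A W (hom_to R X D)"
  note X' = topological_monoidD[OF X] and L' = topological_monoidD[OF L]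
  note lim' = topological_monoidD[OF topological_monoid_lim]
  have nat: "natural_family A W (hom_to R X D) \<theta> \<longleftrightarrow>
      \<theta> \<in> PiE (Obj A) (\<lambda>a. PiE (pt a) (\<lambda>_. ext_cont_hom X (fobj D a))) \<and>
      (\<forall>a\<in>Obj A. \<theta> a (bpt (fobj W a)) = (\<lambda>x\<in>carrier X. \<one>\<^bsub>fobj D a\<^esub>)) \<and>
      (\<forall>a\<in>Obj A. \<forall>b\<in>Obj A. \<forall>f\<in>Mor A a b. \<forall>w\<in>pt a.
        compose (carrier X) (fmap D a b f) (\<theta> a w) = \<theta> b (fmap W a b f w))" for \<theta>
    using X'(2) unfolding natural_family_def hom_to_def Hom Cmp
    by (auto simp: bpt_hom_space PiE_iff)
  have probe: "continuous_map K (btop ?N) \<theta> \<longleftrightarrow>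
      (\<forall>k\<in>topspace K. natural_family A W (hom_to R X D) (\<theta> k)) \<and>
      (\<forall>a\<in>Obj A. joint_probes u K (btop (fobj W a)) (btop (hom_space u X (fobj D a))) (\<lambda>k. \<theta> k a))"
    if "test u K" for K \<theta>
    using probe_nat_trans_space_iff[OF that kspace_W, where G = "hom_to R X D"] by (simp add: hom_to_def Hom)
  have gL: "g y \<in> carrier lim_monoid" if "y \<in> carrier L" for y
    using cont_homD(1)[OF g] that by blast
  have hom_car: "f x \<in> carrier L" if "f \<in> ext_cont_hom X L" "x \<in> carrier X" for f x
    using that by (auto simp: ext_cont_hom_def cont_homD)
  have \<phi>_probe: "continuous_map K (btop ?N) (\<lambda>k. ?\<phi> (F k))"
    if K: "test u K" and "continuous_map K (btop (hom_space u X L)) F" for K F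
  proof -
    have F: "F \<in> topspace K \<rightarrow> ext_cont_hom X L" and joint: "joint_probes u K (mtop X) (mtop L) F"
      using that(2) unfolding probe_hom_space[OF X'(2) K] by auto
    \<comment> \<open>All three variables vary at once: the parameter in \<open>K\<close>, the point
      of the weight and the element of \<open>X\<close>. Freezing two of them gives continuity of a
      single component.\<close>
    have cts: "continuous_map P (mtop (fobj D a)) (\<lambda>l. g (F (p l) (x l)) a (h l))"
      if "test u P" "continuous_map P K p" "a \<in> Obj A" "continuous_map P (btop (fobj W a)) h"
        "continuous_map P (mtop X) x" for P p a h x
      by (rule probe_lim_monoidD[OF that(1) probe_cont_hom[OF g joint_probesD[OF joint that(1,2,5)]] that(3,4)])
    have hom: "(\<lambda>x\<in>carrier X. g (F k x) a w) \<in> ext_cont_hom X (fobj D a)"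
      if k: "k \<in> topspace K" and a: "a \<in> Obj A" and w: "w \<in> pt a" for k a w
    proof (rule ext_cont_homI[OF X cont_homI[OF X'(3,2) topspace_D[OF a]]])
      have Fk: "F k \<in> cont_hom X L"
        using funcset_mem[OF F k] by (simp add: ext_cont_hom_def)
      have gF: "(\<lambda>x. g (F k x)) \<in> cont_hom X lim_monoid"
        by (rule cont_hom_compose[OF Fk g])
      show "g (F k x) a w \<in> carrier (fobj D a)" if "x \<in> carrier X" for x
        using lim_monoid_apply[OF cont_homD(1)[OF gF that] a w] .
      show "g (F k (x \<otimes>\<^bsub>X\<^esub> y)) a w = g (F k x) a w \<otimes>\<^bsub>fobj D a\<^esub> g (F k y) a w"
        if "x \<in> carrier X" "y \<in> carrier X" for x y
        using cont_homD(2)[OF gF that] a w by (simp add: lim_monoid_simps(2))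
      show "g (F k \<one>\<^bsub>X\<^esub>) a w = \<one>\<^bsub>fobj D a\<^esub>"
        using cont_homD(3)[OF gF] a w by (simp add: lim_monoid_simps(3))
      fix P q assume "test u P" "continuous_map P (mtop X) q"
      then show "continuous_map P (mtop (fobj D a)) (\<lambda>x. g (F k (q x)) a w)"
        using cts[of P "\<lambda>_. k" a "\<lambda>_. w" q] k a w by simp
    qed
    have gnat: "natural_family A W underlying_diagram (g (F k x))" if "k \<in> topspace K" "x \<in> carrier X" for k x
      using lim_monoid_natural gL hom_car funcset_mem[OF F] that by blast
    show ?thesis
      unfolding probe[OF K]
    proof (intro conjI ballI)
      fix k assume k: "k \<in> topspace K"
      note nat_k = gnat[OF k, unfolded natural_family_underlying]
      have "compose (carrier X) (fmap D a b f) (?\<phi> (F k) a w) = ?\<phi> (F k) b (fmap W a b f w)"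
        if "a \<in> Obj A" "b \<in> Obj A" "f \<in> Mor A a b" "w \<in> pt a" for a b f w
        using that nat_k W_map[OF that] by (auto simp: compose_def intro!: restrict_ext)
      moreover have "?\<phi> (F k) a (bpt (fobj W a)) = (\<lambda>x\<in>carrier X. \<one>\<^bsub>fobj D a\<^esub>)" if "a \<in> Obj A" for a
        using that nat_k bpt_W[OF that] by (auto intro!: restrict_ext)
      ultimately show "natural_family A W (hom_to R X D) (?\<phi> (F k))"
        unfolding nat using hom k by auto
    next
      fix a assume a: "a \<in> Obj A"
      show "joint_probes u K (btop (fobj W a)) (btop (hom_space u X (fobj D a))) (\<lambda>k. ?\<phi> (F k) a)"
      proof (rule joint_probesI)
        fix P p h assume P: "test u P" and p: "continuous_map P K p"
          and h: "continuous_map P (btop (fobj W a)) h"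
        have h': "h l \<in> pt a" "p l \<in> topspace K" if "l \<in> topspace P" for l
          using funcset_mem[OF continuous_map_funspace[OF h] that] funcset_mem[OF continuous_map_funspace[OF p] that]
          by auto
        show "continuous_map P (btop (hom_space u X (fobj D a))) (\<lambda>l. ?\<phi> (F (p l)) a (h l))"
          unfolding probe_hom_space[OF X'(2) P]
        proof (intro conjI joint_probesI)
          show "(\<lambda>l. ?\<phi> (F (p l)) a (h l)) \<in> topspace P \<rightarrow> ext_cont_hom X (fobj D a)"
            using hom a h' by auto
          fix Q q x assume Q: "test u Q" and q: "continuous_map Q P q" and x: "continuous_map Q (mtop X) x"
          have "continuous_map Q (mtop (fobj D a)) (\<lambda>l. g (F (p (q l)) (x l)) a (h (q l)))"
            by (rule cts[OF Q probe_compose[OF q p] a probe_compose[OF q h] x])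
          then show "continuous_map Q (mtop (fobj D a)) (\<lambda>l. ?\<phi> (F (p (q l))) a (h (q l)) (x l))"
            by (rule continuous_map_eq)
              (use a h'(1)[OF funcset_mem[OF continuous_map_funspace[OF q]]]
                funcset_mem[OF continuous_map_funspace[OF x]] X'(2) in simp)
        qed
      qed
    qed
  qed
  have \<psi>_probe: "continuous_map K (btop (hom_space u X L)) (\<lambda>k. ?\<psi> (\<theta> k))"
    and \<psi>_lim: "k \<in> topspace K \<Longrightarrow> x \<in> carrier X \<Longrightarrow> (\<lambda>a\<in>Obj A. \<lambda>w\<in>pt a. \<theta> k a w x) \<in> carrier lim_monoid"
    if K: "test u K" and \<theta>: "continuous_map K (btop ?N) \<theta>" for K \<theta> k x
  proof -
    have nat_\<theta>: "\<theta> k \<in> PiE (Obj A) (\<lambda>a. PiE (pt a) (\<lambda>_. ext_cont_hom X (fobj D a)))"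
        "a \<in> Obj A \<Longrightarrow> \<theta> k a (bpt (fobj W a)) = (\<lambda>x\<in>carrier X. \<one>\<^bsub>fobj D a\<^esub>)"
        "a \<in> Obj A \<Longrightarrow> b \<in> Obj A \<Longrightarrow> f \<in> Mor A a b \<Longrightarrow> w \<in> pt a \<Longrightarrow>
          compose (carrier X) (fmap D a b f) (\<theta> k a w) = \<theta> k b (fmap W a b f w)"
      if "k \<in> topspace K" for k a b f w
      using \<theta> that unfolding probe[OF K] nat by auto
    have \<theta>hom: "\<theta> k a w \<in> cont_hom X (fobj D a)" if "k \<in> topspace K" "a \<in> Obj A" "w \<in> pt a" for k a w
      using PiE_mem[OF PiE_mem[OF nat_\<theta>(1)[OF that(1)] that(2)] that(3)] by (simp add: ext_cont_hom_def)
    \<comment> \<open>Uncurrying twice: first along the weight into the hom space, then along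
      \<open>X\<close> into \<open>fobj D a\<close>.\<close>
    have cts: "continuous_map P (mtop (fobj D a)) (\<lambda>l. \<theta> (p l) a (h l) (x l))"
      if P: "test u P" and "continuous_map P K p" "a \<in> Obj A" "continuous_map P (btop (fobj W a)) h"
        and x: "continuous_map P (mtop X) x" for P p a h x
    proof -
      have "continuous_map P (btop (hom_space u X (fobj D a))) (\<lambda>l. \<theta> (p l) a (h l))"
        using \<theta> that joint_probesD unfolding probe[OF K] by blast
      then show ?thesis
        using joint_probesD[of u P "mtop X" "mtop (fobj D a)" "\<lambda>l. \<theta> (p l) a (h l)" P "\<lambda>l. l" x] P x
        unfolding probe_hom_space[OF X'(2) P] by simp
    qed
    \<comment> \<open>The parameter space maps to both \<open>K\<close> and \<open>X\<close>, so
      that continuity of a single \<open>?\<psi> (\<theta> k)\<close> and its continuous dependence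
      on \<open>k\<close> come from the same statement.\<close>
    have lim_probe: "continuous_map P (mtop lim_monoid) (\<lambda>l. \<lambda>a\<in>Obj A. \<lambda>w\<in>pt a. \<theta> (p l) a w (x l))"
      if P: "test u P" and p: "continuous_map P K p" and x: "continuous_map P (mtop X) x" for P p x
    proof (rule probe_lim_monoidI[OF P])
      fix l a assume l: "l \<in> topspace P" and a: "a \<in> Obj A"
      have pl: "p l \<in> topspace K" and xl: "x l \<in> carrier X"
        using funcset_mem[OF continuous_map_funspace[OF p] l] funcset_mem[OF continuous_map_funspace[OF x] l] X'(2)
        by auto
      show "\<theta> (p l) a w (x l) \<in> carrier (fobj D a)" if "w \<in> pt a" for w
        by (rule cont_homD(1)[OF \<theta>hom[OF pl a that] xl])
      show "\<theta> (p l) a (bpt (fobj W a)) (x l) = \<one>\<^bsub>fobj D a\<^esub>"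
        using nat_\<theta>(2)[OF pl a] xl by simp
      fix b f w assume "b \<in> Obj A" "f \<in> Mor A a b" "w \<in> pt a"
      then show "fmap D a b f (\<theta> (p l) a w (x l)) = \<theta> (p l) b (fmap W a b f w) (x l)"
        using fun_cong[OF nat_\<theta>(3)[OF pl a], of b f w "x l"] xl by (simp add: compose_def)
    next
      fix a Q q h assume "a \<in> Obj A" "test u Q" "continuous_map Q P q" "continuous_map Q (btop (fobj W a)) h"
      then show "continuous_map Q (mtop (fobj D a)) (\<lambda>l. \<theta> (p (q l)) a (h l) (x (q l)))"
        using cts probe_compose[OF _ p] probe_compose[OF _ x] by blast
    qed
    show lim: "(\<lambda>a\<in>Obj A. \<lambda>w\<in>pt a. \<theta> k a w x) \<in> carrier lim_monoid"
      if "k \<in> topspace K" "x \<in> carrier X" for k x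
      using lim_probe[of "discrete_topology {undefined}" "\<lambda>_. k" "\<lambda>_. x", OF test_sing] that X'(2) by (simp add: lim_monoid_simps(1))
    have e_cts: "continuous_map P (mtop L) (\<lambda>l. e (\<lambda>a\<in>Obj A. \<lambda>w\<in>pt a. \<theta> (p l) a w (x l)))"
      if P: "test u P" and p: "continuous_map P K p" and x: "continuous_map P (mtop X) x" for P p x
      by (rule probe_cont_hom[OF e lim_probe[OF that]])
    have hom: "?\<psi> (\<theta> k) \<in> ext_cont_hom X L" if k: "k \<in> topspace K" for k
    proof (rule ext_cont_homI[OF X cont_hom_compose[OF _ e]], rule cont_homI[OF X'(3,2) lim'(2)])
      show "(\<lambda>a\<in>Obj A. \<lambda>w\<in>pt a. \<theta> k a w x) \<in> carrier lim_monoid" if "x \<in> carrier X" for x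
        by (rule lim[OF k that])
      show "(\<lambda>a\<in>Obj A. \<lambda>w\<in>pt a. \<theta> k a w (x \<otimes>\<^bsub>X\<^esub> y)) =
          (\<lambda>a\<in>Obj A. \<lambda>w\<in>pt a. \<theta> k a w x) \<otimes>\<^bsub>lim_monoid\<^esub> (\<lambda>a\<in>Obj A. \<lambda>w\<in>pt a. \<theta> k a w y)"
        if "x \<in> carrier X" "y \<in> carrier X" for x y
        using cont_homD(2)[OF \<theta>hom[OF k] that] by (auto simp: lim_monoid_simps(2) intro!: restrict_ext)
      show "(\<lambda>a\<in>Obj A. \<lambda>w\<in>pt a. \<theta> k a w \<one>\<^bsub>X\<^esub>) = \<one>\<^bsub>lim_monoid\<^esub>"
        using cont_homD(3)[OF \<theta>hom[OF k]] by (auto simp: lim_monoid_simps(3) intro!: restrict_ext)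
      fix P q assume "test u P" "continuous_map P (mtop X) q"
      then show "continuous_map P (mtop lim_monoid) (\<lambda>x. \<lambda>a\<in>Obj A. \<lambda>w\<in>pt a. \<theta> k a w (q x))"
        using lim_probe[of P "\<lambda>_. k" q] k by simp
    qed
    show "continuous_map K (btop (hom_space u X L)) (\<lambda>k. ?\<psi> (\<theta> k))"
      unfolding probe_hom_space[OF X'(2) K]
    proof (intro conjI joint_probesI)
      show "(\<lambda>k. ?\<psi> (\<theta> k)) \<in> topspace K \<rightarrow> ext_cont_hom X L"
        using hom by blast
      fix P p x assume P: "test u P" "continuous_map P K p" and x: "continuous_map P (mtop X) x"
      show "continuous_map P (mtop L) (\<lambda>l. ?\<psi> (\<theta> (p l)) (x l))"
        by (rule continuous_map_eq[OF e_cts[OF P x]])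
          (use funcset_mem[OF continuous_map_funspace[OF x]] X'(2) in simp)
    qed
  qed
  have "homeomorphic_map (btop (hom_space u X L)) (btop ?N) ?\<phi>"
  proof (rule probes_homeomorphic_map[OF kspace_hom_space kspace_nat_trans_space \<phi>_probe \<psi>_probe])
    fix f assume "f \<in> topspace (btop (hom_space u X L))"
    then have f: "f \<in> ext_cont_hom X L"
      using X'(2) by simp
    have "(\<lambda>a\<in>Obj A. \<lambda>w\<in>pt a. ?\<phi> f a w x) = g (f x)" if "x \<in> carrier X" for x
    proof -
      have "g (f x) \<in> PiE (Obj A) (\<lambda>a. PiE (pt a) (\<lambda>_. carrier (fobj D a)))"
        by (rule lim_monoid_PiE[OF gL[OF hom_car[OF f that]]])
      then have "(\<lambda>a\<in>Obj A. \<lambda>w\<in>pt a. g (f x) a w) = g (f x)"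
        by (auto simp: PiE_iff extensional_def fun_eq_iff)
      moreover have "(\<lambda>a\<in>Obj A. \<lambda>w\<in>pt a. ?\<phi> f a w x) = (\<lambda>a\<in>Obj A. \<lambda>w\<in>pt a. g (f x) a w)"
        using that by (intro restrict_ext) simp
      ultimately show ?thesis
        by simp
    qed
    then have "?\<psi> (?\<phi> f) = (\<lambda>x\<in>carrier X. f x)"
      using eg hom_car f by (intro restrict_ext) simp
    then show "?\<psi> (?\<phi> f) = f"
      using f by (simp add: ext_cont_hom_def extensional_restrict)
  next
    fix \<theta> assume \<theta>: "\<theta> \<in> topspace (btop ?N)"
    have "continuous_map (discrete_topology {undefined}) (btop ?N) (\<lambda>_. \<theta>)"
      using \<theta> by simp
    then have "(\<lambda>a\<in>Obj A. \<lambda>w\<in>pt a. \<theta> a w x) \<in> carrier lim_monoid" if "x \<in> carrier X" for x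
      using \<psi>_lim[OF test_sing _ _ that, of undefined "\<lambda>_. \<theta>" undefined] by simp
    then have "?\<phi> (?\<psi> \<theta>) = (\<lambda>a\<in>Obj A. \<lambda>w\<in>pt a. \<lambda>x\<in>carrier X. \<theta> a w x)"
      by (intro restrict_ext) (simp add: ge)
    also have "\<dots> = \<theta>"
    proof -
      have "\<theta> \<in> PiE (Obj A) (\<lambda>a. PiE (pt a) (\<lambda>_. ext_cont_hom X (fobj D a)))"
        using \<theta> probe[OF test_sing, of undefined "\<lambda>_. \<theta>"] nat[of \<theta>] by simp
      then have *: "\<theta> \<in> extensional (Obj A)" "a \<in> Obj A \<Longrightarrow> \<theta> a \<in> extensional (pt a)"
        "a \<in> Obj A \<Longrightarrow> w \<in> pt a \<Longrightarrow> \<theta> a w \<in> extensional (carrier X)" for a w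
        by (auto simp: PiE_iff ext_cont_hom_def)
      have "(\<lambda>a\<in>Obj A. \<lambda>w\<in>pt a. \<lambda>x\<in>carrier X. \<theta> a w x) = (\<lambda>a\<in>Obj A. \<lambda>w\<in>pt a. \<theta> a w)"
        using *(3) by (intro restrict_ext) (simp add: extensional_restrict)
      also have "\<dots> = (\<lambda>a\<in>Obj A. \<theta> a)"
        using *(2) by (intro restrict_ext) (simp add: extensional_restrict)
      finally show ?thesis
        using *(1) by (simp add: extensional_restrict)
    qed
    finally show "?\<phi> (?\<psi> \<theta>) = \<theta>" .
  qed
  moreover have "?\<phi> (bpt (hom_space u X L)) = bpt ?N"
    unfolding bpt_nat_trans_space bpt_hom_space hom_to_def Hom
    using cont_homD(3)[OF g] by (auto simp: bpt_hom_space lim_monoid_simps(3) intro!: restrict_ext)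
  ultimately show "based_iso (Hom R X L) ?N ?\<phi>"
    unfolding based_iso_def Hom by blast
next
  fix X Y h f assume "X \<in> Obj R" "Y \<in> Obj R" and h: "h \<in> Mor R Y X" and f: "f \<in> Mor R X L"
  then have "topological_monoid u X" "topological_monoid u Y"
    using Obj by auto
  then have "h x \<in> carrier X" if "x \<in> carrier Y" for x
    using h that by (auto simp: Hom topological_monoidD(2) ext_cont_hom_def cont_homD)
  then show "(\<lambda>a\<in>Obj A. \<lambda>w\<in>pt a. \<lambda>x\<in>carrier Y. g (Cmp R Y X L f h x) a w) =
      (\<lambda>a\<in>Obj A. \<lambda>w\<in>pt a. Cmp R Y X (fobj D a)
        ((\<lambda>a\<in>Obj A. \<lambda>w\<in>pt a. \<lambda>x\<in>carrier X. g (f x) a w) a w) h)"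
    unfolding Cmp by (intro restrict_ext) (auto simp: compose_def intro!: restrict_ext)
qed

end

section \<open>Groups of units, and cotensors with test spaces\<close>

section \<open>Units and cotensors\<close>

context universe
begin

text \<open>The subspace topology of \<open>N\<close> need not make inversion continuous. The
  embedding of a unit as the pair of itself and its inverse does, since inversion then exchanges the
  coordinates.\<close>

definition units_monoid :: "'b top_monoid \<Rightarrow> 'b top_monoid" where
  "units_monoid N =
     \<lparr>carrier = Units N, mult = mult N, one = \<one>\<^bsub>N\<^esub>,
      mtop = kify u (pullback_topology (Units N) (\<lambda>x. (x, inv\<^bsub>N\<^esub> x)) (prod_topology (mtop N) (mtop N)))\<rparr>"

lemma units_monoid_simps [simp]:
  "carrier (units_monoid N) = Units N" "x \<otimes>\<^bsub>units_monoid N\<^esub> y = x \<otimes>\<^bsub>N\<^esub> y" "\<one>\<^bsub>units_monoid N\<^esub> = \<one>\<^bsub>N\<^esub>"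
  by (simp_all add: units_monoid_def)

lemma kspace_units_monoid: "kspace u (mtop (units_monoid N))"
  by (simp add: units_monoid_def)

lemma topspace_units_monoid:
  assumes "topological_monoid u N"
  shows "topspace (mtop (units_monoid N)) = Units N"
  using monoid.Units_closed[OF topological_monoidD(1)[OF assms]]
    monoid.Units_inv_closed[OF topological_monoidD(1)[OF assms]] topological_monoidD(2)[OF assms]
  by (auto simp: units_monoid_def topspace_pullback_topology)

lemma probe_units_monoid:
  assumes N: "topological_monoid u N" and K: "test u K"
  shows "continuous_map K (mtop (units_monoid N)) q \<longleftrightarrow>
    q \<in> topspace K \<rightarrow> Units N \<and> continuous_map K (mtop N) q \<and>
    continuous_map K (mtop N) (\<lambda>k. inv\<^bsub>N\<^esub> q k)"
proof -
  let ?P = "prod_topology (mtop N) (mtop N)" and ?f = "\<lambda>x. (x, inv\<^bsub>N\<^esub> x)"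
  have top: "topspace (pullback_topology (Units N) ?f ?P) = Units N"
    using topspace_units_monoid[OF N] by (simp add: units_monoid_def)
  have "continuous_map K (pullback_topology (Units N) ?f ?P) q \<longleftrightarrow>
      q \<in> topspace K \<rightarrow> Units N \<and> continuous_map K ?P (\<lambda>k. ?f (q k))"
  proof (intro iffI conjI)
    assume q: "continuous_map K (pullback_topology (Units N) ?f ?P) q"
    show "q \<in> topspace K \<rightarrow> Units N"
      using continuous_map_funspace[OF q] unfolding top .
    have "continuous_map (pullback_topology (Units N) ?f ?P) ?P ?f"
      using continuous_map_pullback[OF continuous_map_id[of ?P], of "Units N" ?f] by (simp add: o_def)
    then show "continuous_map K ?P (\<lambda>k. ?f (q k))"
      by (rule probe_compose[OF q])
  next
    assume "q \<in> topspace K \<rightarrow> Units N \<and> continuous_map K ?P (\<lambda>k. ?f (q k))"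
    then show "continuous_map K (pullback_topology (Units N) ?f ?P) q"
      by (intro continuous_map_pullback') (auto simp: o_def)
  qed
  then show ?thesis
    by (simp add: units_monoid_def probe_kify[OF K] continuous_map_pairwise o_def)
qed

lemma topological_group_units_monoid:
  assumes N: "topological_monoid u N"
  shows "topological_group u (units_monoid N)"
proof -
  note N' = topological_monoidD[OF N]
  interpret N: monoid N by (rule N')
  have mon: "monoid (units_monoid N)"
    by (rule monoidI) (auto simp: N.m_assoc N.Units_closed)
  have Units: "Units (units_monoid N) = Units N"
  proof
    show "Units N \<subseteq> Units (units_monoid N)"
    proof
      fix x assume "x \<in> Units N"
      then show "x \<in> Units (units_monoid N)"
        unfolding Units_def[of "units_monoid N"] using N.Units_l_inv N.Units_r_inv N.Units_inv_Units
        by (auto intro!: bexI[of _ "inv\<^bsub>N\<^esub> x"])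
    qed
  qed (auto simp: Units_def[of "units_monoid N"])
  have inv: "inv\<^bsub>units_monoid N\<^esub> x = inv\<^bsub>N\<^esub> x" if "x \<in> Units N" for x
    using monoid.inv_unique'[OF mon, of x "inv\<^bsub>N\<^esub> x"] that by simp
  have M: "topological_monoid u (units_monoid N)"
  proof (rule topological_monoidI[OF mon _ kspace_units_monoid])
    show "topspace (mtop (units_monoid N)) = carrier (units_monoid N)"
      using topspace_units_monoid[OF N] by simp
    show "small u (carrier (units_monoid N))"
      using small_subset[OF N'(4)] N.Units_closed by auto
    fix K p q assume K: "test u K"
      and "continuous_map K (mtop (units_monoid N)) p" "continuous_map K (mtop (units_monoid N)) q"
    then have p: "p \<in> topspace K \<rightarrow> Units N" "continuous_map K (mtop N) p" "continuous_map K (mtop N) (\<lambda>k. inv\<^bsub>N\<^esub> p k)"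
      and q: "q \<in> topspace K \<rightarrow> Units N" "continuous_map K (mtop N) q" "continuous_map K (mtop N) (\<lambda>k. inv\<^bsub>N\<^esub> q k)"
      by (simp_all add: probe_units_monoid[OF N])
    have inv_mult: "inv\<^bsub>N\<^esub> (p x \<otimes>\<^bsub>N\<^esub> q x) = inv\<^bsub>N\<^esub> q x \<otimes>\<^bsub>N\<^esub> inv\<^bsub>N\<^esub> p x" if "x \<in> topspace K" for x
    proof -
      interpret U: group "units_monoid N"
        using mon Units by (simp add: group_def group_axioms_def)
      show ?thesis
        using U.inv_mult_group[of "p x" "q x"] funcset_mem[OF p(1) that] funcset_mem[OF q(1) that] by (simp add: inv)
    qed
    have "continuous_map K (mtop N) (\<lambda>x. inv\<^bsub>N\<^esub> (p x \<otimes>\<^bsub>N\<^esub> q x))"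
      by (rule continuous_map_eq[OF probe_mult[OF N K q(3) p(3)]]) (simp add: inv_mult)
    then show "continuous_map K (mtop (units_monoid N)) (\<lambda>x. p x \<otimes>\<^bsub>units_monoid N\<^esub> q x)"
      using p(1) q(1) probe_mult[OF N K p(2) q(2)] by (auto simp: probe_units_monoid[OF N K] Pi_iff)
  qed
  show ?thesis
  proof (rule topological_groupI[OF M])
    fix K p assume K: "test u K" and p: "continuous_map K (mtop (units_monoid N)) p"
    then have p': "p \<in> topspace K \<rightarrow> Units N" "continuous_map K (mtop N) p" "continuous_map K (mtop N) (\<lambda>k. inv\<^bsub>N\<^esub> p k)"
      by (simp_all add: probe_units_monoid[OF N])
    have inv_inv: "inv\<^bsub>N\<^esub> (inv\<^bsub>N\<^esub> x) = x" if "x \<in> Units N" for x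
      using that N.inv_unique'[of "inv\<^bsub>N\<^esub> x" x] N.Units_closed by simp
    have "continuous_map K (mtop N) (\<lambda>k. inv\<^bsub>N\<^esub> (inv\<^bsub>N\<^esub> p k))"
      by (rule continuous_map_eq[OF p'(2)]) (simp add: inv_inv[OF funcset_mem[OF p'(1)]])
    then have "continuous_map K (mtop (units_monoid N)) (\<lambda>k. inv\<^bsub>N\<^esub> p k)"
      using p' by (auto simp: probe_units_monoid[OF N K] Pi_iff)
    then show "continuous_map K (mtop (units_monoid N)) (\<lambda>k. inv\<^bsub>units_monoid N\<^esub> p k)"
      by (rule continuous_map_eq) (simp add: inv[OF funcset_mem[OF p'(1)]])
  qed (simp add: Units)
qed

text \<open>For a group the condition on inverses in \<open>probe_units_monoid\<close> is automatic,
  so the two k-topologies have the same probes.\<close>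

lemma units_monoid_group:
  assumes G: "topological_group u (G :: 'b top_monoid)"
  shows "units_monoid G = G"
proof -
  have Units: "Units G = carrier G"
    using group.Units_eq[OF topological_groupD(2)[OF G]] .
  note G' = topological_groupD(1)[OF G]
  have "mtop (units_monoid G) = mtop G"
  proof (rule kspace_eqI[OF kspace_units_monoid topological_monoidD(3)[OF G']])
    show "topspace (mtop (units_monoid G)) = topspace (mtop G)"
      using topspace_units_monoid[OF G'] topological_monoidD(2)[OF G'] Units by simp
    show "continuous_map K (mtop (units_monoid G)) q = continuous_map K (mtop G) q" if "test u K" for K q
      using topological_groupD(3)[OF G, of K q] continuous_map_funspace[of K "mtop G" q] topological_monoidD(2)[OF G']
      unfolding probe_units_monoid[OF G' that] Units by metis
  qed
  then show ?thesis
    using Units by (simp add: units_monoid_def)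
qed

lemma units_monoid_incl: "topological_monoid u N \<Longrightarrow> (\<lambda>x. x) \<in> cont_hom (units_monoid N) N"
  using topspace_units_monoid[of N] topological_monoidD[of u N] monoid.Units_closed[of N]
  by (intro cont_homI[OF kspace_units_monoid]) (auto simp: probe_units_monoid)

text \<open>The adjunction between the forgetful functor and the passage to units, on sets of
  homomorphisms. The inverse of \<open>f x\<close> is \<open>f\<close> at the inverse of
  \<open>x\<close>, hence continuous in \<open>x\<close>, which is what the finer topology of the
  units asks for.\<close>

lemma cont_hom_units_monoid:
  assumes G: "topological_group u G" and N: "topological_monoid u N"
  shows "f \<in> cont_hom G (units_monoid N) \<longleftrightarrow> f \<in> cont_hom G N"
proof
  assume "f \<in> cont_hom G (units_monoid N)"
  then show "f \<in> cont_hom G N"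
    using cont_hom_compose[OF _ units_monoid_incl[OF N]] by blast
next
  note G' = topological_groupD(1)[OF G]
  note Units = group.Units_eq[OF topological_groupD(2)[OF G]]
  assume f: "f \<in> cont_hom G N"
  have inv: "f x \<in> Units N" "inv\<^bsub>N\<^esub> f x = f (inv\<^bsub>G\<^esub> x)" if "x \<in> carrier G" for x
    using cont_hom_Units[OF f topological_monoidD(1)[OF G'] topological_monoidD(1)[OF N]] that Units by auto
  show "f \<in> cont_hom G (units_monoid N)"
  proof (rule cont_homI[OF topological_monoidD(3,2)[OF G']])
    show "topspace (mtop (units_monoid N)) = carrier (units_monoid N)"
      using topspace_units_monoid[OF N] by simp
    fix K q assume K: "test u K" and q: "continuous_map K (mtop G) q"
    have q': "q x \<in> carrier G" if "x \<in> topspace K" for x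
      using funcset_mem[OF continuous_map_funspace[OF q] that] topological_monoidD(2)[OF G'] by simp
    have "continuous_map K (mtop N) (\<lambda>x. inv\<^bsub>N\<^esub> f (q x))"
      by (rule continuous_map_eq[OF probe_cont_hom[OF f topological_groupD(3)[OF G q]]]) (simp add: inv q')
    then show "continuous_map K (mtop (units_monoid N)) (\<lambda>x. f (q x))"
      using probe_cont_hom[OF f q] inv q' by (simp add: probe_units_monoid[OF N K])
  qed (use inv cont_homD[OF f] in auto)
qed

text \<open>The same adjunction enriched, and as an equality of based spaces: the argument for a
  single homomorphism works for families, because the inverse of \<open>F (p l) (h l)\<close> is
  \<open>F (p l)\<close> at the inverse of \<open>h l\<close>.\<close>

lemma hom_space_units_monoid:
  assumes G: "topological_group u G" and N: "topological_monoid u N"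
  shows "hom_space u G (units_monoid N) = hom_space u G N"
proof -
  note G' = topological_groupD(1)[OF G]
  note topG = topological_monoidD(2)[OF G']
  have ext: "ext_cont_hom G (units_monoid N) = ext_cont_hom G N"
    unfolding ext_cont_hom_def using cont_hom_units_monoid[OF G N] by blast
  have "btop (hom_space u G (units_monoid N)) = btop (hom_space u G N)"
  proof (rule kspace_eqI[of u])
    fix K F assume K: "test u K"
    have "joint_probes u K (mtop G) (mtop (units_monoid N)) F \<longleftrightarrow> joint_probes u K (mtop G) (mtop N) F"
      if F: "F \<in> topspace K \<rightarrow> ext_cont_hom G N"
    proof
      assume "joint_probes u K (mtop G) (mtop (units_monoid N)) F"
      then show "joint_probes u K (mtop G) (mtop N) F"
        unfolding joint_probes_def using probe_units_monoid[OF N] by blast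
    next
      assume joint: "joint_probes u K (mtop G) (mtop N) F"
      show "joint_probes u K (mtop G) (mtop (units_monoid N)) F"
      proof (rule joint_probesI)
        fix L p h assume L: "test u L" and p: "continuous_map L K p" and h: "continuous_map L (mtop G) h"
        have hl: "h l \<in> Units G" and Fl: "F (p l) \<in> cont_hom G N" if "l \<in> topspace L" for l
          using funcset_mem[OF continuous_map_funspace[OF h] that] topG
            group.Units_eq[OF topological_groupD(2)[OF G]]
            funcset_mem[OF F funcset_mem[OF continuous_map_funspace[OF p] that]]
          by (auto simp: ext_cont_hom_def)
        note U = cont_hom_Units[OF Fl topological_monoidD(1)[OF G'] topological_monoidD(1)[OF N] hl]
        have "continuous_map L (mtop N) (\<lambda>l. F (p l) (inv\<^bsub>G\<^esub> h l))"
          by (rule joint_probesD[OF joint L p topological_groupD(3)[OF G h]])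
        then have "continuous_map L (mtop N) (\<lambda>l. inv\<^bsub>N\<^esub> F (p l) (h l))"
          by (rule continuous_map_eq) (simp add: U)
        then show "continuous_map L (mtop (units_monoid N)) (\<lambda>l. F (p l) (h l))"
          using joint_probesD[OF joint L p h] U by (simp add: probe_units_monoid[OF N L])
      qed
    qed
    then show "continuous_map K (btop (hom_space u G (units_monoid N))) F =
        continuous_map K (btop (hom_space u G N)) F"
      unfolding probe_hom_space[OF topG K] ext by blast
  qed (simp_all add: topG ext)
  moreover have "bpt (hom_space u G (units_monoid N)) = bpt (hom_space u G N)"
    by (simp add: bpt_hom_space)
  ultimately show ?thesis
    by simp
qed

text \<open>
  The unbased mapping space is an instance of \<open>map_space\<close>: an extensional function takes the value
  \<open>undefined\<close> at a base point chosen outside the domain.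
\<close>

definition unbased_map_space :: "'u topology \<Rightarrow> 'b topology \<Rightarrow> ('u \<Rightarrow> 'b) topology" where
  "unbased_map_space K Y =
     btop (map_space u \<lparr>btop = K, bpt = SOME z. z \<notin> topspace K\<rparr> \<lparr>btop = Y, bpt = undefined\<rparr>)"

text \<open>For a test space \<open>K\<close> this is the cotensor of \<open>N\<close> with
  \<open>K\<close> plus a disjoint base point: based maps out of the latter are unbased maps out of
  \<open>K\<close>, and a homomorphism into it is a \<open>K\<close>-parametrised family of
  homomorphisms to \<open>N\<close>.\<close>

definition cotensor :: "'u topology \<Rightarrow> 'b top_monoid \<Rightarrow> ('u \<Rightarrow> 'b) top_monoid" where
  "cotensor K N =
     \<lparr>carrier = {f \<in> extensional (topspace K). continuous_map K (mtop N) f},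
      mult = (\<lambda>f g. \<lambda>k\<in>topspace K. f k \<otimes>\<^bsub>N\<^esub> g k), one = (\<lambda>k\<in>topspace K. \<one>\<^bsub>N\<^esub>),
      mtop = unbased_map_space K (mtop N)\<rparr>"

lemma cotensor_simps:
  "carrier (cotensor K N) = {f \<in> extensional (topspace K). continuous_map K (mtop N) f}"
  "f \<otimes>\<^bsub>cotensor K N\<^esub> g = (\<lambda>k\<in>topspace K. f k \<otimes>\<^bsub>N\<^esub> g k)" "\<one>\<^bsub>cotensor K N\<^esub> = (\<lambda>k\<in>topspace K. \<one>\<^bsub>N\<^esub>)"
  by (simp_all add: cotensor_def)

lemma based_maps_unbased:
  assumes "test u K"
  shows "based_maps \<lparr>btop = K, bpt = SOME z. z \<notin> topspace K\<rparr> \<lparr>btop = Y, bpt = undefined\<rparr> =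
    {f \<in> extensional (topspace K). continuous_map K Y f}"
proof -
  \<comment> \<open>A test space is small and \<open>'u\<close> is not, so a point is left over to
    serve as base point.\<close>
  have "\<exists>z. z \<notin> topspace K"
    using assms not_small_UNIV small_subset unfolding test_def by (metis UNIV_eq_I)
  then have "(SOME z. z \<notin> topspace K) \<notin> topspace K"
    by (rule someI_ex)
  then show ?thesis
    by (auto simp: based_maps_def based_map_def extensional_def)
qed

lemma probe_cotensor:
  assumes K: "test u K" and L: "test u L"
  shows "continuous_map L (mtop (cotensor K N)) F \<longleftrightarrow>
    F \<in> topspace L \<rightarrow> carrier (cotensor K N) \<and> joint_probes u L K (mtop N) F"
  unfolding cotensor_def unbased_map_space_def
  by (simp add: probe_map_space[OF L] based_maps_unbased[OF K])

lemma topological_monoid_cotensor: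
  assumes K: "test u K" and N: "topological_monoid u N"
  shows "topological_monoid u (cotensor K N)"
proof (rule topological_monoidI)
  note N' = topological_monoidD[OF N]
  interpret N: monoid N by (rule N')
  have app: "f k \<in> carrier N" if "f \<in> carrier (cotensor K N)" "k \<in> topspace K" for f k
    using that N'(2) continuous_map_funspace[of K "mtop N" f] by (auto simp: cotensor_simps)
  have mult: "f \<otimes>\<^bsub>cotensor K N\<^esub> g \<in> carrier (cotensor K N)"
    if "f \<in> carrier (cotensor K N)" "g \<in> carrier (cotensor K N)" for f g
  proof -
    have "continuous_map K (mtop N) (\<lambda>k. f k \<otimes>\<^bsub>N\<^esub> g k)"
      using that by (intro probe_mult[OF N K]) (auto simp: cotensor_simps)
    then have "continuous_map K (mtop N) (\<lambda>k\<in>topspace K. f k \<otimes>\<^bsub>N\<^esub> g k)"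
      by (rule continuous_map_eq) simp
    then show ?thesis
      by (simp add: cotensor_simps)
  qed
  have one: "\<one>\<^bsub>cotensor K N\<^esub> \<in> carrier (cotensor K N)"
    using N'(2) by (auto simp: cotensor_simps intro: continuous_map_eq[of K "mtop N" "\<lambda>_. \<one>\<^bsub>N\<^esub>"])
  show "monoid (cotensor K N)"
  proof (rule monoidI[OF mult one])
    fix x y z
    assume x: "x \<in> carrier (cotensor K N)"
    note [simp] = app[OF x]
    have ext: "x = (\<lambda>k\<in>topspace K. x k)"
      using x by (simp add: cotensor_simps extensional_restrict)
    have "(\<lambda>k\<in>topspace K. (\<lambda>k\<in>topspace K. \<one>\<^bsub>N\<^esub>) k \<otimes>\<^bsub>N\<^esub> x k) = (\<lambda>k\<in>topspace K. x k)"
      "(\<lambda>k\<in>topspace K. x k \<otimes>\<^bsub>N\<^esub> (\<lambda>k\<in>topspace K. \<one>\<^bsub>N\<^esub>) k) = (\<lambda>k\<in>topspace K. x k)"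
      by (intro restrict_ext; simp)+
    then show "\<one>\<^bsub>cotensor K N\<^esub> \<otimes>\<^bsub>cotensor K N\<^esub> x = x" "x \<otimes>\<^bsub>cotensor K N\<^esub> \<one>\<^bsub>cotensor K N\<^esub> = x"
      using ext by (simp_all add: cotensor_simps)
    assume y: "y \<in> carrier (cotensor K N)" and z: "z \<in> carrier (cotensor K N)"
    show "x \<otimes>\<^bsub>cotensor K N\<^esub> y \<otimes>\<^bsub>cotensor K N\<^esub> z = x \<otimes>\<^bsub>cotensor K N\<^esub> (y \<otimes>\<^bsub>cotensor K N\<^esub> z)"
      using app[OF y] app[OF z] by (auto simp: cotensor_simps N.m_assoc intro!: restrict_ext)
  qed
  show top: "topspace (mtop (cotensor K N)) = carrier (cotensor K N)"
    by (simp add: cotensor_def unbased_map_space_def based_maps_unbased[OF K])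
  show "kspace u (mtop (cotensor K N))"
    by (simp add: cotensor_def unbased_map_space_def)
  have "carrier (cotensor K N) \<subseteq> PiE (topspace K) (\<lambda>_. carrier N)"
  proof
    fix f assume f: "f \<in> carrier (cotensor K N)"
    show "f \<in> PiE (topspace K) (\<lambda>_. carrier N)"
      using app[OF f] f unfolding PiE_iff cotensor_simps by blast
  qed
  then show "small u (carrier (cotensor K N))"
    using K N'(4) by (intro small_subset[OF small_PiE]) (auto simp: test_def)
  fix L F G assume L: "test u L"
    and "continuous_map L (mtop (cotensor K N)) F" "continuous_map L (mtop (cotensor K N)) G"
  then have F: "F \<in> topspace L \<rightarrow> carrier (cotensor K N)" "joint_probes u L K (mtop N) F"
    and G: "G \<in> topspace L \<rightarrow> carrier (cotensor K N)" "joint_probes u L K (mtop N) G"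
    by (simp_all add: probe_cotensor[OF K])
  have "joint_probes u L K (mtop N) (\<lambda>l. F l \<otimes>\<^bsub>cotensor K N\<^esub> G l)"
  proof (rule joint_probesI)
    fix P p h assume P: "test u P" "continuous_map P L p" and h: "continuous_map P K h"
    have "continuous_map P (mtop N) (\<lambda>l. F (p l) (h l) \<otimes>\<^bsub>N\<^esub> G (p l) (h l))"
      by (rule probe_mult[OF N P(1) joint_probesD[OF F(2) P h] joint_probesD[OF G(2) P h]])
    then show "continuous_map P (mtop N) (\<lambda>l. (F (p l) \<otimes>\<^bsub>cotensor K N\<^esub> G (p l)) (h l))"
      by (rule continuous_map_eq)
        (use funcset_mem[OF continuous_map_funspace[OF h]] in \<open>simp add: cotensor_simps\<close>)
  qed
  then show "continuous_map L (mtop (cotensor K N)) (\<lambda>l. F l \<otimes>\<^bsub>cotensor K N\<^esub> G l)"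
    using mult F(1) G(1) unfolding probe_cotensor[OF K L] by (simp add: Pi_iff)
qed

lemma cotensor_eval:
  assumes K: "test u K" and N: "topological_monoid u N" and k: "k \<in> topspace K"
  shows "(\<lambda>f. f k) \<in> cont_hom (cotensor K N) N"
proof (rule cont_homI)
  note C = topological_monoidD[OF topological_monoid_cotensor[OF K N]]
  show "kspace u (mtop (cotensor K N))" "topspace (mtop (cotensor K N)) = carrier (cotensor K N)"
    by (rule C(3), rule C(2))
  show "topspace (mtop N) = carrier N"
    by (rule topological_monoidD(2)[OF N])
  show "f k \<in> carrier N" if "f \<in> carrier (cotensor K N)" for f
    using that k continuous_map_funspace[of K "mtop N" f] topological_monoidD(2)[OF N]
    by (auto simp: cotensor_simps)
  fix L F assume "test u L" "continuous_map L (mtop (cotensor K N)) F"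
  then show "continuous_map L (mtop N) (\<lambda>l. F l k)"
    using k joint_probesD[of u L K "mtop N" F L "\<lambda>l. l" "\<lambda>_. k"] by (simp add: probe_cotensor[OF K])
qed (use k in \<open>simp_all add: cotensor_simps\<close>)

end

section \<open>Cocones and their ordinary universal property\<close>

section \<open>Colimits\<close>

lemma eop_simps [simp]: "Obj (eop A) = Obj A" "Hom (eop A) a b = Hom A b a"
  by (simp_all add: eop_def)

locale colimit_data = weighted u A W D
  for u :: "'u itself" and A :: "('i, 'j) ecat" and W :: "('i, 'j, 'a based, 'a \<Rightarrow> 'a) efun"
    and D :: "('i, 'j, 'u top_monoid, 'u \<Rightarrow> 'u) efun" +
  assumes W_map: "a \<in> Obj A \<Longrightarrow> b \<in> Obj A \<Longrightarrow> f \<in> Mor A b a \<Longrightarrow> w \<in> pt a \<Longrightarrow> fmap W a b f w \<in> pt b"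
begin

text \<open>
  A cocone into \<open>X\<close> is a natural transformation from \<open>W\<close> to \<open>hom(D -, X)\<close>, with \<open>X\<close> on an
  arbitrary type and with no convention on values outside the domain.
\<close>

definition cocone :: "'x top_monoid \<Rightarrow> ('i \<Rightarrow> 'a \<Rightarrow> 'u \<Rightarrow> 'x) \<Rightarrow> bool" where
  "cocone X \<theta> \<longleftrightarrow>
     (\<forall>a\<in>Obj A. \<forall>w\<in>pt a.
        (\<forall>d\<in>carrier (fobj D a). \<theta> a w d \<in> carrier X) \<and>
        (\<forall>d\<in>carrier (fobj D a). \<forall>d'\<in>carrier (fobj D a).
           \<theta> a w (d \<otimes>\<^bsub>fobj D a\<^esub> d') = \<theta> a w d \<otimes>\<^bsub>X\<^esub> \<theta> a w d') \<and>
        \<theta> a w \<one>\<^bsub>fobj D a\<^esub> = \<one>\<^bsub>X\<^esub>) \<and>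
     (\<forall>a\<in>Obj A. \<forall>d\<in>carrier (fobj D a). \<theta> a (bpt (fobj W a)) d = \<one>\<^bsub>X\<^esub>) \<and>
     (\<forall>a\<in>Obj A. \<forall>b\<in>Obj A. \<forall>f\<in>Mor A b a. \<forall>w\<in>pt a. \<forall>d\<in>carrier (fobj D b).
        \<theta> a w (fmap D b a f d) = \<theta> b (fmap W a b f w) d) \<and>
     (\<forall>a\<in>Obj A. \<forall>L h x. test u L \<longrightarrow> continuous_map L (btop (fobj W a)) h \<longrightarrow>
        continuous_map L (mtop (fobj D a)) x \<longrightarrow> continuous_map L (mtop X) (\<lambda>l. \<theta> a (h l) (x l)))"

lemma coconeD:
  assumes "cocone X \<theta>" "a \<in> Obj A"
  shows "w \<in> pt a \<Longrightarrow> d \<in> carrier (fobj D a) \<Longrightarrow> \<theta> a w d \<in> carrier X"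
    and "w \<in> pt a \<Longrightarrow> d \<in> carrier (fobj D a) \<Longrightarrow> d' \<in> carrier (fobj D a) \<Longrightarrow>
      \<theta> a w (d \<otimes>\<^bsub>fobj D a\<^esub> d') = \<theta> a w d \<otimes>\<^bsub>X\<^esub> \<theta> a w d'"
    and "w \<in> pt a \<Longrightarrow> \<theta> a w \<one>\<^bsub>fobj D a\<^esub> = \<one>\<^bsub>X\<^esub>"
    and "d \<in> carrier (fobj D a) \<Longrightarrow> \<theta> a (bpt (fobj W a)) d = \<one>\<^bsub>X\<^esub>"
    and "b \<in> Obj A \<Longrightarrow> f \<in> Mor A b a \<Longrightarrow> w \<in> pt a \<Longrightarrow> d \<in> carrier (fobj D b) \<Longrightarrow>
      \<theta> a w (fmap D b a f d) = \<theta> b (fmap W a b f w) d"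
    and "test u L \<Longrightarrow> continuous_map L (btop (fobj W a)) h \<Longrightarrow>
      continuous_map L (mtop (fobj D a)) x \<Longrightarrow> continuous_map L (mtop X) (\<lambda>l. \<theta> a (h l) (x l))"
proof -
  note c = assms(1)[unfolded cocone_def]
  note c1 = c[THEN conjunct1, rule_format, OF assms(2)]
  note c2 = c[THEN conjunct2, THEN conjunct1, rule_format, OF assms(2)]
  note c3 = c[THEN conjunct2, THEN conjunct2, THEN conjunct1, rule_format, OF assms(2)]
  note c4 = c[THEN conjunct2, THEN conjunct2, THEN conjunct2, rule_format, OF assms(2)]
  show "w \<in> pt a \<Longrightarrow> d \<in> carrier (fobj D a) \<Longrightarrow> \<theta> a w d \<in> carrier X"
    "w \<in> pt a \<Longrightarrow> d \<in> carrier (fobj D a) \<Longrightarrow> d' \<in> carrier (fobj D a) \<Longrightarrow>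
      \<theta> a w (d \<otimes>\<^bsub>fobj D a\<^esub> d') = \<theta> a w d \<otimes>\<^bsub>X\<^esub> \<theta> a w d'"
    "w \<in> pt a \<Longrightarrow> \<theta> a w \<one>\<^bsub>fobj D a\<^esub> = \<one>\<^bsub>X\<^esub>"
    using c1 by simp_all
  show "d \<in> carrier (fobj D a) \<Longrightarrow> \<theta> a (bpt (fobj W a)) d = \<one>\<^bsub>X\<^esub>"
    by (rule c2)
  show "b \<in> Obj A \<Longrightarrow> f \<in> Mor A b a \<Longrightarrow> w \<in> pt a \<Longrightarrow> d \<in> carrier (fobj D b) \<Longrightarrow>
      \<theta> a w (fmap D b a f d) = \<theta> b (fmap W a b f w) d"
    by (rule c3)
  show "test u L \<Longrightarrow> continuous_map L (btop (fobj W a)) h \<Longrightarrow>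
      continuous_map L (mtop (fobj D a)) x \<Longrightarrow> continuous_map L (mtop X) (\<lambda>l. \<theta> a (h l) (x l))"
    by (rule c4)
qed

lemma coconeI:
  assumes "\<And>a w d. a \<in> Obj A \<Longrightarrow> w \<in> pt a \<Longrightarrow> d \<in> carrier (fobj D a) \<Longrightarrow> \<theta> a w d \<in> carrier X"
    and "\<And>a w d d'. a \<in> Obj A \<Longrightarrow> w \<in> pt a \<Longrightarrow> d \<in> carrier (fobj D a) \<Longrightarrow> d' \<in> carrier (fobj D a) \<Longrightarrow>
      \<theta> a w (d \<otimes>\<^bsub>fobj D a\<^esub> d') = \<theta> a w d \<otimes>\<^bsub>X\<^esub> \<theta> a w d'"
    and "\<And>a w. a \<in> Obj A \<Longrightarrow> w \<in> pt a \<Longrightarrow> \<theta> a w \<one>\<^bsub>fobj D a\<^esub> = \<one>\<^bsub>X\<^esub>"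
    and "\<And>a d. a \<in> Obj A \<Longrightarrow> d \<in> carrier (fobj D a) \<Longrightarrow> \<theta> a (bpt (fobj W a)) d = \<one>\<^bsub>X\<^esub>"
    and "\<And>a b f w d. a \<in> Obj A \<Longrightarrow> b \<in> Obj A \<Longrightarrow> f \<in> Mor A b a \<Longrightarrow> w \<in> pt a \<Longrightarrow> d \<in> carrier (fobj D b) \<Longrightarrow>
      \<theta> a w (fmap D b a f d) = \<theta> b (fmap W a b f w) d"
    and "\<And>a L h x. a \<in> Obj A \<Longrightarrow> test u L \<Longrightarrow> continuous_map L (btop (fobj W a)) h \<Longrightarrow>
      continuous_map L (mtop (fobj D a)) x \<Longrightarrow> continuous_map L (mtop X) (\<lambda>l. \<theta> a (h l) (x l))"
  shows "cocone X \<theta>"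
  using assms unfolding cocone_def by simp

lemma cocone_cont_hom:
  assumes "cocone X \<theta>" "topspace (mtop X) = carrier X" "a \<in> Obj A" "w \<in> pt a"
  shows "\<theta> a w \<in> cont_hom (fobj D a) X"
proof (rule cont_homI[OF kspace_D topspace_D])
  fix K q assume "test u K" "continuous_map K (mtop (fobj D a)) q"
  then show "continuous_map K (mtop X) (\<lambda>x. \<theta> a w (q x))"
    using coconeD(6)[OF assms(1,3), of K "\<lambda>_. w" q] assms(4) by simp
qed (use assms coconeD[OF assms(1)] in auto)

lemma cocone_compose:
  assumes \<theta>: "cocone X \<theta>" and j: "j \<in> cont_hom X Y"
  shows "cocone Y (\<lambda>a w d. j (\<theta> a w d))"
proof (rule coconeI)
  fix a L h x assume "a \<in> Obj A" "test u L" "continuous_map L (btop (fobj W a)) h"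
    "continuous_map L (mtop (fobj D a)) x"
  then show "continuous_map L (mtop Y) (\<lambda>l. j (\<theta> a (h l) (x l)))"
    by (rule probe_cont_hom[OF j coconeD(6)[OF \<theta>]])
qed (use coconeD[OF \<theta>] cont_homD[OF j] in simp_all)

text \<open>The test monoids \<open>X\<close> are those on \<open>'u\<close>, as in
  \<open>Tmon\<close>, whereas \<open>C\<close> may live on any type, because
  \<open>generated_monoid\<close> lives on a function type. Uniqueness is stated pointwise on the
  carrier since elements of \<open>cont_hom\<close> are not extensional.\<close>

definition universal_cocone :: "'x top_monoid \<Rightarrow> ('i \<Rightarrow> 'a \<Rightarrow> 'u \<Rightarrow> 'x) \<Rightarrow> bool" where
  "universal_cocone C \<eta> \<longleftrightarrow> topological_monoid u C \<and> cocone C \<eta> \<and>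
     (\<forall>(X :: 'u top_monoid) f g.
        topological_monoid u X \<longrightarrow> f \<in> cont_hom C X \<longrightarrow> g \<in> cont_hom C X \<longrightarrow>
        (\<forall>a\<in>Obj A. \<forall>w\<in>pt a. \<forall>d\<in>carrier (fobj D a). f (\<eta> a w d) = g (\<eta> a w d)) \<longrightarrow>
        (\<forall>x\<in>carrier C. f x = g x)) \<and>
     (\<forall>(X :: 'u top_monoid) \<theta>. topological_monoid u X \<longrightarrow> cocone X \<theta> \<longrightarrow>
        (\<exists>f\<in>cont_hom C X. \<forall>a\<in>Obj A. \<forall>w\<in>pt a. \<forall>d\<in>carrier (fobj D a). f (\<eta> a w d) = \<theta> a w d))"

lemma universal_coconeD:
  assumes "universal_cocone C \<eta>"
  shows "topological_monoid u C" "cocone C \<eta>"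
  using assms unfolding universal_cocone_def by simp_all

lemma universal_cocone_unique:
  fixes X :: "'u top_monoid"
  assumes "universal_cocone C \<eta>" "topological_monoid u X" "f \<in> cont_hom C X" "g \<in> cont_hom C X"
    and "\<And>a w d. a \<in> Obj A \<Longrightarrow> w \<in> pt a \<Longrightarrow> d \<in> carrier (fobj D a) \<Longrightarrow> f (\<eta> a w d) = g (\<eta> a w d)"
    and "x \<in> carrier C"
  shows "f x = g x"
  using assms(1)[unfolded universal_cocone_def, THEN conjunct2, THEN conjunct2, THEN conjunct1,
      THEN spec, THEN spec, THEN spec, THEN mp, OF assms(2), THEN mp, OF assms(3), THEN mp, OF assms(4)]
    assms(5,6) by simp

lemma universal_cocone_factor:
  fixes X :: "'u top_monoid"
  assumes "universal_cocone C \<eta>" "topological_monoid u X" "cocone X \<theta>"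
  obtains f where "f \<in> cont_hom C X"
    and "\<forall>a\<in>Obj A. \<forall>w\<in>pt a. \<forall>d\<in>carrier (fobj D a). f (\<eta> a w d) = \<theta> a w d"
proof -
  note assms(1)[unfolded universal_cocone_def, THEN conjunct2, THEN conjunct2, THEN conjunct2]
  from this[THEN spec, THEN spec, THEN mp, OF assms(2), THEN mp, OF assms(3)]
  show thesis
    by (rule bexE) (rule that)
qed

lemma universal_cocone_copy:
  fixes C :: "'x top_monoid"
  assumes C: "universal_cocone C \<eta>"
  obtains C' :: "'u top_monoid" and \<eta>' where "universal_cocone C' \<eta>'"
proof -
  obtain C' :: "'u top_monoid" and e g where C': "topological_monoid u C'"
    and e: "e \<in> cont_hom C C'" and g: "g \<in> cont_hom C' C"
    and ge: "\<And>x. x \<in> carrier C \<Longrightarrow> g (e x) = x" and eg: "\<And>y. y \<in> carrier C' \<Longrightarrow> e (g y) = y"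
    by (rule small_copy[OF universal_coconeD(1)[OF C]]) (rule that)
  note \<eta> = universal_coconeD(2)[OF C]
  let ?\<eta> = "\<lambda>a w d. e (\<eta> a w d)"
  have "universal_cocone C' ?\<eta>"
    unfolding universal_cocone_def
  proof (intro conjI allI impI ballI)
    show "cocone C' ?\<eta>"
      by (rule cocone_compose[OF \<eta> e])
    fix X :: "'u top_monoid" assume X: "topological_monoid u X"
    show "f x = f' x" if f: "f \<in> cont_hom C' X" and f': "f' \<in> cont_hom C' X"
      and eq: "\<forall>a\<in>Obj A. \<forall>w\<in>pt a. \<forall>d\<in>carrier (fobj D a). f (?\<eta> a w d) = f' (?\<eta> a w d)"
      and x: "x \<in> carrier C'" for f f' x
      using universal_cocone_unique[OF C X cont_hom_compose[OF e f] cont_hom_compose[OF e f'] _ cont_homD(1)[OF g x]]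
        eq eg[OF x] by simp
    fix \<theta> assume "cocone X \<theta>"
    then obtain f where f: "f \<in> cont_hom C X"
      "\<forall>a\<in>Obj A. \<forall>w\<in>pt a. \<forall>d\<in>carrier (fobj D a). f (\<eta> a w d) = \<theta> a w d"
      by (rule universal_cocone_factor[OF C X])
    show "\<exists>f\<in>cont_hom C' X. \<forall>a\<in>Obj A. \<forall>w\<in>pt a. \<forall>d\<in>carrier (fobj D a). f (?\<eta> a w d) = \<theta> a w d"
    proof (intro bexI[of _ "\<lambda>x. f (g x)"] ballI)
      show "f (g (?\<eta> a w d)) = \<theta> a w d" if "a \<in> Obj A" "w \<in> pt a" "d \<in> carrier (fobj D a)" for a w d
        using f(2) that ge coconeD(1)[OF \<eta> that] by simp
    qed (rule cont_hom_compose[OF g f(1)])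
  qed (rule C')
  then show thesis
    by (rule that)
qed

text \<open>The cocone lifts to the units of \<open>C\<close>, which gives a homomorphism
  \<open>f\<close> from \<open>C\<close> to its units. Followed by the inclusion, \<open>f\<close>
  agrees with the identity on the cocone, hence everywhere: each element of \<open>C\<close> is a
  unit, and continuity of \<open>f\<close> into the finer topology is continuity of
  inversion.\<close>

lemma topological_group_universal_cocone:
  fixes C :: "'u top_monoid"
  assumes C: "universal_cocone C \<eta>" and grp: "\<And>a. a \<in> Obj A \<Longrightarrow> topological_group u (fobj D a)"
  shows "topological_group u C"
proof -
  note C' = universal_coconeD[OF C]
  note U = topological_group_units_monoid[OF C'(1)]
  have hom: "\<eta> a w \<in> cont_hom (fobj D a) (units_monoid C)" if "a \<in> Obj A" "w \<in> pt a" for a w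
    using cocone_cont_hom[OF C'(2) topological_monoidD(2)[OF C'(1)] that]
      cont_hom_units_monoid[OF grp[OF that(1)] C'(1)] by blast
  have "cocone (units_monoid C) \<eta>"
  proof (rule coconeI)
    fix a L h x assume a: "a \<in> Obj A" and L: "test u L" and h: "continuous_map L (btop (fobj W a)) h"
      and x: "continuous_map L (mtop (fobj D a)) x"
    have hl: "h l \<in> pt a" and xl: "x l \<in> carrier (fobj D a)" if "l \<in> topspace L" for l
      using funcset_mem[OF continuous_map_funspace[OF h] that] funcset_mem[OF continuous_map_funspace[OF x] that]
        topspace_D[OF a] by auto
    have "x l \<in> Units (fobj D a)" if "l \<in> topspace L" for l
      using xl[OF that] group.Units_eq[OF topological_groupD(2)[OF grp[OF a]]] by simp
    \<comment> \<open>The inverse of a value of a leg is the same leg at the inverse element, and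
      this depends continuously on both variables.\<close>
    then have inv: "inv\<^bsub>C\<^esub> \<eta> a (h l) (x l) = \<eta> a (h l) (inv\<^bsub>fobj D a\<^esub> x l)" if "l \<in> topspace L" for l
      using cont_hom_Units(2)[OF cocone_cont_hom[OF C'(2) topological_monoidD(2)[OF C'(1)] a hl[OF that]]
        monoid_D[OF a] topological_monoidD(1)[OF C'(1)]] that by blast
    have "continuous_map L (mtop C) (\<lambda>l. inv\<^bsub>C\<^esub> \<eta> a (h l) (x l))"
      by (rule continuous_map_eq[OF coconeD(6)[OF C'(2) a L h topological_groupD(3)[OF grp[OF a] x]]]) (simp add: inv)
    then show "continuous_map L (mtop (units_monoid C)) (\<lambda>l. \<eta> a (h l) (x l))"
      using coconeD(6)[OF C'(2) a L h x] cont_homD(1)[OF hom[OF a hl] xl]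
      by (simp add: probe_units_monoid[OF C'(1) L])
  next
    show "\<eta> a w d \<in> carrier (units_monoid C)" if "a \<in> Obj A" "w \<in> pt a" "d \<in> carrier (fobj D a)" for a w d
      by (rule cont_homD(1)[OF hom[OF that(1,2)] that(3)])
  qed (use coconeD[OF C'(2)] in \<open>simp_all\<close>)
  then obtain f where f: "f \<in> cont_hom C (units_monoid C)"
    "\<forall>a\<in>Obj A. \<forall>w\<in>pt a. \<forall>d\<in>carrier (fobj D a). f (\<eta> a w d) = \<eta> a w d"
    by (rule universal_cocone_factor[OF C topological_groupD(1)[OF U]])
  have id_hom: "(\<lambda>x. x) \<in> cont_hom C C"
    by (simp add: cont_hom_def hom_def)
  have fx: "f x = x" if "x \<in> carrier C" for x
    using universal_cocone_unique[OF C C'(1) cont_hom_compose[OF f(1) units_monoid_incl[OF C'(1)]] id_hom _ that]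
      f(2) by simp
  show ?thesis
  proof (rule topological_groupI[OF C'(1)])
    show "carrier C \<subseteq> Units C"
      using cont_homD(1)[OF f(1)] fx by fastforce
    fix K p assume K: "test u K" and p: "continuous_map K (mtop C) p"
    have "continuous_map K (mtop C) (\<lambda>x. inv\<^bsub>C\<^esub> f (p x))"
      using probe_cont_hom[OF f(1) p] by (simp add: probe_units_monoid[OF C'(1) K])
    then show "continuous_map K (mtop C) (\<lambda>x. inv\<^bsub>C\<^esub> p x)"
      by (rule continuous_map_eq)
        (use fx funcset_mem[OF continuous_map_funspace[OF p]] topological_monoidD(2)[OF C'(1)] in simp)
  qed
qed

section \<open>Existence of a universal cocone\<close>

subsection \<open>The submonoid generated by a cocone in a product\<close>

text \<open>All cocones on \<open>'u\<close>, not a set of representatives: this index set is not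
  small, since already the one-element monoids give as many members as \<open>'u\<close> has
  elements. Smallness is restored by passing to the submonoid generated by the legs.\<close>

definition "cocones = {(N :: 'u top_monoid, \<theta>). topological_monoid u N \<and> cocone N \<theta>}"

definition "gens = {(a, w, d). a \<in> Obj A \<and> w \<in> pt a \<and> d \<in> carrier (fobj D a)}"

text \<open>A word in the generators is evaluated in every cocone at once. Two words become equal
  exactly when all cocones identify them, so the relations of the colimit need not be
  described.\<close>

definition "word ws = (\<lambda>i\<in>cocones. foldr (\<lambda>(a, w, d) r. snd i a w d \<otimes>\<^bsub>fst i\<^esub> r) ws \<one>\<^bsub>fst i\<^esub>)"

definition "generated_monoid =
  \<lparr>carrier = word ` lists gens, mult = (\<lambda>x y. \<lambda>i\<in>cocones. x i \<otimes>\<^bsub>fst i\<^esub> y i), one = word [],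
   mtop = kify u (subtopology (product_topology (\<lambda>i. mtop (fst i)) cocones) (word ` lists gens))\<rparr>"

lemma generated_monoid_simps:
  "carrier generated_monoid = word ` lists gens"
  "x \<otimes>\<^bsub>generated_monoid\<^esub> y = (\<lambda>i\<in>cocones. x i \<otimes>\<^bsub>fst i\<^esub> y i)" "\<one>\<^bsub>generated_monoid\<^esub> = word []"
  "mtop generated_monoid =
    kify u (subtopology (product_topology (\<lambda>i. mtop (fst i)) cocones) (word ` lists gens))"
  by (simp_all add: generated_monoid_def)

lemma cocones_monoid: "i \<in> cocones \<Longrightarrow> topological_monoid u (fst i)"
  and cocones_cocone: "i \<in> cocones \<Longrightarrow> cocone (fst i) (snd i)"
  by (simp_all add: cocones_def split_def)

lemma word_closed:
  assumes i: "i \<in> cocones" and ws: "ws \<in> lists gens"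
  shows "word ws i \<in> carrier (fst i)"
proof -
  note mon = topological_monoidD(1)[OF cocones_monoid[OF i]]
  have "foldr (\<lambda>(a, w, d) r. snd i a w d \<otimes>\<^bsub>fst i\<^esub> r) ws \<one>\<^bsub>fst i\<^esub> \<in> carrier (fst i)"
    using ws
  proof (induction ws rule: list.induct)
    case (Cons t ws)
    obtain a w d where t: "t = (a, w, d)"
      using prod_cases3 by blast
    have "snd i a w d \<in> carrier (fst i)"
      using Cons.prems coconeD(1)[OF cocones_cocone[OF i]] by (simp add: gens_def t)
    then show ?case
      using Cons monoid.m_closed[OF mon] by (simp add: t)
  qed (simp add: monoid.one_closed[OF mon])
  then show ?thesis
    using i by (simp add: word_def)
qed

text \<open>Makes the values of words closed under multiplication, and later lets uniqueness be
  proved by induction on the word.\<close>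

lemma word_append:
  assumes "ws \<in> lists gens" "vs \<in> lists gens"
  shows "word (ws @ vs) = word ws \<otimes>\<^bsub>generated_monoid\<^esub> word vs"
proof -
  have "word (ws @ vs) i = word ws i \<otimes>\<^bsub>fst i\<^esub> word vs i" if i: "i \<in> cocones" for i
  proof -
    note mon = topological_monoidD(1)[OF cocones_monoid[OF i]]
    have closed: "foldr (\<lambda>(a, w, d) r. snd i a w d \<otimes>\<^bsub>fst i\<^esub> r) us \<one>\<^bsub>fst i\<^esub> \<in> carrier (fst i)"
      if "us \<in> lists gens" for us
      using word_closed[OF i that] i by (simp add: word_def)
    show ?thesis
      using assms(1)
    proof (induction ws rule: list.induct)
      case Nil
      then show ?case
        using closed[OF assms(2)] i monoid.l_one[OF mon] by (simp add: word_def)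
    next
      case (Cons t ws)
      obtain a w d where t: "t = (a, w, d)"
        using prod_cases3 by blast
      have "snd i a w d \<in> carrier (fst i)"
        using Cons.prems coconeD(1)[OF cocones_cocone[OF i]] by (simp add: gens_def t)
      then show ?case
        using Cons closed[OF assms(2)] closed[of ws] i by (simp add: word_def t monoid.m_assoc[OF mon])
    qed
  qed
  then show ?thesis
    unfolding generated_monoid_simps(2) by (auto simp: word_def fun_eq_iff)
qed

lemma generated_monoid_apply:
  "x \<in> carrier generated_monoid \<Longrightarrow> i \<in> cocones \<Longrightarrow> x i \<in> carrier (fst i)"
  unfolding generated_monoid_simps(1) using word_closed by blast

lemma generated_monoid_ext:
  assumes "x \<in> carrier generated_monoid" "y \<in> carrier generated_monoid" "\<And>i. i \<in> cocones \<Longrightarrow> x i = y i"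
  shows "x = y"
  using assms by (auto simp: generated_monoid_simps word_def fun_eq_iff restrict_def)

lemma topspace_generated_monoid: "topspace (mtop generated_monoid) = carrier generated_monoid"
proof -
  have "word ws \<in> PiE cocones (\<lambda>i. topspace (mtop (fst i)))" if "ws \<in> lists gens" for ws
  proof -
    have "word ws \<in> extensional cocones"
      by (simp add: word_def)
    then show ?thesis
      unfolding PiE_iff using word_closed[OF _ that] topological_monoidD(2)[OF cocones_monoid] by simp
  qed
  then have "word ` lists gens \<subseteq> PiE cocones (\<lambda>i. topspace (mtop (fst i)))"
    by blast
  then show ?thesis
    by (auto simp: generated_monoid_simps)
qed

text \<open>The initial k-topology, seen on probes. It reduces continuity of the multiplication and
  of the legs to each coordinate, where both are given.\<close>

lemma probe_generated_monoid:
  assumes K: "test u K"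
  shows "continuous_map K (mtop generated_monoid) q \<longleftrightarrow>
    q \<in> topspace K \<rightarrow> carrier generated_monoid \<and> (\<forall>i\<in>cocones. continuous_map K (mtop (fst i)) (\<lambda>k. q k i))"
proof -
  have "q ` topspace K \<subseteq> extensional cocones" if "q \<in> topspace K \<rightarrow> word ` lists gens"
  proof -
    have "word ` lists gens \<subseteq> extensional cocones"
      by (auto simp: word_def)
    then show ?thesis
      using that by blast
  qed
  then show ?thesis
    unfolding generated_monoid_simps probe_kify[OF K] continuous_map_in_subtopology
      continuous_map_componentwise by blast
qed

lemma topological_monoid_generated: "topological_monoid u generated_monoid"
proof (rule topological_monoidI)
  have mult: "x \<otimes>\<^bsub>generated_monoid\<^esub> y \<in> carrier generated_monoid"
    if "x \<in> carrier generated_monoid" "y \<in> carrier generated_monoid" for x y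
  proof -
    obtain ws vs where ws: "ws \<in> lists gens" "x = word ws" and vs: "vs \<in> lists gens" "y = word vs"
      using \<open>x \<in> _\<close> \<open>y \<in> _\<close> unfolding generated_monoid_simps(1) by blast
    then have "ws @ vs \<in> lists gens"
      by simp
    then show ?thesis
      unfolding ws(2) vs(2) word_append[OF ws(1) vs(1), symmetric] generated_monoid_simps(1) by (rule imageI)
  qed
  have one: "\<one>\<^bsub>generated_monoid\<^esub> \<in> carrier generated_monoid"
    by (auto simp: generated_monoid_simps)
  have one_app: "\<one>\<^bsub>generated_monoid\<^esub> i = \<one>\<^bsub>fst i\<^esub>" if "i \<in> cocones" for i
    using that by (simp add: generated_monoid_simps word_def)
  note mon = topological_monoidD(1)[OF cocones_monoid]
  show "monoid generated_monoid"
  proof (rule monoidI[OF mult one])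
    fix x y z assume x: "x \<in> carrier generated_monoid"
    show "\<one>\<^bsub>generated_monoid\<^esub> \<otimes>\<^bsub>generated_monoid\<^esub> x = x"
      by (rule generated_monoid_ext[OF mult[OF one x] x])
        (use generated_monoid_apply[OF x] monoid.l_one[OF mon] one_app in \<open>simp add: generated_monoid_simps(2)\<close>)
    show "x \<otimes>\<^bsub>generated_monoid\<^esub> \<one>\<^bsub>generated_monoid\<^esub> = x"
      by (rule generated_monoid_ext[OF mult[OF x one] x])
        (use generated_monoid_apply[OF x] monoid.r_one[OF mon] one_app in \<open>simp add: generated_monoid_simps(2)\<close>)
    assume y: "y \<in> carrier generated_monoid" and z: "z \<in> carrier generated_monoid"
    show "x \<otimes>\<^bsub>generated_monoid\<^esub> y \<otimes>\<^bsub>generated_monoid\<^esub> z = x \<otimes>\<^bsub>generated_monoid\<^esub> (y \<otimes>\<^bsub>generated_monoid\<^esub> z)"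
      using generated_monoid_apply[OF x] generated_monoid_apply[OF y] generated_monoid_apply[OF z]
        monoid.m_assoc[OF mon] by (auto simp: generated_monoid_simps(2) intro!: restrict_ext)
  qed
  \<comment> \<open>The bound comes from the words over a small alphabet, independently of the size
    of the index set of the product.\<close>
  have "small u gens"
  proof -
    have "gens = Sigma (Obj A) (\<lambda>a. pt a \<times> carrier (fobj D a))"
      by (auto simp: gens_def)
    then show ?thesis
      by (simp add: small_Sigma small_Obj small_W small_D)
  qed
  then show "small u (carrier generated_monoid)"
    unfolding generated_monoid_simps by (intro small_image small_lists)
  show "kspace u (mtop generated_monoid)"
    by (simp add: generated_monoid_simps)
  fix K p q assume K: "test u K" and "continuous_map K (mtop generated_monoid) p"
    "continuous_map K (mtop generated_monoid) q"
  then show "continuous_map K (mtop generated_monoid) (\<lambda>x. p x \<otimes>\<^bsub>generated_monoid\<^esub> q x)"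
    using mult probe_mult[OF cocones_monoid K] unfolding probe_generated_monoid[OF K]
    by (auto simp: generated_monoid_simps(2) Pi_iff)
qed (rule topspace_generated_monoid)

text \<open>The cocone equations hold because they hold in every coordinate. A cocone
  \<open>\<theta>\<close> into \<open>X\<close> is itself an index, and projecting to the coordinate
  \<open>(X, \<theta>)\<close> is the factorisation; two homomorphisms that agree on one-letter
  words agree on all words.\<close>

lemma universal_cocone_generated: "universal_cocone generated_monoid (\<lambda>a w d. word [(a, w, d)])"
proof -
  note G = topological_monoid_generated
  note G' = topological_monoidD[OF G]
  have app: "word [(a, w, d)] i = snd i a w d"
    if "i \<in> cocones" "a \<in> Obj A" "w \<in> pt a" "d \<in> carrier (fobj D a)" for i a w d
    using that coconeD(1)[OF cocones_cocone[OF that(1)]] monoid.r_one[OF topological_monoidD(1)[OF cocones_monoid[OF that(1)]]]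
    by (simp add: word_def)
  have car: "word [(a, w, d)] \<in> carrier generated_monoid"
    if "a \<in> Obj A" "w \<in> pt a" "d \<in> carrier (fobj D a)" for a w d
    using that by (auto simp: generated_monoid_simps gens_def)
  note mult_app = generated_monoid_simps(2)
  have one_app: "\<one>\<^bsub>generated_monoid\<^esub> i = \<one>\<^bsub>fst i\<^esub>" if "i \<in> cocones" for i
    using that by (simp add: generated_monoid_simps word_def)
  show ?thesis
    unfolding universal_cocone_def
  proof (intro conjI allI impI ballI G)
    show "cocone generated_monoid (\<lambda>a w d. word [(a, w, d)])"
    proof (rule coconeI)
      fix a w d assume a: "a \<in> Obj A" and w: "w \<in> pt a" and d: "d \<in> carrier (fobj D a)"
      show "word [(a, w, d)] \<in> carrier generated_monoid"
        by (rule car[OF a w d])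
      fix d' assume d': "d' \<in> carrier (fobj D a)"
      have dd': "d \<otimes>\<^bsub>fobj D a\<^esub> d' \<in> carrier (fobj D a)"
        using monoid.m_closed[OF monoid_D[OF a] d d'] .
      show "word [(a, w, d \<otimes>\<^bsub>fobj D a\<^esub> d')] = word [(a, w, d)] \<otimes>\<^bsub>generated_monoid\<^esub> word [(a, w, d')]"
        by (rule generated_monoid_ext[OF car[OF a w dd'] monoid.m_closed[OF G'(1) car[OF a w d] car[OF a w d']]])
          (simp add: mult_app app a w d d' dd' coconeD(2)[OF cocones_cocone a w d d'])
    next
      fix a w assume a: "a \<in> Obj A" and w: "w \<in> pt a"
      have 1: "\<one>\<^bsub>fobj D a\<^esub> \<in> carrier (fobj D a)"
        using monoid.one_closed[OF monoid_D[OF a]] .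
      show "word [(a, w, \<one>\<^bsub>fobj D a\<^esub>)] = \<one>\<^bsub>generated_monoid\<^esub>"
        by (rule generated_monoid_ext[OF car[OF a w 1] monoid.one_closed[OF G'(1)]])
          (simp add: one_app app a w 1 coconeD(3)[OF cocones_cocone a w])
    next
      fix a d assume a: "a \<in> Obj A" and d: "d \<in> carrier (fobj D a)"
      show "word [(a, bpt (fobj W a), d)] = \<one>\<^bsub>generated_monoid\<^esub>"
        by (rule generated_monoid_ext[OF car[OF a bpt_W[OF a] d] monoid.one_closed[OF G'(1)]])
          (simp add: one_app app a d bpt_W coconeD(4)[OF cocones_cocone a d])
    next
      fix a b f w d assume a: "a \<in> Obj A" and b: "b \<in> Obj A" and f: "f \<in> Mor A b a" and w: "w \<in> pt a"
        and d: "d \<in> carrier (fobj D b)"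
      have fd: "fmap D b a f d \<in> carrier (fobj D a)"
        by (rule cont_homD(1)[OF D_map[OF b a f] d])
      note fw = W_map[OF a b f w]
      show "word [(a, w, fmap D b a f d)] = word [(b, fmap W a b f w, d)]"
        by (rule generated_monoid_ext[OF car[OF a w fd] car[OF b fw d]])
          (simp add: app a b w d fd fw coconeD(5)[OF cocones_cocone a b f w d])
    next
      fix a L h x assume a: "a \<in> Obj A" and L: "test u L" and h: "continuous_map L (btop (fobj W a)) h"
        and x: "continuous_map L (mtop (fobj D a)) x"
      have hl: "h l \<in> pt a" and xl: "x l \<in> carrier (fobj D a)" if "l \<in> topspace L" for l
        using funcset_mem[OF continuous_map_funspace[OF h] that] funcset_mem[OF continuous_map_funspace[OF x] that]
          topspace_D[OF a] by auto
      have "continuous_map L (mtop (fst i)) (\<lambda>l. word [(a, h l, x l)] i)" if "i \<in> cocones" for i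
        by (rule continuous_map_eq[OF coconeD(6)[OF cocones_cocone[OF that] a L h x]])
          (simp add: app[OF that a hl xl])
      then show "continuous_map L (mtop generated_monoid) (\<lambda>l. word [(a, h l, x l)])"
        using car[OF a hl xl] by (simp add: probe_generated_monoid[OF L])
    qed
    fix X :: "'u top_monoid" assume X: "topological_monoid u X"
    show "f x = g x" if f: "f \<in> cont_hom generated_monoid X" and g: "g \<in> cont_hom generated_monoid X"
      and eq: "\<forall>a\<in>Obj A. \<forall>w\<in>pt a. \<forall>d\<in>carrier (fobj D a). f (word [(a, w, d)]) = g (word [(a, w, d)])"
      and x: "x \<in> carrier generated_monoid" for f g x
    proof -
      have "f (word ws) = g (word ws)" if "ws \<in> lists gens" for ws
        using that
      proof (induction ws rule: list.induct)
        case Nil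
        then show ?case
          using cont_homD(3)[OF f] cont_homD(3)[OF g] by (simp add: generated_monoid_simps(3))
      next
        case (Cons t ws)
        have "word (t # ws) = word [t] \<otimes>\<^bsub>generated_monoid\<^esub> word ws"
          using word_append[of "[t]" ws] Cons.prems by simp
        moreover have "word [t] \<in> carrier generated_monoid" "word ws \<in> carrier generated_monoid"
          using Cons.prems by (auto simp: generated_monoid_simps)
        moreover have "f (word [t]) = g (word [t])"
          using Cons.prems eq by (auto simp: gens_def)
        ultimately show ?case
          using cont_homD(2)[OF f] cont_homD(2)[OF g] Cons by simp
      qed
      then show ?thesis
        using x by (auto simp: generated_monoid_simps)
    qed
    fix \<theta> assume \<theta>: "cocone X \<theta>"
    have i: "(X, \<theta>) \<in> cocones"
      using X \<theta> by (simp add: cocones_def)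
    show "\<exists>f\<in>cont_hom generated_monoid X.
        \<forall>a\<in>Obj A. \<forall>w\<in>pt a. \<forall>d\<in>carrier (fobj D a). f (word [(a, w, d)]) = \<theta> a w d"
    proof (intro bexI[of _ "\<lambda>x. x (X, \<theta>)"] ballI)
      show "(\<lambda>x. x (X, \<theta>)) \<in> cont_hom generated_monoid X"
        by (rule cont_homI[OF G'(3,2) topological_monoidD(2)[OF X]])
          (use generated_monoid_apply[OF _ i] i one_app[OF i] in \<open>auto simp: mult_app probe_generated_monoid\<close>)
    qed (use app[OF i] in simp)
  qed
qed

section \<open>From the ordinary to the enriched universal property\<close>

text \<open>
  The ordinary universal property implies the enriched one: a family of cocones into \<open>X\<close>
  parametrised by \<open>K\<close> is a single cocone into the cotensor of \<open>X\<close> by \<open>K\<close>.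
\<close>

lemma is_indexed_colimit_universal_cocone:
  fixes C :: "'u top_monoid" and R :: "('u top_monoid, 'u \<Rightarrow> 'u) ecat"
  assumes C: "universal_cocone C \<eta>"
    and Hom: "Hom R = hom_space u" and Cmp: "Cmp R = (\<lambda>M N P g f. compose (carrier M) g f)"
    and Obj: "Obj R \<subseteq> Collect (topological_monoid u)" and CR: "C \<in> Obj R"
  shows "is_indexed_colimit u R A W D C (\<lambda>X f. \<lambda>a\<in>Obj A. \<lambda>w\<in>pt a. \<lambda>d\<in>carrier (fobj D a). f (\<eta> a w d))"
  unfolding is_indexed_colimit_def
proof (intro conjI ballI CR)
  fix X assume "X \<in> Obj R"
  then have X: "topological_monoid u X"
    using Obj by blast
  note X' = topological_monoidD[OF X]
  note \<eta> = universal_coconeD(2)[OF C] and C' = topological_monoidD[OF universal_coconeD(1)[OF C]]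
  let ?\<phi> = "\<lambda>f. \<lambda>a\<in>Obj A. \<lambda>w\<in>pt a. \<lambda>d\<in>carrier (fobj D a). f (\<eta> a w d)"
  let ?factors = "\<lambda>\<theta> f. f \<in> cont_hom C X \<and>
    (\<forall>a\<in>Obj A. \<forall>w\<in>pt a. \<forall>d\<in>carrier (fobj D a). f (\<eta> a w d) = \<theta> a w d)"
  \<comment> \<open>A factorisation is chosen for each transformation separately, with no continuity
    built into the choice; restriction to the carrier makes it a point of the hom space.\<close>
  let ?\<psi> = "\<lambda>\<theta>. restrict (SOME f. ?factors \<theta> f) (carrier C)"
  let ?N = "nat_trans_space u (eop A) W (hom_from R D X)"
  have nat: "natural_family (eop A) W (hom_from R D X) \<theta> \<longleftrightarrow>
      \<theta> \<in> PiE (Obj A) (\<lambda>a. PiE (pt a) (\<lambda>_. ext_cont_hom (fobj D a) X)) \<and>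
      (\<forall>a\<in>Obj A. \<theta> a (bpt (fobj W a)) = (\<lambda>x\<in>carrier (fobj D a). \<one>\<^bsub>X\<^esub>)) \<and>
      (\<forall>a\<in>Obj A. \<forall>b\<in>Obj A. \<forall>f\<in>Mor A b a. \<forall>w\<in>pt a.
        compose (carrier (fobj D b)) (\<theta> a w) (fmap D b a f) = \<theta> b (fmap W a b f w))" for \<theta>
  proof -
    have "PiE (Obj A) (\<lambda>a. PiE (pt a) (\<lambda>_. topspace (btop (hom_space u (fobj D a) X)))) =
        PiE (Obj A) (\<lambda>a. PiE (pt a) (\<lambda>_. ext_cont_hom (fobj D a) X))"
      by (intro PiE_cong) (simp add: topspace_D)
    then show ?thesis
      unfolding natural_family_def hom_from_def Hom Cmp by (auto simp: bpt_hom_space PiE_iff topspace_D)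
  qed
  have probe: "continuous_map K (btop ?N) \<theta> \<longleftrightarrow>
      (\<forall>k\<in>topspace K. natural_family (eop A) W (hom_from R D X) (\<theta> k)) \<and>
      (\<forall>a\<in>Obj A. joint_probes u K (btop (fobj W a)) (btop (hom_space u (fobj D a) X)) (\<lambda>k. \<theta> k a))"
    if "test u K" for K \<theta>
    using probe_nat_trans_space_iff[OF that, of "eop A" W "hom_from R D X"] kspace_W by (simp add: hom_from_def Hom)
  have \<phi>_probe: "continuous_map K (btop ?N) (\<lambda>k. ?\<phi> (F k))"
    if K: "test u K" and "continuous_map K (btop (hom_space u C X)) F" for K F
  proof -
    have F: "F \<in> topspace K \<rightarrow> ext_cont_hom C X" and joint: "joint_probes u K (mtop C) (mtop X) F"
      using that(2) unfolding probe_hom_space[OF C'(2) K] by auto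
    have Fk: "F k \<in> cont_hom C X" if "k \<in> topspace K" for k
      using funcset_mem[OF F that] by (simp add: ext_cont_hom_def)
    have hom: "(\<lambda>d\<in>carrier (fobj D a). F k (\<eta> a w d)) \<in> ext_cont_hom (fobj D a) X"
      if "k \<in> topspace K" "a \<in> Obj A" "w \<in> pt a" for k a w
      by (rule ext_cont_homI[OF D_obj[OF that(2)] cont_hom_compose[OF cocone_cont_hom[OF \<eta> C'(2) that(2,3)] Fk[OF that(1)]]])
    show ?thesis
      unfolding probe[OF K]
    proof (intro conjI ballI)
      fix k assume k: "k \<in> topspace K"
      have "compose (carrier (fobj D b)) (?\<phi> (F k) a w) (fmap D b a f) = ?\<phi> (F k) b (fmap W a b f w)"
        if "a \<in> Obj A" "b \<in> Obj A" "f \<in> Mor A b a" "w \<in> pt a" for a b f w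
        using that coconeD(5)[OF \<eta> that] W_map[OF that] cont_homD(1)[OF D_map[OF that(2,1,3)]]
        by (auto simp: compose_def intro!: restrict_ext)
      moreover have "?\<phi> (F k) a (bpt (fobj W a)) = (\<lambda>d\<in>carrier (fobj D a). \<one>\<^bsub>X\<^esub>)" if "a \<in> Obj A" for a
        using that coconeD(4)[OF \<eta> that] bpt_W[OF that] cont_homD(3)[OF Fk[OF k]] by (auto intro!: restrict_ext)
      ultimately show "natural_family (eop A) W (hom_from R D X) (?\<phi> (F k))"
        unfolding nat using hom[OF k] by auto
    next
      fix a assume a: "a \<in> Obj A"
      show "joint_probes u K (btop (fobj W a)) (btop (hom_space u (fobj D a) X)) (\<lambda>k. ?\<phi> (F k) a)"
      proof (rule joint_probesI)
        fix P p h assume P: "test u P" and p: "continuous_map P K p"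
          and h: "continuous_map P (btop (fobj W a)) h"
        have h': "h l \<in> pt a" "p l \<in> topspace K" if "l \<in> topspace P" for l
          using funcset_mem[OF continuous_map_funspace[OF h] that] funcset_mem[OF continuous_map_funspace[OF p] that]
          by auto
        show "continuous_map P (btop (hom_space u (fobj D a) X)) (\<lambda>l. ?\<phi> (F (p l)) a (h l))"
          unfolding probe_hom_space[OF topspace_D[OF a] P]
        proof (intro conjI joint_probesI)
          show "(\<lambda>l. ?\<phi> (F (p l)) a (h l)) \<in> topspace P \<rightarrow> ext_cont_hom (fobj D a) X"
            using hom a h' by auto
          fix Q q x assume Q: "test u Q" and q: "continuous_map Q P q" and x: "continuous_map Q (mtop (fobj D a)) x"
          have "continuous_map Q (mtop X) (\<lambda>l. F (p (q l)) (\<eta> a (h (q l)) (x l)))"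
            by (rule joint_probesD[OF joint Q probe_compose[OF q p] coconeD(6)[OF \<eta> a Q probe_compose[OF q h] x]])
          then show "continuous_map Q (mtop X) (\<lambda>l. ?\<phi> (F (p (q l))) a (h (q l)) (x l))"
            by (rule continuous_map_eq)
              (use a h'(1)[OF funcset_mem[OF continuous_map_funspace[OF q]]]
                funcset_mem[OF continuous_map_funspace[OF x]] topspace_D[OF a] in simp)
        qed
      qed
    qed
  qed
  have \<psi>_probe: "continuous_map K (btop (hom_space u C X)) (\<lambda>k. ?\<psi> (\<theta> k))"
    and factors: "k \<in> topspace K \<Longrightarrow> ?factors (\<theta> k) (SOME f. ?factors (\<theta> k) f)"
    if K: "test u K" and \<theta>: "continuous_map K (btop ?N) \<theta>" for K \<theta> k
  proof -
    have nat_\<theta>: "\<theta> k \<in> PiE (Obj A) (\<lambda>a. PiE (pt a) (\<lambda>_. ext_cont_hom (fobj D a) X))"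
        "a \<in> Obj A \<Longrightarrow> \<theta> k a (bpt (fobj W a)) = (\<lambda>x\<in>carrier (fobj D a). \<one>\<^bsub>X\<^esub>)"
        "a \<in> Obj A \<Longrightarrow> b \<in> Obj A \<Longrightarrow> f \<in> Mor A b a \<Longrightarrow> w \<in> pt a \<Longrightarrow>
          compose (carrier (fobj D b)) (\<theta> k a w) (fmap D b a f) = \<theta> k b (fmap W a b f w)"
      if "k \<in> topspace K" for k a b f w
      using \<theta> that unfolding probe[OF K] nat by auto
    have \<theta>hom: "\<theta> k a w \<in> cont_hom (fobj D a) X" if "k \<in> topspace K" "a \<in> Obj A" "w \<in> pt a" for k a w
      using PiE_mem[OF PiE_mem[OF nat_\<theta>(1)[OF that(1)] that(2)] that(3)] by (simp add: ext_cont_hom_def)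
    have cts: "continuous_map P (mtop X) (\<lambda>l. \<theta> (p l) a (h l) (x l))"
      if P: "test u P" and p: "continuous_map P K p" and a: "a \<in> Obj A"
        and h: "continuous_map P (btop (fobj W a)) h" and x: "continuous_map P (mtop (fobj D a)) x" for P p a h x
    proof -
      have "joint_probes u K (btop (fobj W a)) (btop (hom_space u (fobj D a) X)) (\<lambda>k. \<theta> k a)"
        using \<theta> a unfolding probe[OF K] by simp
      then have "continuous_map P (btop (hom_space u (fobj D a) X)) (\<lambda>l. \<theta> (p l) a (h l))"
        by (rule joint_probesD[OF _ P p h])
      then show ?thesis
        using joint_probesD[of u P "mtop (fobj D a)" "mtop X" "\<lambda>l. \<theta> (p l) a (h l)" P "\<lambda>l. l" x] P x
        unfolding probe_hom_space[OF topspace_D[OF a] P] by simp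
    qed
    let ?T = "cotensor K X"
    have T: "topological_monoid u ?T"
      by (rule topological_monoid_cotensor[OF K X])
    \<comment> \<open>For fixed \<open>a\<close>, \<open>w\<close> and \<open>d\<close>, the
      dependence on \<open>k\<close> becomes one point of the cotensor. By \<open>cts\<close>, this
      point depends continuously on \<open>w\<close> and \<open>d\<close>; the algebraic conditions
      hold for each \<open>k\<close>.\<close>
    have cocone_T: "cocone ?T (\<lambda>a w d. \<lambda>k\<in>topspace K. \<theta> k a w d)"
    proof (rule coconeI)
      fix a L h x assume a: "a \<in> Obj A" and L: "test u L" and h: "continuous_map L (btop (fobj W a)) h"
        and x: "continuous_map L (mtop (fobj D a)) x"
      have "continuous_map K (mtop X) (\<lambda>k. \<theta> k a (h l) (x l))" if "l \<in> topspace L" for l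
        using cts[OF K _ a, of "\<lambda>k. k" "\<lambda>_. h l" "\<lambda>_. x l"] funcset_mem[OF continuous_map_funspace[OF h] that]
          funcset_mem[OF continuous_map_funspace[OF x] that] by simp
      then have "continuous_map K (mtop X) (\<lambda>k\<in>topspace K. \<theta> k a (h l) (x l))" if "l \<in> topspace L" for l
        by (rule continuous_map_eq) (use that in simp_all)
      moreover have "joint_probes u L K (mtop X) (\<lambda>l. \<lambda>k\<in>topspace K. \<theta> k a (h l) (x l))"
      proof (rule joint_probesI)
        fix P p k assume P: "test u P" and p: "continuous_map P L p" and k: "continuous_map P K k"
        show "continuous_map P (mtop X) (\<lambda>l. (\<lambda>k\<in>topspace K. \<theta> k a (h (p l)) (x (p l))) (k l))"
          by (rule continuous_map_eq[OF cts[OF P k a probe_compose[OF p h] probe_compose[OF p x]]])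
            (simp add: funcset_mem[OF continuous_map_funspace[OF k]])
      qed
      ultimately show "continuous_map L (mtop ?T) (\<lambda>l. \<lambda>k\<in>topspace K. \<theta> k a (h l) (x l))"
        unfolding probe_cotensor[OF K L] by (simp add: cotensor_simps)
    next
      fix a w d assume a: "a \<in> Obj A" and w: "w \<in> pt a" and d: "d \<in> carrier (fobj D a)"
      have "continuous_map K (mtop X) (\<lambda>k. \<theta> k a w d)"
        using cts[OF K _ a, of "\<lambda>k. k" "\<lambda>_. w" "\<lambda>_. d"] w d topspace_D[OF a] by simp
      then have "continuous_map K (mtop X) (\<lambda>k\<in>topspace K. \<theta> k a w d)"
        by (rule continuous_map_eq) simp
      then show "(\<lambda>k\<in>topspace K. \<theta> k a w d) \<in> carrier ?T"
        by (simp add: cotensor_simps)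
      fix d' assume d': "d' \<in> carrier (fobj D a)"
      show "(\<lambda>k\<in>topspace K. \<theta> k a w (d \<otimes>\<^bsub>fobj D a\<^esub> d')) =
          (\<lambda>k\<in>topspace K. \<theta> k a w d) \<otimes>\<^bsub>?T\<^esub> (\<lambda>k\<in>topspace K. \<theta> k a w d')"
        using cont_homD(2)[OF \<theta>hom[OF _ a w] d d'] by (auto simp: cotensor_simps intro!: restrict_ext)
    next
      fix a w assume a: "a \<in> Obj A" and w: "w \<in> pt a"
      show "(\<lambda>k\<in>topspace K. \<theta> k a w \<one>\<^bsub>fobj D a\<^esub>) = \<one>\<^bsub>?T\<^esub>"
        using cont_homD(3)[OF \<theta>hom[OF _ a w]] by (auto simp: cotensor_simps intro!: restrict_ext)
    next
      fix a d assume a: "a \<in> Obj A" and d: "d \<in> carrier (fobj D a)"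
      show "(\<lambda>k\<in>topspace K. \<theta> k a (bpt (fobj W a)) d) = \<one>\<^bsub>?T\<^esub>"
        using nat_\<theta>(2)[OF _ a] d by (auto simp: cotensor_simps intro!: restrict_ext)
    next
      fix a b f w d assume ab: "a \<in> Obj A" "b \<in> Obj A" "f \<in> Mor A b a" "w \<in> pt a" and d: "d \<in> carrier (fobj D b)"
      show "(\<lambda>k\<in>topspace K. \<theta> k a w (fmap D b a f d)) = (\<lambda>k\<in>topspace K. \<theta> k b (fmap W a b f w) d)"
      proof (rule restrict_ext)
        fix k assume "k \<in> topspace K"
        then show "\<theta> k a w (fmap D b a f d) = \<theta> k b (fmap W a b f w) d"
          using fun_cong[OF nat_\<theta>(3)[OF _ ab], of k d] d by (simp add: compose_def)
      qed
    qed
    \<comment> \<open>The universal property of \<open>C\<close> is tested on monoids over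
      \<open>'u\<close>, but the cotensor is carried by functions; the factorisation is found into
      the copy \<open>N\<close> and brought back by \<open>g\<close>.\<close>
    obtain N :: "'u top_monoid" and e g where N: "topological_monoid u N"
      and e: "e \<in> cont_hom ?T N" and g: "g \<in> cont_hom N ?T" and ge: "\<And>x. x \<in> carrier ?T \<Longrightarrow> g (e x) = x"
      by (rule small_copy[OF T]) (rule that)
    obtain f where f: "f \<in> cont_hom C N"
      "\<forall>a\<in>Obj A. \<forall>w\<in>pt a. \<forall>d\<in>carrier (fobj D a). f (\<eta> a w d) = e (\<lambda>k\<in>topspace K. \<theta> k a w d)"
      by (rule universal_cocone_factor[OF C N cocone_compose[OF cocone_T e]])
    have G: "(\<lambda>c. g (f c)) \<in> cont_hom C ?T"
      by (rule cont_hom_compose[OF f(1) g])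
    have G_factors: "?factors (\<theta> k) (\<lambda>c. g (f c) k)" if k: "k \<in> topspace K" for k
    proof (intro conjI ballI)
      show "(\<lambda>c. g (f c) k) \<in> cont_hom C X"
        by (rule cont_hom_compose[OF G cotensor_eval[OF K X k]])
      show "g (f (\<eta> a w d)) k = \<theta> k a w d" if "a \<in> Obj A" "w \<in> pt a" "d \<in> carrier (fobj D a)" for a w d
        using f(2) that ge[OF coconeD(1)[OF cocone_T that]] k by simp
    qed
    show some: "?factors (\<theta> k) (SOME f. ?factors (\<theta> k) f)" if k: "k \<in> topspace K" for k
      by (rule someI[of "?factors (\<theta> k)", OF G_factors[OF k]])
    \<comment> \<open>Uniqueness identifies the choices made for the single \<open>k\<close> with
      the evaluations at \<open>k\<close> of one homomorphism into the cotensor, and so makes them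
      vary continuously.\<close>
    have eq: "(SOME f. ?factors (\<theta> k) f) c = g (f c) k" if k: "k \<in> topspace K" and c: "c \<in> carrier C" for k c
      by (rule universal_cocone_unique[OF C X conjunct1[OF some[OF k]] conjunct1[OF G_factors[OF k]] _ c])
        (use some[OF k] G_factors[OF k] in simp)
    show "continuous_map K (btop (hom_space u C X)) (\<lambda>k. ?\<psi> (\<theta> k))"
      unfolding probe_hom_space[OF C'(2) K]
    proof (intro conjI joint_probesI)
      show "(\<lambda>k. ?\<psi> (\<theta> k)) \<in> topspace K \<rightarrow> ext_cont_hom C X"
        using ext_cont_homI[OF universal_coconeD(1)[OF C] conjunct1[OF some]] by blast
      fix P p c assume P: "test u P" and p: "continuous_map P K p" and c: "continuous_map P (mtop C) c"
      \<comment> \<open>A probe of \<open>C\<close> is sent to a probe of the cotensor, whose joint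
        continuity in its argument from \<open>K\<close> covers the element of \<open>C\<close> and
        the parameter together.\<close>
      have "joint_probes u P K (mtop X) (\<lambda>l. g (f (c l)))"
        using probe_cont_hom[OF G c] unfolding probe_cotensor[OF K P] by simp
      then have "continuous_map P (mtop X) (\<lambda>l. g (f (c l)) (p l))"
        using joint_probesD[of u P K "mtop X" "\<lambda>l. g (f (c l))" P "\<lambda>l. l" p] P p by simp
      then show "continuous_map P (mtop X) (\<lambda>l. ?\<psi> (\<theta> (p l)) (c l))"
        by (rule continuous_map_eq)
          (use eq funcset_mem[OF continuous_map_funspace[OF c]] funcset_mem[OF continuous_map_funspace[OF p]] C'(2)
            in simp)
    qed
  qed
  have "homeomorphic_map (btop (hom_space u C X)) (btop ?N) ?\<phi>"
  proof (rule probes_homeomorphic_map[OF kspace_hom_space kspace_nat_trans_space \<phi>_probe \<psi>_probe])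
    fix f assume "f \<in> topspace (btop (hom_space u C X))"
    then have f: "f \<in> ext_cont_hom C X"
      using C'(2) by simp
    then have f': "f \<in> cont_hom C X"
      by (simp add: ext_cont_hom_def)
    then have "?factors (?\<phi> f) f"
      by simp
    then have some: "?factors (?\<phi> f) (SOME f'. ?factors (?\<phi> f) f')"
      by (rule someI[of "?factors (?\<phi> f)"])
    have "(SOME f'. ?factors (?\<phi> f) f') c = f c" if c: "c \<in> carrier C" for c
      by (rule universal_cocone_unique[OF C X conjunct1[OF some] f' _ c]) (use some in simp)
    then have "?\<psi> (?\<phi> f) = restrict f (carrier C)"
      by (intro restrict_ext)
    then show "?\<psi> (?\<phi> f) = f"
      using f by (simp add: ext_cont_hom_def extensional_restrict)
  next
    fix \<theta> assume \<theta>: "\<theta> \<in> topspace (btop ?N)"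
    have some: "?factors \<theta> (SOME f. ?factors \<theta> f)"
      using factors[of "discrete_topology {undefined}" "\<lambda>_. \<theta>" undefined, OF test_sing] \<theta> by simp
    have "?\<psi> \<theta> (\<eta> a w d) = \<theta> a w d" if "a \<in> Obj A" "w \<in> pt a" "d \<in> carrier (fobj D a)" for a w d
      using some that coconeD(1)[OF \<eta> that] by simp
    then have "?\<phi> (?\<psi> \<theta>) = (\<lambda>a\<in>Obj A. \<lambda>w\<in>pt a. \<lambda>d\<in>carrier (fobj D a). \<theta> a w d)"
      by (intro restrict_ext)
    also have "\<dots> = \<theta>"
    proof -
      have "\<theta> \<in> PiE (Obj A) (\<lambda>a. PiE (pt a) (\<lambda>_. ext_cont_hom (fobj D a) X))"
        using \<theta> probe[OF test_sing, of undefined "\<lambda>_. \<theta>"] nat[of \<theta>] by simp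
      then have *: "\<theta> \<in> extensional (Obj A)" "a \<in> Obj A \<Longrightarrow> \<theta> a \<in> extensional (pt a)"
        "a \<in> Obj A \<Longrightarrow> w \<in> pt a \<Longrightarrow> \<theta> a w \<in> extensional (carrier (fobj D a))" for a w
        by (auto simp: PiE_iff ext_cont_hom_def)
      have "(\<lambda>a\<in>Obj A. \<lambda>w\<in>pt a. \<lambda>d\<in>carrier (fobj D a). \<theta> a w d) = (\<lambda>a\<in>Obj A. \<lambda>w\<in>pt a. \<theta> a w)"
        using *(3) by (intro restrict_ext) (simp add: extensional_restrict)
      also have "\<dots> = (\<lambda>a\<in>Obj A. \<theta> a)"
        using *(2) by (intro restrict_ext) (simp add: extensional_restrict)
      finally show ?thesis
        using *(1) by (simp add: extensional_restrict)
    qed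
    finally show "?\<phi> (?\<psi> \<theta>) = \<theta>" .
  qed
  moreover have "?\<phi> (bpt (hom_space u C X)) = bpt ?N"
    unfolding bpt_nat_trans_space bpt_hom_space hom_from_def Hom
    using coconeD(1)[OF \<eta>] by (auto simp: bpt_hom_space intro!: restrict_ext)
  ultimately show "based_iso (Hom R C X) ?N ?\<phi>"
    unfolding based_iso_def Hom by blast
next
  fix X Y h f
  show "(\<lambda>a\<in>Obj A. \<lambda>w\<in>pt a. \<lambda>d\<in>carrier (fobj D a). Cmp R C X Y h f (\<eta> a w d)) =
      (\<lambda>a\<in>Obj A. \<lambda>w\<in>pt a. Cmp R (fobj D a) X Y h
        ((\<lambda>a\<in>Obj A. \<lambda>w\<in>pt a. \<lambda>d\<in>carrier (fobj D a). f (\<eta> a w d)) a w))"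
    using coconeD(1)[OF universal_coconeD(2)[OF C]] unfolding Cmp
    by (intro restrict_ext) (auto simp: compose_def intro!: restrict_ext)
qed

end

section \<open>Existence of limits and colimits, and the forgetful functor\<close>

section \<open>Completeness, cocompleteness and preservation of colimits\<close>

context universe
begin

lemma functor_map:
  assumes "topp_functor u A B F" "a \<in> Obj A" "b \<in> Obj A" "f \<in> Mor A a b"
  shows "fmap F a b f \<in> Mor B (fobj F a) (fobj F b)"
proof -
  have "based_map (Hom A a b) (Hom B (fobj F a) (fobj F b)) (fmap F a b)"
    using assms(1-3) unfolding topp_functor_def by blast
  then show ?thesis
    using assms(4) continuous_map_funspace unfolding based_map_def by blast
qed

lemma functor_Topp:
  assumes F: "topp_functor u A (Topp u) F" and "a \<in> Obj A"
  shows "based_kspace u (fobj F a)"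
    and "b \<in> Obj A \<Longrightarrow> f \<in> Mor A a b \<Longrightarrow> x \<in> topspace (btop (fobj F a)) \<Longrightarrow>
      fmap F a b f x \<in> topspace (btop (fobj F b))"
proof -
  have "fobj F a \<in> Obj (Topp u)"
    using assms unfolding topp_functor_def by blast
  then show "based_kspace u (fobj F a)"
    by (simp add: Topp_def)
  assume b: "b \<in> Obj A" and f: "f \<in> Mor A a b" and x: "x \<in> topspace (btop (fobj F a))"
  have "fmap F a b f \<in> based_maps (fobj F a) (fobj F b)"
    using functor_map[OF F assms(2) b f] by (simp add: Topp_def)
  then show "fmap F a b f x \<in> topspace (btop (fobj F b))"
    using subsetD[OF based_maps_subset] x by (blast dest: PiE_mem)
qed

lemma weightedI:
  assumes "small u (Obj A)" and W: "\<And>a. a \<in> Obj A \<Longrightarrow> based_kspace u (fobj W a)"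
    and D: "topp_functor u A R D" and Hom: "Hom R = hom_space u" and Obj: "Obj R \<subseteq> Collect (topological_monoid u)"
  shows "weighted u A W D"
proof
  have D_obj: "topological_monoid u (fobj D a)" if "a \<in> Obj A" for a
    using D Obj that unfolding topp_functor_def by blast
  then show "topological_monoid u (fobj D a)" if "a \<in> Obj A" for a
    using that .
  show "fmap D a b f \<in> cont_hom (fobj D a) (fobj D b)"
    if "a \<in> Obj A" "b \<in> Obj A" "f \<in> Mor A a b" for a b f
    using functor_map[OF D that] topological_monoidD(2)[OF D_obj[OF that(1)]]
    by (simp add: Hom ext_cont_hom_def)
qed (use assms in auto)

lemma limit_dataI:
  assumes "small u (Obj A)" and W: "topp_functor u A (Topp u) W"
    and D: "topp_functor u A R D" and R: "Hom R = hom_space u" "Obj R \<subseteq> Collect (topological_monoid u)"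
  shows "limit_data u A W D"
  by (rule limit_data.intro[OF weightedI[OF assms(1) functor_Topp(1)[OF W] D R]])
    (auto simp: limit_data_axioms_def functor_Topp(2)[OF W])

lemma colimit_dataI:
  assumes "small u (Obj A)" and W: "topp_functor u (eop A) (Topp u) W"
    and D: "topp_functor u A R D" and R: "Hom R = hom_space u" "Obj R \<subseteq> Collect (topological_monoid u)"
  shows "colimit_data u A W D"
  by (rule colimit_data.intro[OF weightedI[OF assms(1) _ D R]])
    (use functor_Topp[OF W] in \<open>auto simp: colimit_data_axioms_def\<close>)

lemma Cmp_Tmon: "Cmp (Tmon u) = (\<lambda>M N P g f. compose (carrier M) g f)"
  and Cmp_Tgrp: "Cmp (Tgrp u) = (\<lambda>M N P g f. compose (carrier M) g f)"
  by (simp_all add: Tmon_def Tgrp_def)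

text \<open>The cases for \<open>Obj\<close> differ only in the proof of
  \<open>L \<in> Obj R\<close>: a pointwise inverse makes the limit of groups a group, and
  \<open>small_copy\<close> preserves this.\<close>

lemma indexed_limit_exists:
  fixes R :: "('u top_monoid, 'u \<Rightarrow> 'u) ecat"
  assumes A: "small u (Obj A)" and W: "topp_functor u A (Topp u) W" and D: "topp_functor u A R D"
    and Hom: "Hom R = hom_space u" and Cmp: "Cmp R = (\<lambda>M N P g f. compose (carrier M) g f)"
    and Obj: "Obj R = Collect (topological_monoid u) \<or> Obj R = Collect (topological_group u)"
  shows "\<exists>L \<phi>. is_indexed_limit u R A W D L \<phi>"
proof -
  have Obj_R: "Obj R \<subseteq> Collect (topological_monoid u)"
    using Obj topological_groupD(1) by auto
  interpret limit_data u A W D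
    by (rule limit_dataI[OF A W D Hom Obj_R])
  obtain L :: "'u top_monoid" and e g where L: "topological_monoid u L"
    and grp: "topological_group u lim_monoid \<Longrightarrow> topological_group u L"
    and e: "e \<in> cont_hom lim_monoid L" and g: "g \<in> cont_hom L lim_monoid"
    and ge: "\<And>x. x \<in> carrier lim_monoid \<Longrightarrow> g (e x) = x" and eg: "\<And>y. y \<in> carrier L \<Longrightarrow> e (g y) = y"
    by (rule small_copy[OF topological_monoid_lim]) (rule that)
  have "L \<in> Obj R"
    using Obj
  proof
    assume Obj: "Obj R = Collect (topological_group u)"
    have "topological_group u (fobj D a)" if "a \<in> Obj A" for a
      using D Obj that unfolding topp_functor_def by blast
    then show ?thesis
      using Obj grp topological_group_lim by blast
  qed (use L in simp)
  then show ?thesis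
    using is_indexed_limit_copy[OF L e g ge eg Hom Cmp Obj_R] by blast
qed

lemma indexed_colimit_exists:
  fixes R :: "('u top_monoid, 'u \<Rightarrow> 'u) ecat"
  assumes A: "small u (Obj A)" and W: "topp_functor u (eop A) (Topp u) W" and D: "topp_functor u A R D"
    and Hom: "Hom R = hom_space u" and Cmp: "Cmp R = (\<lambda>M N P g f. compose (carrier M) g f)"
    and Obj: "Obj R = Collect (topological_monoid u) \<or> Obj R = Collect (topological_group u)"
  shows "\<exists>C \<phi>. is_indexed_colimit u R A W D C \<phi>"
proof -
  have Obj_R: "Obj R \<subseteq> Collect (topological_monoid u)"
    using Obj topological_groupD(1) by auto
  interpret colimit_data u A W D
    by (rule colimit_dataI[OF A W D Hom Obj_R])
  obtain C :: "'u top_monoid" and \<eta> where C: "universal_cocone C \<eta>"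
    by (rule universal_cocone_copy[OF universal_cocone_generated])
  have "C \<in> Obj R"
    using Obj
  proof
    assume Obj: "Obj R = Collect (topological_group u)"
    have "topological_group u (fobj D a)" if "a \<in> Obj A" for a
      using D Obj that unfolding topp_functor_def by blast
    then show ?thesis
      using Obj topological_group_universal_cocone[OF C] by blast
  qed (use universal_coconeD(1)[OF C] in simp)
  then show ?thesis
    using is_indexed_colimit_universal_cocone[OF C Hom Cmp Obj_R] by blast
qed

lemma topp_complete_Tmon: "topp_complete u (Tmon u)"
  and topp_complete_Tgrp: "topp_complete u (Tgrp u)"
  unfolding topp_complete_def using topp_category_Tmon topp_category_Tgrp
  by (auto intro!: indexed_limit_exists simp: Cmp_Tmon Cmp_Tgrp)

lemma topp_cocomplete_Tmon: "topp_cocomplete u (Tmon u)"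
  and topp_cocomplete_Tgrp: "topp_cocomplete u (Tgrp u)"
  unfolding topp_cocomplete_def using topp_category_Tmon topp_category_Tgrp
  by (auto intro!: indexed_colimit_exists simp: Cmp_Tmon Cmp_Tgrp)

lemma efun_comp_forget: "efun_comp forget D = D" "fobj forget = (\<lambda>G. G)" "fmap forget a b f = f"
  by (simp_all add: efun_comp_def forget_def)

text \<open>
  Homomorphisms from a topological group to a monoid \<open>X\<close> are homomorphisms to its group of units,
  with the same topology, so the colimit in groups represents cocones into \<open>X\<close> through the units.
\<close>

lemma is_indexed_colimit_forget:
  fixes D :: "('i, 'j, 'u top_monoid, 'u \<Rightarrow> 'u) efun"
  assumes D: "topp_functor u A (Tgrp u) D" and C: "is_indexed_colimit u (Tgrp u) A W D C \<phi>"
  shows "is_indexed_colimit u (Tmon u) A W D C (\<lambda>X. \<phi> (units_monoid X))"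
  unfolding is_indexed_colimit_def
proof (intro conjI ballI)
  have D_obj: "topological_group u (fobj D a)" if "a \<in> Obj A" for a
    using D that unfolding topp_functor_def by auto
  have C_grp: "topological_group u C"
    using C unfolding is_indexed_colimit_def by simp
  note C_mon = topological_groupD(1)[OF C_grp]
  show "C \<in> Obj (Tmon u)"
    using C_mon by simp
  \<comment> \<open>The functors compared take equal values by
    \<open>hom_space_units_monoid\<close>, so \<open>\<phi> (units_monoid X)\<close> is already a
    map between the required spaces and needs no correction.\<close>
  have N: "nat_trans_space u (eop A) W (hom_from (Tgrp u) D (units_monoid X)) =
      nat_trans_space u (eop A) W (hom_from (Tmon u) D X)" if X: "topological_monoid u X" for X
  proof (rule nat_trans_space_cong)
    show "fobj (hom_from (Tgrp u) D (units_monoid X)) a = fobj (hom_from (Tmon u) D X) a" if "a \<in> Obj (eop A)" for a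
      using hom_space_units_monoid[OF D_obj X] that by (simp add: hom_from_def)
    show "fmap (hom_from (Tgrp u) D (units_monoid X)) a b f x = fmap (hom_from (Tmon u) D X) a b f x"
      if "a \<in> Obj (eop A)" for a b f x
      using hom_space_units_monoid[OF D_obj X] that by (simp add: hom_from_def)
  qed
  have iso: "based_iso (hom_space u C (units_monoid X))
      (nat_trans_space u (eop A) W (hom_from (Tgrp u) D (units_monoid X))) (\<phi> (units_monoid X))"
    if "topological_monoid u X" for X
    using C topological_group_units_monoid[OF that] unfolding is_indexed_colimit_def by simp
  fix X assume "X \<in> Obj (Tmon u)"
  then have X: "topological_monoid u X"
    by simp
  show "based_iso (Hom (Tmon u) C X) (nat_trans_space u (eop A) W (hom_from (Tmon u) D X)) (\<phi> (units_monoid X))"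
    using iso[OF X] by (simp add: N[OF X] hom_space_units_monoid[OF C_grp X])
  fix Y h f assume "Y \<in> Obj (Tmon u)" and "h \<in> Mor (Tmon u) X Y" and "f \<in> Mor (Tmon u) C X"
  then have Y: "topological_monoid u Y" and h: "h \<in> cont_hom X Y" and f: "f \<in> ext_cont_hom C X"
    using topological_monoidD(2)[OF X] topological_monoidD(2)[OF C_mon] by (simp_all add: ext_cont_hom_def)
  note UX = topological_group_units_monoid[OF X] and UY = topological_group_units_monoid[OF Y]
  \<comment> \<open>Naturality of \<open>\<phi>\<close> is available along morphisms of groups only.
    A homomorphism preserves units, so its restriction is such a morphism, and it has the same
    composites as \<open>h\<close> with maps that take values in the units.\<close>
  let ?h = "restrict h (Units X)"
  have h': "?h \<in> ext_cont_hom (units_monoid X) (units_monoid Y)"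
    using ext_cont_homI[OF topological_groupD(1)[OF UX], of h "units_monoid Y"]
      cont_hom_compose[OF units_monoid_incl[OF X] h] cont_hom_units_monoid[OF UX Y] by simp
  have f': "f \<in> ext_cont_hom C (units_monoid X)"
    using f cont_hom_units_monoid[OF C_grp X] by (simp add: ext_cont_hom_def)
  have "compose (carrier C) h f = compose (carrier C) ?h f"
    using f' by (auto simp: compose_def ext_cont_hom_def dest: cont_homD(1) intro!: restrict_ext)
  moreover have "\<phi> (units_monoid Y) (compose (carrier C) ?h f) = (\<lambda>a\<in>Obj A. \<lambda>w\<in>topspace (btop (fobj W a)).
      compose (carrier (fobj D a)) ?h (\<phi> (units_monoid X) f a w))"
    using C UX UY h' f' topological_monoidD(2)[OF topological_groupD(1)[OF UX]] topological_monoidD(2)[OF C_mon]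
    unfolding is_indexed_colimit_def by simp
  \<comment> \<open>Nothing is known about \<open>\<phi>\<close> beyond its universal property; that
    its components take values in the units is read off from its target space.\<close>
  moreover have "compose (carrier (fobj D a)) ?h (\<phi> (units_monoid X) f a w) =
      compose (carrier (fobj D a)) h (\<phi> (units_monoid X) f a w)"
    if a: "a \<in> Obj A" and w: "w \<in> topspace (btop (fobj W a))" for a w
  proof -
    let ?N = "nat_trans_space u (eop A) W (hom_from (Tgrp u) D (units_monoid X))"
    have "homeomorphic_map (btop (hom_space u C (units_monoid X))) (btop ?N) (\<phi> (units_monoid X))"
      using iso[OF X] by (simp add: based_iso_def)
    then have "\<phi> (units_monoid X) f \<in> topspace (btop ?N)"
      using f' topological_monoidD(2)[OF C_mon] homeomorphic_imp_surjective_map by fastforce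
    then have "\<phi> (units_monoid X) f a \<in> based_maps (fobj W a) (hom_space u (fobj D a) (units_monoid X))"
      using a unfolding topspace_nat_trans_space by (auto simp: hom_from_def PiE_iff)
    then have "\<phi> (units_monoid X) f a w \<in> ext_cont_hom (fobj D a) (units_monoid X)"
      using w subsetD[OF based_maps_subset] topological_monoidD(2)[OF topological_groupD(1)[OF D_obj[OF a]]]
      by (fastforce dest: PiE_mem)
    then show ?thesis
      by (auto simp: compose_def ext_cont_hom_def dest: cont_homD(1) intro!: restrict_ext)
  qed
  ultimately show "\<phi> (units_monoid Y) (Cmp (Tmon u) C X Y h f) = (\<lambda>a\<in>Obj A. \<lambda>w\<in>topspace (btop (fobj W a)).
      Cmp (Tmon u) (fobj D a) X Y h (\<phi> (units_monoid X) f a w))"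
    by (auto intro!: restrict_ext)
qed

lemma preserves_indexed_colimits_forget: "preserves_indexed_colimits u (Tgrp u) (Tmon u) forget"
  unfolding preserves_indexed_colimits_def
proof (intro conjI allI impI topp_functor_forget)
  fix A :: "('u, 'u) ecat" and W :: "('u, 'u, 'u based, 'u \<Rightarrow> 'u) efun"
    and D :: "('u, 'u, 'u top_monoid, 'u \<Rightarrow> 'u) efun" and C \<phi>
  assume "small u (Obj A) \<and> topp_functor u (eop A) (Topp u) W \<and> topp_functor u A (Tgrp u) D \<and>
    is_indexed_colimit u (Tgrp u) A W D C \<phi>"
  then have D: "topp_functor u A (Tgrp u) D" and C: "is_indexed_colimit u (Tgrp u) A W D C \<phi>"
    by auto
  then have "topological_group u C"
    unfolding is_indexed_colimit_def by simp
  then show "\<exists>\<psi>. is_indexed_colimit u (Tmon u) A W (efun_comp forget D) (fobj forget C) \<psi> \<and>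
      (\<forall>a\<in>Obj A. \<forall>w\<in>topspace (btop (fobj W a)).
        \<psi> (fobj forget C) (Idn (Tmon u) (fobj forget C)) a w =
          fmap forget (fobj D a) C (\<phi> C (Idn (Tgrp u) C) a w))"
    \<comment> \<open>As \<open>C\<close> is a group, \<open>units_monoid_group\<close> turns
      \<open>\<phi> (units_monoid C)\<close> into \<open>\<phi> C\<close>, so the units of the two
      colimits agree literally.\<close>
    using is_indexed_colimit_forget[OF D C]
    by (intro exI[of _ "\<lambda>X. \<phi> (units_monoid X)"]) (simp add: efun_comp_forget units_monoid_group)
qed

end

theorem proposition2p10:
  assumes "universe_type TYPE('u)"
  shows "topp_complete TYPE('u) (Tmon TYPE('u)) \<and> topp_cocomplete TYPE('u) (Tmon TYPE('u)) \<and>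
         topp_complete TYPE('u) (Tgrp TYPE('u)) \<and> topp_cocomplete TYPE('u) (Tgrp TYPE('u)) \<and>
         preserves_indexed_colimits TYPE('u) (Tgrp TYPE('u)) (Tmon TYPE('u)) forget"
proof -
  interpret universe "TYPE('u)"
    by (rule universe.intro[OF assms])
  show ?thesis
    using topp_complete_Tmon topp_cocomplete_Tmon topp_complete_Tgrp topp_cocomplete_Tgrp
      preserves_indexed_colimits_forget by blast
qed

end
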